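(* Let $0<H<1$ and let $(X^H_t)_{t\in\mathbb R}$ be an $\mathbb R^d$-valued fractional Brownian motion on a probability space $\Omega$, that is, a continuous centered Gaussian process indexed by $\mathbb R$ with covariance $$\mathbb E(X^{H,i}_sX^{H,j}_t)=\delta_{ij}\,\kappa_H\left[|t|^{2H}+|s|^{2H}-|t-s|^{2H}\right],\qquad \kappa_H=[2\Gamma(2H+1)\sin(\pi H)]^{-1}.$$ Then there exists on $\Omega$ an $\mathbb R^d$-valued standard Brownian motion $(B_t)_{t\in\mathbb R}$ such that for every $t\in\mathbb R$, almost surely, $$X^H_t=\int_{\mathbb R}[S(u)-S(u-t)]\,dB_u .$$
   Context: Put $\alpha=H+1/2$. For $\alpha\ne1$, $S(t)=\frac{|t|^{\alpha-1}}{2\Gamma(\alpha)\cos(\pi\alpha/2)}$; for $\alpha=1$, $S(t)=-\frac1\pi\log|t|$ (only differences of values of $S$ are used), so that $u\mapsto S(u)-S(u-t)$ is in $L^2(du)$ for every $t$. A standard Brownian motion indexed by $\mathbb R$ is two-sided with $B_0=0$, and the integral with respect to $dB_u$ is the Wiener integral. *)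

theory Defs
  imports "HOL-Probability.Probability"
begin

text \<open>Gaussian laws on the line include the degenerate ones, so that an arbitrary linear
  combination of the variables of a Gaussian process has a Gaussian law.\<close>

definition gaussian_law :: "real measure \<Rightarrow> bool" where
  "gaussian_law N \<longleftrightarrow>
     (\<exists>\<mu> \<sigma>. 0 < \<sigma> \<and> N = density lborel (\<lambda>x. ennreal (normal_density \<mu> \<sigma> x))) \<or>
     (\<exists>\<mu>. N = return borel \<mu>)"

definition gaussian_process ::
    "'a measure \<Rightarrow> ('t \<Rightarrow> 'a \<Rightarrow> 'b::euclidean_space) \<Rightarrow> bool" where
  "gaussian_process M X \<longleftrightarrow>
     (\<forall>t. X t \<in> borel_measurable M) \<and>
     (\<forall>T c. finite T \<longrightarrow> gaussian_law (distr M borel (\<lambda>\<omega>. \<Sum>t\<in>T. c t \<bullet> X t \<omega>)))"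

definition continuous_paths ::
    "'a measure \<Rightarrow> (real \<Rightarrow> 'a \<Rightarrow> 'b::topological_space) \<Rightarrow> bool" where
  "continuous_paths M X \<longleftrightarrow> (\<forall>\<omega>\<in>space M. continuous_on UNIV (\<lambda>t. X t \<omega>))"

definition kappa :: "real \<Rightarrow> real" where
  "kappa H = inverse (2 * Gamma (2 * H + 1) * sin (pi * H))"

definition fractional_brownian_motion ::
    "'a measure \<Rightarrow> real \<Rightarrow> (real \<Rightarrow> 'a \<Rightarrow> real ^ 'd) \<Rightarrow> bool" where
  "fractional_brownian_motion M H X \<longleftrightarrow>
     gaussian_process M X \<and>
     continuous_paths M X \<and>
     (\<forall>t i. (\<integral>\<omega>. X t \<omega> $ i \<partial>M) = 0) \<and>
     (\<forall>s t i j. (\<integral>\<omega>. X s \<omega> $ i * X t \<omega> $ j \<partial>M) =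
        (if i = j
         then kappa H * (\<bar>t\<bar> powr (2 * H) + \<bar>s\<bar> powr (2 * H) - \<bar>t - s\<bar> powr (2 * H))
         else 0))"

text \<open>Two-sided standard Brownian motion.  The independence clause is joint in the time
  intervals and the coordinates, so it also makes the coordinate processes independent.\<close>

definition standard_brownian_motion ::
    "'a measure \<Rightarrow> (real \<Rightarrow> 'a \<Rightarrow> real ^ 'd) \<Rightarrow> bool" where
  "standard_brownian_motion M B \<longleftrightarrow>
     (\<forall>t. B t \<in> borel_measurable M) \<and>
     continuous_paths M B \<and>
     (\<forall>\<omega>\<in>space M. B 0 \<omega> = 0) \<and>
     (\<forall>s t i. s < t \<longrightarrow>
        distributed M lborel (\<lambda>\<omega>. B t \<omega> $ i - B s \<omega> $ i) (normal_density 0 (sqrt (t - s)))) \<and>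
     (\<forall>(n::nat) \<tau>. strict_mono_on {..n} \<tau> \<longrightarrow>
        prob_space.indep_vars M (\<lambda>_. borel)
          (\<lambda>(k, i) \<omega>. B (\<tau> (Suc k)) \<omega> $ i - B (\<tau> k) \<omega> $ i) ({..<n} \<times> UNIV))"

text \<open>A step function is coded by a list of triples \<open>(c, a, b)\<close> with \<open>a \<le> b\<close>, each standing
  for \<open>c\<close> times the indicator of the interval from \<open>a\<close> (excluded) to \<open>b\<close> (included).\<close>

type_synonym step_code = "(real \<times> real \<times> real) list"

definition valid_step :: "step_code \<Rightarrow> bool" where
  "valid_step p \<longleftrightarrow> (\<forall>(c, a, b)\<in>set p. a \<le> b)"

definition step_fun :: "step_code \<Rightarrow> real \<Rightarrow> real" where
  "step_fun p u = (\<Sum>(c, a, b)\<leftarrow>p. c * indicator {a<..b} u)"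

definition step_integral ::
    "(real \<Rightarrow> 'a \<Rightarrow> 'b::real_vector) \<Rightarrow> step_code \<Rightarrow> 'a \<Rightarrow> 'b" where
  "step_integral B p \<omega> = (\<Sum>(c, a, b)\<leftarrow>p. c *\<^sub>R (B b \<omega> - B a \<omega>))"

text \<open>The Wiener integral of \<open>f\<close> with respect to \<open>B\<close> is the limit in mean square of the integrals
  of step functions converging to \<open>f\<close> in mean square (whence \<open>f\<close> is square integrable).  It is
  only determined up to almost sure equality, and so is rendered as a relation:
  \<open>Y\<close> is a version of the integral.\<close>

definition has_wiener_integral ::
    "'a measure \<Rightarrow> (real \<Rightarrow> 'a \<Rightarrow> 'b::euclidean_space) \<Rightarrow> (real \<Rightarrow> real) \<Rightarrow> ('a \<Rightarrow> 'b) \<Rightarrow> bool" where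
  "has_wiener_integral M B f Y \<longleftrightarrow>
     f \<in> borel_measurable lborel \<and> Y \<in> borel_measurable M \<and>
     (\<exists>p. (\<forall>n. valid_step (p n)) \<and>
        (\<lambda>n::nat. \<integral>\<^sup>+u. ennreal ((step_fun (p n) u - f u)\<^sup>2) \<partial>lborel) \<longlonglongrightarrow> 0 \<and>
        (\<lambda>n::nat. \<integral>\<^sup>+\<omega>. ennreal ((norm (step_integral B (p n) \<omega> - Y \<omega>))\<^sup>2) \<partial>M) \<longlonglongrightarrow> 0)"

text \<open>The kernel, with \<open>\<alpha> = H + 1/2\<close>.  Its value at \<open>t = 0\<close> (which is \<open>0\<close> by the library's
  conventions) plays no role.\<close>

definition S_kernel :: "real \<Rightarrow> real \<Rightarrow> real" where
  "S_kernel \<alpha> t =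
     (if \<alpha> = 1 then - (1 / pi) * ln \<bar>t\<bar>
      else \<bar>t\<bar> powr (\<alpha> - 1) / (2 * Gamma \<alpha> * cos (pi * \<alpha> / 2)))"

end

theory Submission imports Defs begin

text \<open>Put \<open>\<alpha> = H + 1/2\<close>, \<open>k t u = S u - S (u - t)\<close>, and let \<open>\<sigma> s\<close> be the indicator of the interval from
  \<open>0\<close> to \<open>s\<close>, counted negatively for \<open>s < 0\<close>.  Formally, the Fourier transforms of \<open>k t\<close> and
  \<open>\<sigma> s\<close> are, up to the sign of the frequency,
  \<open>|\<xi>| powr - \<alpha> * (1 - cis (t * \<xi>))\<close> and \<open>(cis (s * \<xi>) - 1) / (\<i> * \<xi>)\<close>.
  Being Hermitian, they are determined by their values for \<open>\<xi> > 0\<close>; up to constants these are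
  the functions \<open>e t = spectral H 1 t\<close> and \<open>b s = spectral (1/2) \<i> s\<close> of the real Hilbert space
  \<open>E\<close> of square integrable complex functions on the half line.  Three scalar products in \<open>E\<close>
  carry the proof.
  \<^item> \<open>\<langle>e s, e t\<rangle>\<close> is the covariance of the fractional Brownian motion
    (\<open>spectral_gram\<close>), so that \<open>e t\<close> corresponds isometrically to \<open>X t\<close>.
  \<^item> \<open>\<langle>b s, b r\<rangle>\<close> is the covariance of Brownian motion, and also the scalar product of \<open>\<sigma> s\<close>
    and \<open>\<sigma> r\<close> (\<open>spectral_half_gram\<close>, \<open>signed_ind_gram\<close>).
  \<^item> \<open>\<langle>e t, b s\<rangle>\<close> is the integral of \<open>k t\<close> from \<open>0\<close> to \<open>s\<close> (\<open>spectral_cross\<close>,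
    \<open>signed_ind_S_kernel\<close>).

  Moreover every element of \<open>E\<close> that is continuous on the open half line is a limit of real
  combinations of the \<open>e t\<close>, and likewise of the \<open>b s\<close> (\<open>spectral_dense\<close>), by Weierstrass
  approximation with trigonometric polynomials of growing period.  Everything else is soft.

  In particular, each \<open>b s\<close> is a limit of combinations of the \<open>e t\<close>; the same combinations of the \<open>X t\<close> converge in mean square to Gaussian variables with the covariance of a
  Brownian motion (\<open>gram_transfer\<close>, \<open>fractional_brownian_motion_whitening\<close>).  A continuous
  version of this family is the process \<open>B\<close>: orthogonal jointly Gaussian increments are independent
  (\<open>indep_vars_orthogonal\<close>), and fourth moments give continuity (\<open>continuous_version\<close>).  No
  enlargement of the probability space is needed because \<open>B\<close> is built from \<open>X\<close> alone.

  Conversely, \<open>e t\<close> is a limit of combinations of the \<open>b s\<close>.  The same combinations of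
  the \<open>B s\<close> converge to \<open>X t\<close> by isometry.  The same combinations of the \<open>\<sigma> s\<close>, which are step
  functions, converge to some square integrable \<open>g\<close> whose integral from \<open>0\<close> to \<open>s\<close> is
  \<open>\<langle>e t, b s\<rangle>\<close> for every \<open>s\<close>, so that \<open>g = k t\<close> almost everywhere (\<open>kernel_approx\<close>).  This says
  that \<open>X t\<close> is the Wiener integral of \<open>k t\<close>.  In particular, the square integrability of \<open>k t\<close>
  is a result of the argument, and the norm of \<open>k t\<close> is never computed.\<close>

section \<open>Square integrable functions and transfer along equal Gram matrices\<close>

definition sq_int :: "'a measure \<Rightarrow> ('a \<Rightarrow> 'b::euclidean_space) \<Rightarrow> bool" where
  "sq_int M f \<longleftrightarrow> f \<in> borel_measurable M \<and> integrable M (\<lambda>x. f x \<bullet> f x)"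

definition ip :: "'a measure \<Rightarrow> ('a \<Rightarrow> 'b::euclidean_space) \<Rightarrow> ('a \<Rightarrow> 'b) \<Rightarrow> real" where
  "ip M f g = (\<integral>x. f x \<bullet> g x \<partial>M)"

text \<open>Combinations are coded by lists with possible repetitions, so that concatenation is addition and
  no bookkeeping of supports is needed.\<close>

definition lincomb :: "(real \<times> 'i) list \<Rightarrow> ('i \<Rightarrow> 'v::real_vector) \<Rightarrow> 'v" where
  "lincomb l F = (\<Sum>(c, i)\<leftarrow>l. c *\<^sub>R F i)"

lemma lincomb_simps [simp]:
  "lincomb [] F = 0"
  "lincomb ((c, i) # l) F = c *\<^sub>R F i + lincomb l F"
  "lincomb (l @ l') F = lincomb l F + lincomb l' F"
  by (auto simp: lincomb_def)

lemma lincomb_scale: "lincomb (map (\<lambda>(c, i). (a * c, f i)) l) F = a *\<^sub>R lincomb l (\<lambda>i. F (f i))"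
  by (induction l) (auto simp: algebra_simps)

lemma lincomb_index: "lincomb (map (\<lambda>(c, i). (c, f i)) l) F = lincomb l (\<lambda>i. F (f i))"
  by (induction l) auto

lemma lincomb_linear: "linear h \<Longrightarrow> h (lincomb l F) = lincomb l (\<lambda>i. h (F i))"
  by (induction l) (auto simp: linear_add linear_scale linear_0)

lemma sq_int_measurable [measurable_dest]: "sq_int M f \<Longrightarrow> f \<in> borel_measurable M"
  by (simp add: sq_int_def)

lemma inner_mult_bound:
  fixes x y :: "'a::real_inner"
  shows "\<bar>x \<bullet> y\<bar> \<le> x \<bullet> x + y \<bullet> y"
proof -
  have "0 \<le> (x + y) \<bullet> (x + y)" "0 \<le> (x - y) \<bullet> (x - y)" "0 \<le> x \<bullet> x" "0 \<le> y \<bullet> y" by simp_all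
  then show ?thesis
    unfolding inner_add_left inner_add_right inner_diff_left inner_diff_right
    by (simp only: inner_commute[of y x])
qed

lemma integrable_inner:
  assumes "sq_int M f" "sq_int M g"
  shows "integrable M (\<lambda>x. f x \<bullet> g x)"
proof (rule Bochner_Integration.integrable_bound)
  show "integrable M (\<lambda>x. f x \<bullet> f x + g x \<bullet> g x)"
    using assms by (simp add: sq_int_def)
  show "(\<lambda>x. f x \<bullet> g x) \<in> borel_measurable M"
    using assms by (intro borel_measurable_inner) (auto simp: sq_int_def)
  show "AE x in M. norm (f x \<bullet> g x) \<le> norm (f x \<bullet> f x + g x \<bullet> g x)"
  proof (rule AE_I2)
    fix x show "norm (f x \<bullet> g x) \<le> norm (f x \<bullet> f x + g x \<bullet> g x)"
      using inner_mult_bound[of "f x" "g x"] by simp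
  qed
qed

lemma ip_commute: "ip M f g = ip M g f"
  by (simp add: ip_def inner_commute)

abbreviation sq_dist :: "'a measure \<Rightarrow> ('a \<Rightarrow> 'b::euclidean_space) \<Rightarrow> ('a \<Rightarrow> 'b) \<Rightarrow> real" where
  "sq_dist M f g \<equiv> ip M (\<lambda>x. f x - g x) (\<lambda>x. f x - g x)"

lemma ip_nonneg: "0 \<le> ip M f f"
  by (simp add: ip_def)

lemma sq_int_0: "sq_int M (\<lambda>x. 0)"
  by (simp add: sq_int_def)

lemma sq_int_scale:
  assumes "sq_int M f" shows "sq_int M (\<lambda>x. c *\<^sub>R f x)"
  using assms by (auto simp: sq_int_def)

lemma sq_int_add:
  assumes f: "sq_int M f" and g: "sq_int M g" shows "sq_int M (\<lambda>x. f x + g x)"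
proof -
  have "integrable M (\<lambda>x. f x \<bullet> f x + f x \<bullet> g x + f x \<bullet> g x + g x \<bullet> g x)"
    by (intro Bochner_Integration.integrable_add integrable_inner f g)
  then show ?thesis
    using f g by (auto simp: sq_int_def inner_add_left inner_add_right inner_commute algebra_simps)
qed

lemma sq_int_diff:
  assumes "sq_int M f" "sq_int M g" shows "sq_int M (\<lambda>x. f x - g x)"
  using sq_int_add[OF assms(1) sq_int_scale[OF assms(2), of "-1"]] by simp

lemma sq_int_lincomb:
  assumes "\<And>i. sq_int M (F i)" shows "sq_int M (\<lambda>x. lincomb l (\<lambda>i. F i x))"
  by (induction l) (auto intro!: sq_int_add sq_int_scale sq_int_0 assms)

lemma ip_add_left:
  assumes "sq_int M f" "sq_int M g" "sq_int M h"
  shows "ip M (\<lambda>x. f x + g x) h = ip M f h + ip M g h"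
  using assms by (simp add: ip_def inner_add_left integrable_inner)

lemma ip_scale_left: "ip M (\<lambda>x. c *\<^sub>R f x) h = c * ip M f h"
  by (simp add: ip_def)

lemma ip_diff_left:
  assumes "sq_int M f" "sq_int M g" "sq_int M h"
  shows "ip M (\<lambda>x. f x - g x) h = ip M f h - ip M g h"
  using assms by (simp add: ip_def inner_diff_left integrable_inner)

lemma ip_diff_right:
  assumes "sq_int M f" "sq_int M g" "sq_int M h"
  shows "ip M h (\<lambda>x. f x - g x) = ip M h f - ip M h g"
  using ip_diff_left[OF assms] by (simp add: ip_commute)

lemma ip_lincomb_left:
  assumes "\<And>i. sq_int M (F i)" "sq_int M g"
  shows "ip M (\<lambda>x. lincomb l (\<lambda>i. F i x)) g = lincomb l (\<lambda>i. ip M (F i) g)"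
proof (induction l)
  case Nil then show ?case by (simp add: ip_def)
next
  case (Cons a l)
  then show ?case
    using assms by (cases a) (simp add: ip_add_left ip_scale_left sq_int_lincomb sq_int_scale)
qed

lemma ip_lincomb_right:
  assumes "\<And>i. sq_int M (F i)" "sq_int M g"
  shows "ip M g (\<lambda>x. lincomb l (\<lambda>i. F i x)) = lincomb l (\<lambda>i. ip M g (F i))"
  using ip_lincomb_left[OF assms] by (simp add: ip_commute)

lemma ip_lincomb:
  assumes "\<And>i. sq_int M (F i)" "\<And>j. sq_int M (G j)"
  shows "ip M (\<lambda>x. lincomb l (\<lambda>i. F i x)) (\<lambda>x. lincomb l' (\<lambda>j. G j x)) =
    lincomb l (\<lambda>i. lincomb l' (\<lambda>j. ip M (F i) (G j)))"
  using assms by (simp add: ip_lincomb_left ip_lincomb_right sq_int_lincomb)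

lemma ip_diff_self:
  assumes "sq_int M f" "sq_int M g"
  shows "sq_dist M f g = ip M f f - 2 * ip M f g + ip M g g"
  using assms by (simp add: ip_diff_left ip_diff_right sq_int_diff ip_commute[of M g f])

lemma ip_cauchy_schwarz:
  assumes f: "sq_int M f" and g: "sq_int M g"
  shows "\<bar>ip M f g\<bar> \<le> sqrt (ip M f f) * sqrt (ip M g g)"
proof -
  have q: "0 \<le> ip M f f - 2 * c * ip M f g + c^2 * ip M g g" for c
  proof -
    have "0 \<le> sq_dist M f (\<lambda>x. c *\<^sub>R g x)" by (rule ip_nonneg)
    also have "\<dots> = ip M f f - 2 * ip M f (\<lambda>x. c *\<^sub>R g x) + ip M (\<lambda>x. c *\<^sub>R g x) (\<lambda>x. c *\<^sub>R g x)"
      by (intro ip_diff_self f sq_int_scale g)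
    finally show ?thesis
      by (simp add: ip_scale_left ip_commute[of M _ "\<lambda>x. c *\<^sub>R g x"] ip_commute[of M g f] power2_eq_square)
  qed
  have "(ip M f g)^2 \<le> ip M f f * ip M g g"
  proof (cases "ip M g g = 0")
    case True
    have "ip M f g = 0"
    proof (rule ccontr)
      assume "ip M f g \<noteq> 0"
      then show False using q[of "(ip M f f + 1) / (2 * ip M f g)"] True by simp
    qed
    then show ?thesis using True by simp
  next
    case False
    then have pos: "0 < ip M g g" using ip_nonneg[of M g] by simp
    have "0 \<le> (ip M f f - 2 * (ip M f g / ip M g g) * ip M f g + (ip M f g / ip M g g)^2 * ip M g g) * ip M g g"
      using pos q[of "ip M f g / ip M g g"] by (intro mult_nonneg_nonneg) auto
    also have "\<dots> = ip M f f * ip M g g - (ip M f g)^2"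
      using False by (simp add: field_simps power2_eq_square)
    finally show ?thesis by simp
  qed
  then have "sqrt ((ip M f g)^2) \<le> sqrt (ip M f f * ip M g g)" by (rule real_sqrt_le_mono)
  then show ?thesis by (simp add: real_sqrt_mult)
qed

definition L2_lim :: "'a measure \<Rightarrow> (nat \<Rightarrow> 'a \<Rightarrow> 'b::euclidean_space) \<Rightarrow> ('a \<Rightarrow> 'b) \<Rightarrow> bool" where
  "L2_lim M f g \<longleftrightarrow> (\<forall>n. sq_int M (f n)) \<and> sq_int M g \<and>
     (\<lambda>n. sq_dist M (f n) g) \<longlonglongrightarrow> 0"

lemma ip_lim_left:
  assumes f: "L2_lim M f g" and h: "sq_int M h"
  shows "(\<lambda>n. ip M (f n) h) \<longlonglongrightarrow> ip M g h"
proof -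
  have sq: "\<And>n. sq_int M (f n)" "sq_int M g" using f by (auto simp: L2_lim_def)
  have "(\<lambda>n. sqrt (sq_dist M (f n) g) * sqrt (ip M h h)) \<longlonglongrightarrow> sqrt 0 * sqrt (ip M h h)"
    using f by (intro tendsto_intros) (auto simp: L2_lim_def)
  then have "(\<lambda>n. sqrt (sq_dist M (f n) g) * sqrt (ip M h h)) \<longlonglongrightarrow> 0" by simp
  then have "(\<lambda>n. ip M (f n) h - ip M g h) \<longlonglongrightarrow> 0"
    by (rule Lim_null_comparison[rotated])
      (auto simp: sq h ip_diff_left[symmetric] intro!: always_eventually ip_cauchy_schwarz sq_int_diff)
  then show ?thesis by (simp add: LIM_zero_iff)
qed

lemma ip_triangle:
  assumes "sq_int M f" "sq_int M g" "sq_int M h"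
  shows "sq_dist M f h \<le>
    2 * sq_dist M f g + 2 * sq_dist M g h"
proof -
  have "0 \<le> sq_dist M (\<lambda>x. f x - g x) (\<lambda>x. g x - h x)" by (rule ip_nonneg)
  then show ?thesis
    using assms by (simp add: ip_diff_left ip_diff_right sq_int_diff ip_commute[of M g f]
      ip_commute[of M h f] ip_commute[of M h g])
qed

lemma L2_lim_Cauchy:
  assumes "L2_lim M f g" "0 < e"
  shows "\<exists>N. \<forall>m\<ge>N. \<forall>n\<ge>N. sq_dist M (f m) (f n) < e"
proof -
  have sq: "\<And>n. sq_int M (f n)" "sq_int M g" using assms by (auto simp: L2_lim_def)
  have "\<forall>\<^sub>F n in sequentially. sq_dist M (f n) g < e / 4"
    using assms by (intro order_tendstoD) (auto simp: L2_lim_def)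
  then obtain N where N: "\<And>n. n \<ge> N \<Longrightarrow> sq_dist M (f n) g < e / 4"
    by (auto simp: eventually_sequentially)
  have "sq_dist M (f m) (f n) < e" if "m \<ge> N" "n \<ge> N" for m n
  proof -
    have "sq_dist M g (f n) = sq_dist M (f n) g"
      unfolding ip_def by (rule Bochner_Integration.integral_cong)
        (auto simp: power2_norm_eq_inner[symmetric] norm_minus_commute)
    then show ?thesis
      using ip_triangle[OF sq(1) sq(2) sq(1), of m n] N[OF that(1)] N[OF that(2)] by linarith
  qed
  then show ?thesis by blast
qed

lemma nn_integral_inner_self:
  assumes "sq_int M f"
  shows "(\<integral>\<^sup>+x. ennreal (f x \<bullet> f x) \<partial>M) = ennreal (ip M f f)"
  using assms unfolding ip_def by (intro nn_integral_eq_integral) (auto simp: sq_int_def)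

text \<open>The Riesz-Fischer theorem: along a subsequence the increments \<open>h k\<close> satisfy
  \<open>ip (h k) (h k) \<le> 4 ^ - k\<close>, whence \<open>\<Sum>k. 2 ^ k * (norm (h k x))\<^sup>2\<close> is finite almost everywhere and the
  subsequence converges; Fatou's lemma identifies the limit in mean square.\<close>

lemma L2_complete:
  fixes f :: "nat \<Rightarrow> 'a \<Rightarrow> 'b::euclidean_space"
  assumes sq: "\<And>n. sq_int M (f n)"
    and cauchy: "\<And>e. 0 < e \<Longrightarrow> \<exists>N. \<forall>m\<ge>N. \<forall>n\<ge>N. sq_dist M (f m) (f n) < e"
  shows "\<exists>g. L2_lim M f g"
proof -
  have [measurable]: "f n \<in> borel_measurable M" for n using sq by (simp add: sq_int_def)
  have "\<exists>r::nat \<Rightarrow> nat. \<forall>k. (\<forall>m\<ge>r k. \<forall>n\<ge>r k. sq_dist M (f m) (f n) < (1/4)^k) \<and> r k < r (Suc k)"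
  proof (rule dependent_nat_choice)
    show "\<exists>N. \<forall>m\<ge>N. \<forall>n\<ge>N. sq_dist M (f m) (f n) < (1/4)^0"
      by (rule cauchy) simp
    fix N k
    obtain N' where "\<forall>m\<ge>N'. \<forall>n\<ge>N'. sq_dist M (f m) (f n) < (1/4)^Suc k"
      using cauchy[of "(1/4)^Suc k"] by auto
    then show "\<exists>y. (\<forall>m\<ge>y. \<forall>n\<ge>y. sq_dist M (f m) (f n) < (1/4)^Suc k) \<and> N < y"
      by (intro exI[of _ "max N' (Suc N)"]) auto
  qed
  then obtain r :: "nat \<Rightarrow> nat" where
    r: "\<And>k m n. m \<ge> r k \<Longrightarrow> n \<ge> r k \<Longrightarrow> sq_dist M (f m) (f n) < (1/4)^k"
    and mono: "\<And>k. r k < r (Suc k)" by blast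
  have smr: "strict_mono r" using mono by (simp add: strict_mono_Suc_iff)
  define h where "h k x = f (r (Suc k)) x - f (r k) x" for k x
  have h_sq: "sq_int M (h k)" for k unfolding h_def by (intro sq_int_diff sq)
  have [measurable]: "h k \<in> borel_measurable M" for k unfolding h_def by measurable
  have h_ip: "ip M (h k) (h k) \<le> (1/4)^k" for k
    unfolding h_def using r[of k "r (Suc k)" "r k"] mono[of k] by simp
  have "(\<integral>\<^sup>+x. (\<Sum>k. ennreal (2^k * (h k x \<bullet> h k x))) \<partial>M) = (\<Sum>k. \<integral>\<^sup>+x. ennreal (2^k * (h k x \<bullet> h k x)) \<partial>M)"
    by (intro nn_integral_suminf) measurable
  also have "\<dots> = (\<Sum>k. ennreal (2^k * ip M (h k) (h k)))"
    by (simp add: ennreal_mult nn_integral_cmult nn_integral_inner_self h_sq ip_nonneg)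
  also have "\<dots> \<le> (\<Sum>k. ennreal ((1/2)^k))"
  proof (intro suminf_le summableI ennreal_leI)
    fix k have "2^k * ip M (h k) (h k) \<le> 2^k * (1/4)^k" using h_ip by (intro mult_left_mono) auto
    then show "2^k * ip M (h k) (h k) \<le> (1/2)^k" by (simp add: power_mult_distrib[symmetric])
  qed
  also have "\<dots> < \<infinity>"
    by (subst suminf_ennreal2) (auto simp: summable_geometric)
  finally have "(\<integral>\<^sup>+x. (\<Sum>k. ennreal (2^k * (h k x \<bullet> h k x))) \<partial>M) \<noteq> \<infinity>" by simp
  then have "AE x in M. (\<Sum>k. ennreal (2^k * (h k x \<bullet> h k x))) \<noteq> \<infinity>"
    by (intro nn_integral_PInf_AE) auto
  then have conv: "AE x in M. convergent (\<lambda>k. f (r k) x)"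
  proof eventually_elim
    case (elim x)
    then have s: "summable (\<lambda>k. 2^k * (h k x \<bullet> h k x))"
      by (intro summable_suminf_not_top) (auto simp: infinity_ennreal_def)
    have "summable (\<lambda>k. (1/2)^k + 2^k * (h k x \<bullet> h k x))"
      by (intro summable_add s) (simp add: summable_geometric)
    \<comment> \<open>Either \<open>norm (h k x) \<le> 2 ^ - k\<close>, or multiplying by \<open>2 ^ k * norm (h k x) \<ge> 1\<close> can only enlarge it.\<close>
    moreover have "norm (h k x) \<le> (1/2)^k + 2^k * (h k x \<bullet> h k x)" for k
    proof (cases "norm (h k x) \<le> (1/2)^k")
      case True
      then show ?thesis by (simp add: add_increasing2)
    next
      case False
      then have "1 \<le> 2^k * norm (h k x)" by (simp add: power_divide field_simps)
      then have "1 * norm (h k x) \<le> (2^k * norm (h k x)) * norm (h k x)" by (intro mult_right_mono) auto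
      then show ?thesis by (simp add: power2_norm_eq_inner[symmetric] power2_eq_square add_increasing mult.assoc)
    qed
    ultimately have "summable (\<lambda>k. h k x)"
      by (rule summable_comparison_test'[where N=0 and g="\<lambda>k. (1/2)^k + 2^k * (h k x \<bullet> h k x)"])
    then have "convergent (\<lambda>n. \<Sum>k<n. h k x)" by (simp add: summable_iff_convergent)
    moreover have "(\<Sum>k<n. h k x) = f (r n) x - f (r 0) x" for n
      unfolding h_def by (simp add: sum_lessThan_telescope[of "\<lambda>k. f (r k) x"])
    ultimately have "convergent (\<lambda>n. f (r n) x - f (r 0) x)" by simp
    then have "convergent (\<lambda>n. (f (r n) x - f (r 0) x) + f (r 0) x)" by (intro convergent_add convergent_const)
    then show ?case by simp
  qed
  define g where "g x = lim (\<lambda>k. f (r k) x)" for x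
  have [measurable]: "g \<in> borel_measurable M" unfolding g_def by measurable
  have bound: "(\<integral>\<^sup>+x. ennreal ((f n x - g x) \<bullet> (f n x - g x)) \<partial>M) \<le> ennreal ((1/4)^k)" if n: "n \<ge> r k" for n k
  proof -
    have "(\<integral>\<^sup>+x. ennreal ((f n x - g x) \<bullet> (f n x - g x)) \<partial>M) =
       (\<integral>\<^sup>+x. liminf (\<lambda>j. ennreal ((f n x - f (r j) x) \<bullet> (f n x - f (r j) x))) \<partial>M)"
    proof (rule nn_integral_cong_AE)
      show "AE x in M. ennreal ((f n x - g x) \<bullet> (f n x - g x)) = liminf (\<lambda>j. ennreal ((f n x - f (r j) x) \<bullet> (f n x - f (r j) x)))"
        using conv
      proof eventually_elim
        case (elim x)
        then have "(\<lambda>k. f (r k) x) \<longlonglongrightarrow> g x" by (simp add: g_def convergent_LIMSEQ_iff)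
        then have "(\<lambda>j. ennreal ((f n x - f (r j) x) \<bullet> (f n x - f (r j) x))) \<longlonglongrightarrow> ennreal ((f n x - g x) \<bullet> (f n x - g x))"
          by (intro tendsto_intros)
        then show ?case by (intro lim_imp_Liminf[symmetric]) auto
      qed
    qed
    also have "\<dots> \<le> liminf (\<lambda>j. \<integral>\<^sup>+x. ennreal ((f n x - f (r j) x) \<bullet> (f n x - f (r j) x)) \<partial>M)"
      by (intro nn_integral_liminf) measurable
    also have "\<dots> \<le> liminf (\<lambda>j. ennreal ((1/4)^k))"
    proof (rule Liminf_mono)
      have "(\<integral>\<^sup>+x. ennreal ((f n x - f (r j) x) \<bullet> (f n x - f (r j) x)) \<partial>M) \<le> ennreal ((1/4)^k)" if "j \<ge> k" for j
      proof -
        have "r k \<le> r j" using that smr by (simp add: strict_mono_less_eq)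
        then show ?thesis
          using r[of k n "r j"] n by (subst nn_integral_inner_self) (auto intro!: sq_int_diff sq ennreal_leI)
      qed
      then show "\<forall>\<^sub>F j in sequentially. (\<integral>\<^sup>+x. ennreal ((f n x - f (r j) x) \<bullet> (f n x - f (r j) x)) \<partial>M) \<le> ennreal ((1/4)^k)"
        by (auto simp: eventually_sequentially)
    qed
    finally show ?thesis by (simp add: Liminf_const)
  qed
  have dsq: "sq_int M (\<lambda>x. f (r 0) x - g x)"
  proof -
    have "integrable M (\<lambda>x. (f (r 0) x - g x) \<bullet> (f (r 0) x - g x))"
      using bound[of 0 "r 0"] by (intro integrableI_bounded) (auto simp: le_less_trans)
    then show ?thesis by (simp add: sq_int_def)
  qed
  have gsq: "sq_int M g"
    using sq_int_diff[OF sq[of "r 0"] dsq] by simp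
  have bound': "sq_dist M (f n) g \<le> (1/4)^k" if "n \<ge> r k" for n k
    using bound[OF that] by (subst (asm) nn_integral_inner_self) (auto intro!: sq_int_diff sq gsq)
  have "(\<lambda>n. sq_dist M (f n) g) \<longlonglongrightarrow> 0"
  proof (rule LIMSEQ_I)
    fix e :: real assume "0 < e"
    then obtain k where k: "(1/4)^k < e" using real_arch_pow_inv[of e "1/4"] by auto
    show "\<exists>N. \<forall>n\<ge>N. norm (sq_dist M (f n) g - 0) < e"
      using bound'[of k] k by (intro exI[of _ "r k"]) (auto simp: ip_nonneg intro: le_less_trans)
  qed
  then show ?thesis using sq gsq by (auto simp: L2_lim_def)
qed

lemma ip_lincomb_diff:
  assumes "\<And>i. sq_int M (F i)" "sq_int M g"
  shows "sq_dist M (\<lambda>x. lincomb l (\<lambda>i. F i x)) g =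
    lincomb l (\<lambda>i. lincomb l (\<lambda>j. ip M (F i) (F j))) - 2 * lincomb l (\<lambda>i. ip M (F i) g) + ip M g g"
  using assms by (simp add: ip_diff_self sq_int_lincomb ip_lincomb ip_lincomb_left)

lemma ip_lincomb_diff2:
  assumes "\<And>i. sq_int M (F i)"
  shows "ip M (\<lambda>x. lincomb l (\<lambda>i. F i x) - lincomb l' (\<lambda>i. F i x))
      (\<lambda>x. lincomb l (\<lambda>i. F i x) - lincomb l' (\<lambda>i. F i x)) =
    lincomb l (\<lambda>i. lincomb l (\<lambda>j. ip M (F i) (F j))) - 2 * lincomb l (\<lambda>i. lincomb l' (\<lambda>j. ip M (F i) (F j)))
    + lincomb l' (\<lambda>i. lincomb l' (\<lambda>j. ip M (F i) (F j)))"
  using assms by (simp add: ip_diff_self sq_int_lincomb ip_lincomb)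

text \<open>Two families with the same Gram matrix span isometric spaces, so any approximation of \<open>b k\<close> by
  combinations of the \<open>e i\<close> can be copied to the \<open>X i\<close>: the copied combinations are Cauchy.  Used
  twice: from the spectral side to the random variables, and from the spectral side to functions of
  time.\<close>

lemma gram_transfer:
  fixes e :: "'i \<Rightarrow> 'x \<Rightarrow> 'v::euclidean_space" and X :: "'i \<Rightarrow> 'a \<Rightarrow> 'w::euclidean_space"
    and b :: "'k \<Rightarrow> 'x \<Rightarrow> 'v"
  assumes X: "\<And>i. sq_int M (X i)" and e: "\<And>i. sq_int N (e i)" and b: "\<And>k. sq_int N (b k)"
    and gram: "\<And>i j. ip M (X i) (X j) = ip N (e i) (e j)"
    and dense: "\<And>k \<epsilon>. 0 < \<epsilon> \<Longrightarrow> \<exists>l. sq_dist N (\<lambda>x. lincomb l (\<lambda>i. e i x)) (b k) < \<epsilon>"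
  obtains Y L where "\<And>k. sq_int M (Y k)"
    and "\<And>k. L2_lim N (\<lambda>n x. lincomb (L k n) (\<lambda>i. e i x)) (b k)"
    and "\<And>k. L2_lim M (\<lambda>n \<omega>. lincomb (L k n) (\<lambda>i. X i \<omega>)) (Y k)"
    and "\<And>k k'. ip M (Y k) (Y k') = ip N (b k) (b k')"
    and "\<And>i k. ip M (X i) (Y k) = ip N (e i) (b k)"
proof -
  have "\<exists>L. \<forall>k n. sq_dist N (\<lambda>x. lincomb (L k n) (\<lambda>i. e i x)) (b k) < inverse (real (Suc n))"
    using dense by (intro choice allI) simp
  then obtain L where L: "\<And>k n. sq_dist N (\<lambda>x. lincomb (L k n) (\<lambda>i. e i x)) (b k) < inverse (real (Suc n))"
    by blast
  have limN: "L2_lim N (\<lambda>n x. lincomb (L k n) (\<lambda>i. e i x)) (b k)" for k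
    unfolding L2_lim_def
  proof (intro conjI allI sq_int_lincomb e b)
    show "(\<lambda>n. sq_dist N (\<lambda>x. lincomb (L k n) (\<lambda>i. e i x)) (b k)) \<longlonglongrightarrow> 0"
      by (rule tendsto_sandwich[OF _ _ tendsto_const LIMSEQ_inverse_real_of_nat])
         (intro always_eventually allI ip_nonneg less_imp_le[OF L])+
  qed
  have iso: "sq_dist M (\<lambda>x. lincomb l (\<lambda>i. X i x)) (\<lambda>x. lincomb l' (\<lambda>i. X i x)) =
     sq_dist N (\<lambda>x. lincomb l (\<lambda>i. e i x)) (\<lambda>x. lincomb l' (\<lambda>i. e i x))" for l l'
    by (simp add: ip_lincomb_diff2 X e gram)
  have "\<exists>Y. \<forall>k. L2_lim M (\<lambda>n \<omega>. lincomb (L k n) (\<lambda>i. X i \<omega>)) (Y k)"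
  proof (intro choice allI L2_complete)
    fix k show "sq_int M (\<lambda>\<omega>. lincomb (L k n) (\<lambda>i. X i \<omega>))" for n by (intro sq_int_lincomb X)
    fix \<epsilon> :: real assume "0 < \<epsilon>"
    from L2_lim_Cauchy[OF limN this] show "\<exists>K. \<forall>m\<ge>K. \<forall>n\<ge>K. sq_dist M (\<lambda>x. lincomb (L k m) (\<lambda>i. X i x)) (\<lambda>x. lincomb (L k n) (\<lambda>i. X i x)) < \<epsilon>"
      unfolding iso .
  qed
  then obtain Y where limM: "\<And>k. L2_lim M (\<lambda>n \<omega>. lincomb (L k n) (\<lambda>i. X i \<omega>)) (Y k)" by blast
  have Y: "sq_int M (Y k)" for k using limM by (auto simp: L2_lim_def)
  have XY: "ip M (X i) (Y k) = ip N (e i) (b k)" for i k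
  proof (rule LIMSEQ_unique)
    show "(\<lambda>n. ip M (\<lambda>\<omega>. lincomb (L k n) (\<lambda>i. X i \<omega>)) (X i)) \<longlonglongrightarrow> ip M (X i) (Y k)"
      using ip_lim_left[OF limM X] by (simp add: ip_commute)
    show "(\<lambda>n. ip M (\<lambda>\<omega>. lincomb (L k n) (\<lambda>i. X i \<omega>)) (X i)) \<longlonglongrightarrow> ip N (e i) (b k)"
      using ip_lim_left[OF limN e, of k i] by (simp add: ip_lincomb_left X e gram ip_commute[of N "e i" "b k"])
  qed
  have "ip M (Y k) (Y k') = ip N (b k) (b k')" for k k'
  proof (rule LIMSEQ_unique)
    show "(\<lambda>n. ip M (\<lambda>\<omega>. lincomb (L k n) (\<lambda>i. X i \<omega>)) (Y k')) \<longlonglongrightarrow> ip M (Y k) (Y k')"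
      by (rule ip_lim_left[OF limM Y])
    show "(\<lambda>n. ip M (\<lambda>\<omega>. lincomb (L k n) (\<lambda>i. X i \<omega>)) (Y k')) \<longlonglongrightarrow> ip N (b k) (b k')"
      using ip_lim_left[OF limN b, of k k'] by (simp add: ip_lincomb_left X Y e b XY)
  qed
  then show ?thesis using that Y limN limM XY by blast
qed


section \<open>Centred Gaussian variables: limits in mean square and independence\<close>

text \<open>The characteristic function is used as the definition because it passes to limits in mean square;
  the degenerate law is included.\<close>

definition centred_gaussian :: "'a measure \<Rightarrow> ('a \<Rightarrow> real) \<Rightarrow> bool" where
  "centred_gaussian M Z \<longleftrightarrow> sq_int M Z \<and>
     (\<forall>u. (CLINT \<omega>|M. iexp (u * Z \<omega>)) = exp (- (u^2 * ip M Z Z / 2)))"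

lemma (in prob_space) char_distr:
  assumes [measurable]: "Z \<in> borel_measurable M"
  shows "char (distr M borel Z) u = (CLINT \<omega>|M. iexp (u * Z \<omega>))"
  unfolding char_def by (subst integral_distr) auto

lemma (in prob_space) normal_centred_gaussian:
  assumes D: "distributed M lborel Z (normal_density 0 \<sigma>)" and s: "0 < \<sigma>"
  shows "centred_gaussian M Z" "ip M Z Z = \<sigma>^2"
proof -
  have [measurable]: "Z \<in> borel_measurable M" using distributed_measurable[OF D] by simp
  have "integrable lborel (\<lambda>x. normal_density 0 \<sigma> x * x^2)"
    using integrable_normal_moment[OF s, of 0 2] by simp
  then have sq: "sq_int M Z"
    using distributed_integrable[OF D, of "\<lambda>x. x^2"] by (simp add: sq_int_def power2_eq_square)
  have v: "variance Z = \<sigma>^2" by (rule normal_distributed_variance[OF s D])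
  have "expectation Z = 0" by (rule normal_distributed_expectation[OF s D])
  with v show ip: "ip M Z Z = \<sigma>^2" by (simp add: ip_def power2_eq_square)
  have D1: "distributed M lborel (\<lambda>\<omega>. (Z \<omega> - 0) / \<sigma>) std_normal_density"
    using D s normal_standard_normal_convert[of \<sigma> Z 0] by simp
  have dd: "distr M borel (\<lambda>\<omega>. Z \<omega> / \<sigma>) = std_normal_distribution"
  proof -
    have "distr M borel (\<lambda>\<omega>. Z \<omega> / \<sigma>) = distr M lborel (\<lambda>\<omega>. (Z \<omega> - 0) / \<sigma>)"
      by (rule distr_cong) auto
    then show ?thesis using distributed_distr_eq_density[OF D1] by simp
  qed
  have "(CLINT \<omega>|M. iexp (u * Z \<omega>)) = exp (- (u^2 * \<sigma>^2 / 2))" for u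
  proof -
    have "(CLINT \<omega>|M. iexp (u * Z \<omega>)) = char (distr M borel (\<lambda>\<omega>. Z \<omega> / \<sigma>)) (u * \<sigma>)"
      using s by (subst char_distr) auto
    then show ?thesis
      by (simp add: dd char_std_normal_distribution power_mult_distrib)
  qed
  then show "centred_gaussian M Z" using sq by (simp add: centred_gaussian_def ip)
qed

lemma (in prob_space) gaussian_law_centred:
  assumes [measurable]: "Z \<in> borel_measurable M" and G: "gaussian_law (distr M borel Z)"
    and E: "expectation Z = 0"
  shows "centred_gaussian M Z"
  using G unfolding gaussian_law_def
proof (elim disjE exE conjE)
  fix \<mu> \<sigma> :: real assume s: "0 < \<sigma>" and "distr M borel Z = density lborel (\<lambda>x. ennreal (normal_density \<mu> \<sigma> x))"
  moreover have "distr M borel Z = distr M lborel Z" by (rule distr_cong) auto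
  ultimately have D: "distributed M lborel Z (normal_density \<mu> \<sigma>)"
    by (simp add: distributed_def)
  with normal_distributed_expectation[OF s D] E have "\<mu> = 0" by simp
  with D s show ?thesis using normal_centred_gaussian(1) by blast
next
  fix \<mu> assume d: "distr M borel Z = return borel \<mu>"
  have int: "(\<integral>\<omega>. f (Z \<omega>) \<partial>M) = f \<mu>" if [measurable]: "f \<in> borel_measurable borel"
    for f :: "real \<Rightarrow> 'c::euclidean_space"
  proof -
    have "(\<integral>\<omega>. f (Z \<omega>) \<partial>M) = (\<integral>x. f x \<partial>distr M borel Z)" by (subst integral_distr) auto
    then show ?thesis by (simp add: d integral_return)
  qed
  have m: "\<mu> = 0" using int[of "\<lambda>x. x"] E by simp
  have "AE x in distr M borel Z. x = 0" by (subst d) (simp add: m AE_return)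
  then have "AE \<omega> in M. Z \<omega> = 0" by (subst (asm) AE_distr_iff) auto
  then have "integrable M (\<lambda>\<omega>. Z \<omega> \<bullet> Z \<omega>) = integrable M (\<lambda>\<omega>. 0 :: real)"
    by (intro integrable_cong_AE) auto
  then have "sq_int M Z" by (simp add: sq_int_def)
  moreover have "ip M Z Z = 0" using int[of "\<lambda>x. x * x"] by (simp add: ip_def m)
  moreover have "(CLINT \<omega>|M. iexp (u * Z \<omega>)) = 1" for u
    using int[of "\<lambda>x. iexp (u * x)"] by (simp add: m)
  ultimately show ?thesis by (simp add: centred_gaussian_def)
qed

lemma (in prob_space) centred_gaussian_normal:
  assumes G: "centred_gaussian M Z" and v: "ip M Z Z = \<sigma>^2" and s: "0 < \<sigma>"
  shows "distributed M lborel Z (normal_density 0 \<sigma>)"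
proof -
  have [measurable]: "Z \<in> borel_measurable M" using G by (simp add: centred_gaussian_def sq_int_def)
  define N where "N = density lborel (\<lambda>x. ennreal (normal_density 0 \<sigma> x))"
  interpret N: prob_space N unfolding N_def by (rule prob_space_normal_density[OF s])
  have sN: "sets N = sets borel" by (simp add: N_def)
  have "distributed N lborel (\<lambda>x. x) (normal_density 0 \<sigma>)"
  proof -
    have "distr N lborel (\<lambda>x. x) = N" by (rule distr_id2) (simp add: N_def)
    then show ?thesis by (auto simp: distributed_def N_def intro: measurable_ident_sets)
  qed
  from N.normal_centred_gaussian[OF this s]
  have cN: "char N u = exp (- (u^2 * \<sigma>^2 / 2))" for u
    by (simp add: centred_gaussian_def char_def)
  have "distr M borel Z = N"
  proof (rule Levy_uniqueness)
    show "real_distribution (distr M borel Z)" by (rule real_distribution_distr) simp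
    show "real_distribution N"
      by (intro real_distribution.intro real_distribution_axioms.intro N.prob_space_axioms) (simp_all add: N_def)
    show "char (distr M borel Z) = char N"
      using G by (auto simp: char_distr cN centred_gaussian_def v)
  qed
  moreover have "distr M borel Z = distr M lborel Z" by (rule distr_cong) auto
  ultimately show ?thesis by (simp add: distributed_def N_def)
qed

lemma norm_iexp_diff: "norm (iexp a - iexp b) \<le> \<bar>a - b\<bar>"
proof -
  have "iexp a - iexp b = iexp b * (iexp (a - b) - 1)"
    by (simp add: algebra_simps exp_add[symmetric])
  then show ?thesis using iexp_approx1[of "a - b" 0] by (simp add: norm_mult)
qed

lemma (in prob_space) centred_gaussian_lim:
  assumes lim: "L2_lim M f g" and G: "\<And>n. centred_gaussian M (f n)"
  shows "centred_gaussian M g"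
proof -
  have sq: "\<And>n. sq_int M (f n)" "sq_int M g" using lim by (auto simp: L2_lim_def)
  have meas [measurable]: "f n \<in> borel_measurable M" "g \<in> borel_measurable M" for n
    using sq by (auto simp: sq_int_def)
  define D where "D n = sq_dist M (f n) g" for n
  have D: "D \<longlonglongrightarrow> 0" using lim by (simp add: L2_lim_def D_def[abs_def])
  have "ip M (f n) (f n) = D n + 2 * ip M (f n) g - ip M g g" for n
    unfolding D_def by (subst ip_diff_self) (use sq in auto)
  moreover have "(\<lambda>n. D n + 2 * ip M (f n) g - ip M g g) \<longlonglongrightarrow> 0 + 2 * ip M g g - ip M g g"
    by (intro tendsto_intros D ip_lim_left lim sq)
  ultimately have v: "(\<lambda>n. ip M (f n) (f n)) \<longlonglongrightarrow> ip M g g" by simp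
  have "(CLINT \<omega>|M. iexp (u * g \<omega>)) = exp (- (u^2 * ip M g g / 2))" for u
  proof (rule LIMSEQ_unique)
    have b: "norm ((CLINT \<omega>|M. iexp (u * f n \<omega>)) - (CLINT \<omega>|M. iexp (u * g \<omega>))) \<le> \<bar>u\<bar> * sqrt (D n)" for n
    proof -
      have one: "sq_int M (\<lambda>x. 1::real)" by (simp add: sq_int_def)
      have ad: "sq_int M (\<lambda>x. \<bar>f n x - g x\<bar>)"
        using sq_int_diff[OF sq(1) sq(2)] by (auto simp: sq_int_def)
      have i: "integrable M (\<lambda>\<omega>. iexp (u * h \<omega>))" if "h \<in> borel_measurable M" for h
        using that by (intro integrable_iexp) auto
      have "norm ((CLINT \<omega>|M. iexp (u * f n \<omega>)) - (CLINT \<omega>|M. iexp (u * g \<omega>))) =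
          norm (CLINT \<omega>|M. iexp (u * f n \<omega>) - iexp (u * g \<omega>))"
        by (simp only: Bochner_Integration.integral_diff[OF i[OF meas(1)] i[OF meas(2)]])
      also have "\<dots> \<le> (\<integral>\<omega>. norm (iexp (u * f n \<omega>) - iexp (u * g \<omega>)) \<partial>M)"
        by (rule integral_norm_bound)
      also have "\<dots> \<le> (\<integral>\<omega>. \<bar>u\<bar> * \<bar>f n \<omega> - g \<omega>\<bar> \<partial>M)"
      proof (rule integral_mono)
        show "integrable M (\<lambda>\<omega>. norm (iexp (u * f n \<omega>) - iexp (u * g \<omega>)))"
          by (intro integrable_norm Bochner_Integration.integrable_diff i meas)
        show "integrable M (\<lambda>\<omega>. \<bar>u\<bar> * \<bar>f n \<omega> - g \<omega>\<bar>)"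
          using integrable_inner[OF ad one] by simp
        show "norm (iexp (u * f n \<omega>) - iexp (u * g \<omega>)) \<le> \<bar>u\<bar> * \<bar>f n \<omega> - g \<omega>\<bar>" for \<omega>
          using norm_iexp_diff[of "u * f n \<omega>" "u * g \<omega>"]
          by (simp add: abs_mult[symmetric] right_diff_distrib)
      qed
      also have "\<dots> = \<bar>u\<bar> * ip M (\<lambda>x. \<bar>f n x - g x\<bar>) (\<lambda>x. 1)" by (simp add: ip_def)
      also have "\<dots> \<le> \<bar>u\<bar> * (sqrt (D n) * 1)"
        using ip_cauchy_schwarz[OF ad one]
        by (intro mult_left_mono) (auto simp: D_def ip_def prob_space)
      finally show ?thesis by simp
    qed
    have "(\<lambda>n. \<bar>u\<bar> * sqrt (D n)) \<longlonglongrightarrow> \<bar>u\<bar> * sqrt 0" by (intro tendsto_intros D)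
    then have "(\<lambda>n. \<bar>u\<bar> * sqrt (D n)) \<longlonglongrightarrow> 0" by simp
    then have "(\<lambda>n. (CLINT \<omega>|M. iexp (u * f n \<omega>)) - (CLINT \<omega>|M. iexp (u * g \<omega>))) \<longlonglongrightarrow> 0"
      by (rule Lim_null_comparison[rotated]) (rule always_eventually, rule allI, rule b)
    then show "(\<lambda>n. (CLINT \<omega>|M. iexp (u * f n \<omega>))) \<longlonglongrightarrow> (CLINT \<omega>|M. iexp (u * g \<omega>))"
      by (simp add: LIM_zero_iff)
    have "(\<lambda>n. complex_of_real (exp (- (u^2 * ip M (f n) (f n) / 2)))) \<longlonglongrightarrow> complex_of_real (exp (- (u^2 * ip M g g / 2)))"
      by (intro tendsto_intros v)  simp
    then show "(\<lambda>n. (CLINT \<omega>|M. iexp (u * f n \<omega>))) \<longlonglongrightarrow> exp (- (u^2 * ip M g g / 2))"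
      using G by (simp add: centred_gaussian_def)
  qed
  then show ?thesis using sq by (simp add: centred_gaussian_def)
qed

lemma (in prob_space) centred_gaussian_fourth_moment:
  assumes G: "centred_gaussian M Z"
  shows "(\<integral>\<^sup>+\<omega>. ennreal (Z \<omega> ^ 4) \<partial>M) \<le> ennreal (3 * (ip M Z Z)^2)"
proof (cases "ip M Z Z = 0")
  case True
  have [measurable]: "Z \<in> borel_measurable M" using G by (simp add: centred_gaussian_def sq_int_def)
  have "AE \<omega> in M. Z \<omega> \<bullet> Z \<omega> = 0"
    using True G unfolding ip_def centred_gaussian_def sq_int_def
    by (subst integral_nonneg_eq_0_iff_AE[symmetric]) auto
  then have "(\<integral>\<^sup>+\<omega>. ennreal (Z \<omega> ^ 4) \<partial>M) = (\<integral>\<^sup>+\<omega>. 0 \<partial>M)"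
    by (intro nn_integral_cong_AE) auto
  then show ?thesis by simp
next
  case False
  define s where "s = sqrt (ip M Z Z)"
  have s: "0 < s" "ip M Z Z = s^2" using False ip_nonneg[of M Z] by (auto simp: s_def)
  have D: "distributed M lborel Z (normal_density 0 s)"
    by (rule centred_gaussian_normal[OF G s(2,1)])
  have "(\<integral>\<^sup>+\<omega>. ennreal (Z \<omega> ^ 4) \<partial>M) = (\<integral>\<^sup>+x. ennreal (normal_density 0 s x) * ennreal (x ^ 4) \<partial>lborel)"
    using distributed_nn_integral[OF D, of "\<lambda>x. ennreal (x^4)"] by simp
  also have "\<dots> = (\<integral>\<^sup>+x. ennreal (normal_density 0 s x * (x - 0) ^ (2 * 2)) \<partial>lborel)"
    by (intro nn_integral_cong) (auto simp: ennreal_mult')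
  also have "\<dots> = ennreal (\<integral>x. normal_density 0 s x * (x - 0) ^ (2 * 2) \<partial>lborel)"
    using s(1) integrable_normal_moment[OF s(1), of 0 4]
    by (intro nn_integral_eq_integral) (auto simp: zero_le_even_power)
  also have "\<dots> = ennreal (fact (2 * 2) / ((2 / s\<^sup>2)^2 * fact 2))"
    using integral_normal_moment_even[OF s(1), of 0 2] by simp
  also have "\<dots> = ennreal (3 * (ip M Z Z)^2)"
    using s by (simp add: fact_numeral field_simps)
  finally show ?thesis by simp
qed

text \<open>If \<open>W\<close> were a probability density, the hypothesis would say that \<open>Z\<close> has the same
  characteristic function under \<open>M\<close> and under the measure with density \<open>W\<close>, hence the same law.
  A bounded complex weight is reduced to this case by taking real and imaginary parts and adding a
  constant, which is itself an admissible weight.\<close>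

lemma (in prob_space) char_factor_weight:
  fixes W :: "'a \<Rightarrow> complex"
  assumes Z [measurable]: "Z \<in> borel_measurable M" and W [measurable]: "W \<in> borel_measurable M"
    and bd: "\<And>\<omega>. norm (W \<omega>) \<le> 1"
    and fac: "\<And>u. (CLINT \<omega>|M. iexp (u * Z \<omega>) * W \<omega>) = (CLINT \<omega>|M. iexp (u * Z \<omega>)) * (CLINT \<omega>|M. W \<omega>)"
    and B [measurable]: "B \<in> sets borel"
  shows "(CLINT \<omega>|M. indicator B (Z \<omega>) * W \<omega>) = complex_of_real (prob {\<omega>\<in>space M. Z \<omega> \<in> B}) * (CLINT \<omega>|M. W \<omega>)"
proof -
  have int: "integrable M f" if "f \<in> borel_measurable M" "\<And>\<omega>. norm (f \<omega>) \<le> 3" for f :: "'a \<Rightarrow> 'c::euclidean_space"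
    using that by (intro integrable_const_bound[of _ 3]) auto
  have nW: "norm (iexp (u * Z \<omega>) * W \<omega>) \<le> 3" for u \<omega> using bd[of \<omega>] by (simp add: norm_mult)
  have real: "(\<integral>\<omega>. indicator B (Z \<omega>) * V \<omega> \<partial>M) = prob {\<omega>\<in>space M. Z \<omega> \<in> B} * expectation V"
    if [measurable]: "V \<in> borel_measurable M" and V: "\<And>\<omega>. \<bar>V \<omega>\<bar> \<le> 1"
    and f: "\<And>u. (CLINT \<omega>|M. iexp (u * Z \<omega>) * complex_of_real (V \<omega>)) = (CLINT \<omega>|M. iexp (u * Z \<omega>)) * complex_of_real (expectation V)"
    for V :: "'a \<Rightarrow> real"
  proof -
    have V3: "\<bar>V \<omega>\<bar> \<le> 3" for \<omega> by (rule order_trans[OF V]) simp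
    define Q where "Q \<omega> = 2 + V \<omega>" for \<omega>
    have Q: "1 \<le> Q \<omega>" "Q \<omega> \<le> 3" for \<omega> using V[of \<omega>] by (auto simp: Q_def)
    have [measurable]: "Q \<in> borel_measurable M" by (simp add: Q_def[abs_def])
    have iV: "integrable M V" by (rule int) (simp_all add: V3)
    have iQ: "integrable M Q" using iV by (auto simp: Q_def[abs_def])
    define m where "m = expectation Q"
    have mV: "m = 2 + expectation V" using iV by (simp add: m_def Q_def[abs_def] prob_space)
    have m: "1 \<le> m" unfolding m_def by (rule integral_ge_const[OF iQ]) (use Q in auto)
    have fQ: "(CLINT \<omega>|M. complex_of_real (Q \<omega>) * iexp (u * Z \<omega>)) = complex_of_real m * (CLINT \<omega>|M. iexp (u * Z \<omega>))" for u
    proof -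
      have "(CLINT \<omega>|M. complex_of_real (Q \<omega>) * iexp (u * Z \<omega>)) =
        (CLINT \<omega>|M. 2 * iexp (u * Z \<omega>) + iexp (u * Z \<omega>) * complex_of_real (V \<omega>))"
        by (rule Bochner_Integration.integral_cong) (auto simp: Q_def algebra_simps)
      also have "\<dots> = (CLINT \<omega>|M. 2 * iexp (u * Z \<omega>)) + (CLINT \<omega>|M. iexp (u * Z \<omega>) * complex_of_real (V \<omega>))"
        by (rule Bochner_Integration.integral_add)
           (intro int, simp, simp add: norm_mult, intro int, simp, simp add: norm_mult V3)
      finally show ?thesis using f[of u] by (simp add: mV algebra_simps)
    qed
    define M' where "M' = density M (\<lambda>\<omega>. ennreal (Q \<omega> / m))"
    have Qm: "0 \<le> Q \<omega> / m" for \<omega> using Q(1)[of \<omega>] m by simp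
    have "emeasure M' (space M') = (\<integral>\<^sup>+\<omega>. ennreal (Q \<omega> / m) \<partial>M)"
      unfolding M'_def by (subst emeasure_density) (auto cong: nn_integral_cong)
    also have "\<dots> = ennreal (\<integral>\<omega>. Q \<omega> / m \<partial>M)"
      by (rule nn_integral_eq_integral) (use iQ Qm in auto)
    also have "\<dots> = 1" using m by (simp add: m_def[symmetric])
    finally interpret M': prob_space M' by (rule prob_spaceI)
    have ZM' [measurable]: "Z \<in> borel_measurable M'" by (simp add: M'_def)
    have "distr M' borel Z = distr M borel Z"
    proof (rule Levy_uniqueness)
      show "real_distribution (distr M borel Z)" by (rule real_distribution_distr) simp
      show "real_distribution (distr M' borel Z)" by (rule M'.real_distribution_distr) simp
      show "char (distr M' borel Z) = char (distr M borel Z)"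
      proof
        fix u
        have "char (distr M' borel Z) u = (CLINT \<omega>|M'. iexp (u * Z \<omega>))"
          by (rule M'.char_distr) simp
        also have "\<dots> = (CLINT \<omega>|M. (Q \<omega> / m) *\<^sub>R iexp (u * Z \<omega>))"
          unfolding M'_def by (rule integral_density) (use Qm in auto)
        also have "\<dots> = (CLINT \<omega>|M. complex_of_real (Q \<omega>) * iexp (u * Z \<omega>)) / m"
          by (simp add: scaleR_conv_of_real)
        also have "\<dots> = (CLINT \<omega>|M. iexp (u * Z \<omega>))" using m fQ[of u] by simp
        finally show "char (distr M' borel Z) u = char (distr M borel Z) u" by (simp add: char_distr)
      qed
    qed
    then have "(\<integral>x. indicator B x \<partial>distr M' borel Z) = (\<integral>x. indicator B x \<partial>distr M borel Z :: real)" by simp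
    then have "(\<integral>\<omega>. indicator B (Z \<omega>) \<partial>M) = (\<integral>\<omega>. indicator B (Z \<omega>) \<partial>M' :: real)"
      by (simp add: integral_distr del: Bochner_Integration.integral_indicator)
    also have "\<dots> = (\<integral>\<omega>. (Q \<omega> / m) *\<^sub>R indicator B (Z \<omega>) \<partial>M :: real)"
      unfolding M'_def by (rule integral_density) (use Qm in auto)
    also have "\<dots> = (\<integral>\<omega>. (2 * indicator B (Z \<omega>) + indicator B (Z \<omega>) * V \<omega>) / m \<partial>M)"
      by (rule Bochner_Integration.integral_cong) (auto simp: Q_def field_simps)
    also have "\<dots> = (2 * (\<integral>\<omega>. indicator B (Z \<omega>) \<partial>M) + (\<integral>\<omega>. indicator B (Z \<omega>) * V \<omega> \<partial>M)) / m"
      by (subst integral_divide_zero, subst Bochner_Integration.integral_add)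
         (intro int, simp, simp add: indicator_def, intro int, simp, simp add: abs_mult indicator_def V3, simp)
    finally have eq: "(\<integral>\<omega>. indicator B (Z \<omega>) \<partial>M) = (2 * (\<integral>\<omega>. indicator B (Z \<omega>) \<partial>M) + (\<integral>\<omega>. indicator B (Z \<omega>) * V \<omega> \<partial>M)) / m" .
    have P: "(\<integral>\<omega>. indicator B (Z \<omega>) \<partial>M) = prob {\<omega>\<in>space M. Z \<omega> \<in> B}"
    proof -
      have "(\<integral>\<omega>. indicator B (Z \<omega>) \<partial>M) = (\<integral>\<omega>. indicator {\<omega>\<in>space M. Z \<omega> \<in> B} \<omega> \<partial>M :: real)"
        by (rule Bochner_Integration.integral_cong) (auto simp: indicator_def)
      then show ?thesis by (simp add: Int_def conj_commute)
    qed
    show ?thesis using eq m unfolding P by (simp add: field_simps mV)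
  qed
  have iW: "integrable M W" by (rule int) (auto intro!: order_trans[OF bd])
  have icW: "integrable M (\<lambda>\<omega>. cnj (W \<omega>))" using iW by simp
  note [measurable] = borel_measurable_integrable[OF icW]
  have facc: "(CLINT \<omega>|M. iexp (u * Z \<omega>) * cnj (W \<omega>)) = (CLINT \<omega>|M. iexp (u * Z \<omega>)) * (CLINT \<omega>|M. cnj (W \<omega>))" for u
  proof -
    have "(CLINT \<omega>|M. iexp (u * Z \<omega>) * cnj (W \<omega>)) = (CLINT \<omega>|M. cnj (iexp (- u * Z \<omega>) * W \<omega>))"
      by (rule Bochner_Integration.integral_cong) (auto simp: exp_cnj)
    also have "\<dots> = cnj (CLINT \<omega>|M. iexp (- u * Z \<omega>) * W \<omega>)" by (rule Bochner_Integration.integral_cnj)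
    also have "\<dots> = (CLINT \<omega>|M. cnj (iexp (- u * Z \<omega>))) * (CLINT \<omega>|M. cnj (W \<omega>))"
      by (subst fac) (simp only: complex_cnj_mult Bochner_Integration.integral_cnj)
    also have "(CLINT \<omega>|M. cnj (iexp (- u * Z \<omega>))) = (CLINT \<omega>|M. iexp (u * Z \<omega>))"
      by (rule Bochner_Integration.integral_cong) (auto simp: exp_cnj)
    finally show ?thesis .
  qed
  have iu: "integrable M (\<lambda>\<omega>. iexp (u * Z \<omega>) * W \<omega>)" "integrable M (\<lambda>\<omega>. iexp (u * Z \<omega>) * cnj (W \<omega>))" for u
    using nW[of u] by (auto intro!: int simp: norm_mult)
  have re: "(\<integral>\<omega>. indicator B (Z \<omega>) * Re (W \<omega>) \<partial>M) = prob {\<omega>\<in>space M. Z \<omega> \<in> B} * expectation (\<lambda>\<omega>. Re (W \<omega>))"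
  proof (rule real)
    show "\<bar>Re (W \<omega>)\<bar> \<le> 1" for \<omega> using abs_Re_le_cmod[of "W \<omega>"] bd[of \<omega>] by simp
    fix u
    have "(CLINT \<omega>|M. iexp (u * Z \<omega>) * complex_of_real (Re (W \<omega>))) =
       (CLINT \<omega>|M. (iexp (u * Z \<omega>) * W \<omega> + iexp (u * Z \<omega>) * cnj (W \<omega>)) / 2)"
      by (rule Bochner_Integration.integral_cong) (auto simp: complex_eq_iff algebra_simps)
    also have "\<dots> = ((CLINT \<omega>|M. iexp (u * Z \<omega>)) * (CLINT \<omega>|M. W \<omega>) + (CLINT \<omega>|M. iexp (u * Z \<omega>)) * (CLINT \<omega>|M. cnj (W \<omega>))) / 2"
      by (simp only: integral_divide_zero Bochner_Integration.integral_add[OF iu] fac facc)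
    also have "\<dots> = (CLINT \<omega>|M. iexp (u * Z \<omega>)) * complex_of_real (Re (CLINT \<omega>|M. W \<omega>))"
      by (simp add: Bochner_Integration.integral_cnj complex_eq_iff algebra_simps)
    also have "Re (CLINT \<omega>|M. W \<omega>) = expectation (\<lambda>\<omega>. Re (W \<omega>))" using iW by simp
    finally show "(CLINT \<omega>|M. iexp (u * Z \<omega>) * complex_of_real (Re (W \<omega>))) = (CLINT \<omega>|M. iexp (u * Z \<omega>)) * complex_of_real (expectation (\<lambda>\<omega>. Re (W \<omega>)))" .
  qed simp
  have im: "(\<integral>\<omega>. indicator B (Z \<omega>) * Im (W \<omega>) \<partial>M) = prob {\<omega>\<in>space M. Z \<omega> \<in> B} * expectation (\<lambda>\<omega>. Im (W \<omega>))"
  proof (rule real)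
    show "\<bar>Im (W \<omega>)\<bar> \<le> 1" for \<omega> using abs_Im_le_cmod[of "W \<omega>"] bd[of \<omega>] by simp
    fix u
    have "(CLINT \<omega>|M. iexp (u * Z \<omega>) * complex_of_real (Im (W \<omega>))) =
       (CLINT \<omega>|M. (iexp (u * Z \<omega>) * W \<omega> - iexp (u * Z \<omega>) * cnj (W \<omega>)) * Complex 0 (- 1/2))"
      by (rule Bochner_Integration.integral_cong) (auto simp: complex_eq_iff algebra_simps)
    also have "\<dots> = ((CLINT \<omega>|M. iexp (u * Z \<omega>)) * (CLINT \<omega>|M. W \<omega>) - (CLINT \<omega>|M. iexp (u * Z \<omega>)) * (CLINT \<omega>|M. cnj (W \<omega>))) * Complex 0 (- 1/2)"
      by (simp only: integral_mult_left_zero Bochner_Integration.integral_diff[OF iu] fac facc)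
    also have "\<dots> = (CLINT \<omega>|M. iexp (u * Z \<omega>)) * complex_of_real (Im (CLINT \<omega>|M. W \<omega>))"
      by (auto simp: Bochner_Integration.integral_cnj complex_eq_iff algebra_simps)
    also have "Im (CLINT \<omega>|M. W \<omega>) = expectation (\<lambda>\<omega>. Im (W \<omega>))" using iW by simp
    finally show "(CLINT \<omega>|M. iexp (u * Z \<omega>) * complex_of_real (Im (W \<omega>))) = (CLINT \<omega>|M. iexp (u * Z \<omega>)) * complex_of_real (expectation (\<lambda>\<omega>. Im (W \<omega>)))" .
  qed simp
  have iB: "integrable M (\<lambda>\<omega>. indicator B (Z \<omega>) * W \<omega>)"
    by (rule int) (auto simp: norm_mult indicator_def intro!: order_trans[OF bd])
  have "Re (CLINT \<omega>|M. indicator B (Z \<omega>) * W \<omega>) = (\<integral>\<omega>. indicator B (Z \<omega>) * Re (W \<omega>) \<partial>M)"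
    by (subst integral_Re[OF iB, symmetric]) (rule Bochner_Integration.integral_cong, auto simp: indicator_def)
  moreover have "Im (CLINT \<omega>|M. indicator B (Z \<omega>) * W \<omega>) = (\<integral>\<omega>. indicator B (Z \<omega>) * Im (W \<omega>) \<partial>M)"
    by (subst integral_Im[OF iB, symmetric]) (rule Bochner_Integration.integral_cong, auto simp: indicator_def)
  ultimately show ?thesis using re im iW by (simp add: complex_eq_iff)
qed

text \<open>The factors of the joint characteristic function are replaced by indicators one coordinate at a
  time, the remaining product serving as the weight in \<open>char_factor_weight\<close>.  Thus only the
  one-dimensional uniqueness theorem for characteristic functions is needed.\<close>

lemma (in prob_space) indep_vars_char:
  fixes Z :: "'j \<Rightarrow> 'a \<Rightarrow> real"
  assumes J: "finite J" and Z: "\<And>j. j \<in> J \<Longrightarrow> Z j \<in> borel_measurable M"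
    and fac: "\<And>a. (CLINT \<omega>|M. iexp (\<Sum>j\<in>J. a j * Z j \<omega>)) = (\<Prod>j\<in>J. CLINT \<omega>|M. iexp (a j * Z j \<omega>))"
  shows "indep_vars (\<lambda>_. borel) Z J"
proof -
  have key: "(CLINT \<omega>|M. (\<Prod>j\<in>K. indicator (B j) (Z j \<omega>)) * iexp (\<Sum>j\<in>J-K. a j * Z j \<omega>)) =
      (\<Prod>j\<in>K. complex_of_real (prob {\<omega>\<in>space M. Z j \<omega> \<in> B j})) * (\<Prod>j\<in>J-K. CLINT \<omega>|M. iexp (a j * Z j \<omega>))"
    if "finite K" "K \<subseteq> J" "\<And>j. j \<in> K \<Longrightarrow> B j \<in> sets borel" for K B a
    using that
  proof (induction K arbitrary: a rule: finite_induct)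
    case empty
    then show ?case using fac[of a] by simp
  next
    case (insert k K)
    have kJ: "k \<in> J" "K \<subseteq> J" and [measurable]: "B k \<in> sets borel" using insert.prems by auto
    have BK: "\<And>j. j \<in> K \<Longrightarrow> B j \<in> sets borel" using insert.prems by auto
    note [measurable] = Z[OF kJ(1)]
    define W where "W \<omega> = (\<Prod>j\<in>K. indicator (B j) (Z j \<omega>)) * iexp (\<Sum>j\<in>J-insert k K. a j * Z j \<omega>)" for \<omega>
    have JK: "J - K = insert k (J - insert k K)" using kJ insert.hyps by auto
    have fin: "finite (J - insert k K)" using J by simp
    have IH: "(CLINT \<omega>|M. iexp (u * Z k \<omega>) * W \<omega>) =
       (\<Prod>j\<in>K. complex_of_real (prob {\<omega>\<in>space M. Z j \<omega> \<in> B j})) * ((CLINT \<omega>|M. iexp (u * Z k \<omega>)) * (\<Prod>j\<in>J-insert k K. CLINT \<omega>|M. iexp (a j * Z j \<omega>)))" for u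
    proof -
      have s: "(\<Sum>j\<in>J-K. (a(k:=u)) j * Z j \<omega>) = u * Z k \<omega> + (\<Sum>j\<in>J-insert k K. a j * Z j \<omega>)" for \<omega>
        unfolding JK by (subst sum.insert) (auto simp: J intro!: sum.cong)
      have p: "(\<Prod>j\<in>J-K. CLINT \<omega>|M. iexp ((a(k:=u)) j * Z j \<omega>)) = (CLINT \<omega>|M. iexp (u * Z k \<omega>)) * (\<Prod>j\<in>J-insert k K. CLINT \<omega>|M. iexp (a j * Z j \<omega>))"
        unfolding JK by (subst prod.insert) (auto simp: J intro!: prod.cong)
      have "(CLINT \<omega>|M. iexp (u * Z k \<omega>) * W \<omega>) = (CLINT \<omega>|M. (\<Prod>j\<in>K. indicator (B j) (Z j \<omega>)) * iexp (\<Sum>j\<in>J-K. (a(k:=u)) j * Z j \<omega>))"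
        by (rule Bochner_Integration.integral_cong[OF refl]) (subst s, simp only: W_def of_real_add distrib_left exp_add mult_ac)
      then show ?thesis using insert.IH[OF kJ(2) BK, of "a(k:=u)"] by (simp only: p)
    qed
    have W0: "(CLINT \<omega>|M. W \<omega>) = (\<Prod>j\<in>K. complex_of_real (prob {\<omega>\<in>space M. Z j \<omega> \<in> B j})) * (\<Prod>j\<in>J-insert k K. CLINT \<omega>|M. iexp (a j * Z j \<omega>))"
      using IH[of 0] by (simp add: prob_space)
    have ind: "(CLINT \<omega>|M. indicator (B k) (Z k \<omega>) * W \<omega>) = complex_of_real (prob {\<omega>\<in>space M. Z k \<omega> \<in> B k}) * (CLINT \<omega>|M. W \<omega>)"
    proof (rule char_factor_weight)
      show "W \<in> borel_measurable M"
      proof -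
        have "(\<lambda>\<omega>. indicator (B j) (Z j \<omega>) :: complex) \<in> borel_measurable M" if "j \<in> K" for j
          using kJ(2) that by (intro measurable_compose[OF Z borel_measurable_indicator[OF BK]]) auto
        then have 1: "(\<lambda>\<omega>. \<Prod>j\<in>K. indicator (B j) (Z j \<omega>) :: complex) \<in> borel_measurable M"
          by (rule borel_measurable_prod)
        have "(\<lambda>\<omega>. \<Sum>j\<in>J-insert k K. a j * Z j \<omega>) \<in> borel_measurable M"
          by (intro borel_measurable_sum borel_measurable_times Z) auto
        from measurable_compose[OF this, of iexp borel]
        have 2: "(\<lambda>\<omega>. iexp (\<Sum>j\<in>J-insert k K. a j * Z j \<omega>)) \<in> borel_measurable M" by measurable
        show ?thesis unfolding W_def by (rule borel_measurable_times[OF 1 2])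
      qed
      show "norm (W \<omega>) \<le> 1" for \<omega>
        by (auto simp: W_def norm_mult prod_norm[symmetric] indicator_def intro!: prod_le_1)
    qed (use IH in \<open>simp_all add: W0 mult.left_commute\<close>)
    have split: "(\<Prod>j\<in>insert k K. indicator (B j) (Z j \<omega>)) * iexp (\<Sum>j\<in>J-insert k K. a j * Z j \<omega>) = indicator (B k) (Z k \<omega>) * W \<omega>" for \<omega>
      using insert.hyps by (simp add: W_def mult.assoc)
    show ?case unfolding split ind W0 unfolding prod.insert[OF insert.hyps] by (simp only: mult.assoc)
  qed
  show ?thesis
    unfolding indep_vars_def2
  proof (intro conjI ballI indep_setsI)
    show "Z j \<in> borel_measurable M" if "j \<in> J" for j by (rule Z[OF that])
    show "{Z i -` A \<inter> space M |A. A \<in> sets borel} \<subseteq> events" if "i \<in> J" for i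
      using Z[OF that] by (auto intro: measurable_sets)
    fix A K assume K: "K \<noteq> {}" "K \<subseteq> J" "finite K" and "\<forall>j\<in>K. A j \<in> {Z j -` A \<inter> space M |A. A \<in> sets borel}"
    then have "\<forall>j\<in>K. \<exists>B. A j = Z j -` B \<inter> space M \<and> B \<in> sets borel" by blast
    then obtain B where B: "\<And>j. j \<in> K \<Longrightarrow> A j = Z j -` B j \<inter> space M" "\<And>j. j \<in> K \<Longrightarrow> B j \<in> sets borel"
      by metis
    have Am: "A j \<in> events" if "j \<in> K" for j
      unfolding B(1)[OF that] using K(2) that by (intro measurable_sets[OF Z B(2)]) auto
    have "complex_of_real (prob (\<Inter>j\<in>K. A j)) = (CLINT \<omega>|M. complex_of_real (indicator (\<Inter>j\<in>K. A j) \<omega>))"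
    proof -
      have "(\<Inter>j\<in>K. A j) \<in> events" using K(3,1) Am by (rule sets.finite_INT)
      from sets.sets_into_space[OF this] have "(\<Inter>j\<in>K. A j) \<inter> space M = (\<Inter>j\<in>K. A j)" by (rule Int_absorb2)
      then show ?thesis
        by (simp only: integral_complex_of_real Bochner_Integration.integral_indicator scaleR_one mult_1_right)
    qed
    also have "\<dots> = (CLINT \<omega>|M. (\<Prod>j\<in>K. indicator (B j) (Z j \<omega>)))"
    proof (rule Bochner_Integration.integral_cong)
      fix \<omega> assume w: "\<omega> \<in> space M"
      have "complex_of_real (indicator (\<Inter>j\<in>K. A j) \<omega>) = (\<Prod>j\<in>K. indicator (A j) \<omega>)"
        using K(3,1) by (induction K rule: finite_ne_induct) (auto simp: indicator_def)
      also have "\<dots> = (\<Prod>j\<in>K. indicator (B j) (Z j \<omega>))"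
        by (rule prod.cong) (auto simp: B(1) w indicator_def)
      finally show "complex_of_real (indicator (\<Inter>j\<in>K. A j) \<omega>) = (\<Prod>j\<in>K. indicator (B j) (Z j \<omega>))" .
    qed simp
    also have "\<dots> = (\<Prod>j\<in>K. complex_of_real (prob {\<omega>\<in>space M. Z j \<omega> \<in> B j}))"
    proof -
      have "(CLINT \<omega>|M. (\<Prod>j\<in>K. indicator (B j) (Z j \<omega>)) * iexp (\<Sum>j\<in>J-K. 0 * Z j \<omega>)) =
        (\<Prod>j\<in>K. complex_of_real (prob {\<omega>\<in>space M. Z j \<omega> \<in> B j})) * (\<Prod>j\<in>J-K. CLINT \<omega>|M. iexp (0 * Z j \<omega>))"
        by (rule key[OF K(3,2) B(2)])
      then show ?thesis by (simp add: prob_space)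
    qed
    also have "\<dots> = complex_of_real (\<Prod>j\<in>K. prob (A j))"
    proof -
      have "{\<omega>\<in>space M. Z j \<omega> \<in> B j} = A j" if "j \<in> K" for j using B(1)[OF that] by auto
      then show ?thesis by simp
    qed
    finally show "prob (\<Inter>j\<in>K. A j) = (\<Prod>j\<in>K. prob (A j))" by (simp only: of_real_eq_iff)
  qed
qed

lemma (in prob_space) indep_vars_orthogonal:
  fixes Z :: "'j \<Rightarrow> 'a \<Rightarrow> real"
  assumes J: "finite J" and G: "\<And>a. centred_gaussian M (\<lambda>\<omega>. \<Sum>j\<in>J. a j * Z j \<omega>)"
    and sq: "\<And>j. sq_int M (Z j)"
    and orth: "\<And>i j. i \<in> J \<Longrightarrow> j \<in> J \<Longrightarrow> i \<noteq> j \<Longrightarrow> ip M (Z i) (Z j) = 0"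
  shows "indep_vars (\<lambda>_. borel) Z J"
proof (rule indep_vars_char[OF J])
  show "Z j \<in> borel_measurable M" for j using sq by (simp add: sq_int_def)
  fix a
  have int: "integrable M (\<lambda>\<omega>. Z i \<omega> * Z j \<omega>)" for i j using integrable_inner[OF sq sq, of i j] by simp
  have ipa: "ip M (\<lambda>\<omega>. \<Sum>j\<in>J. b j * Z j \<omega>) (\<lambda>\<omega>. \<Sum>j\<in>J. b j * Z j \<omega>) = (\<Sum>j\<in>J. (b j)^2 * ip M (Z j) (Z j))" for b
  proof -
    have "ip M (\<lambda>\<omega>. \<Sum>j\<in>J. b j * Z j \<omega>) (\<lambda>\<omega>. \<Sum>j\<in>J. b j * Z j \<omega>) = (\<integral>\<omega>. (\<Sum>i\<in>J. \<Sum>j\<in>J. b i * b j * (Z i \<omega> * Z j \<omega>)) \<partial>M)"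
      unfolding ip_def by (rule Bochner_Integration.integral_cong) (auto simp: sum_product algebra_simps)
    also have "\<dots> = (\<Sum>i\<in>J. \<Sum>j\<in>J. b i * b j * ip M (Z i) (Z j))"
      by (simp add: int ip_def)
    also have "\<dots> = (\<Sum>i\<in>J. \<Sum>j\<in>J. if j = i then (b i)^2 * ip M (Z i) (Z i) else 0)"
      by (intro sum.cong refl) (auto simp: orth power2_eq_square)
    finally show ?thesis by (simp add: J)
  qed
  have one: "(CLINT \<omega>|M. iexp (a j * Z j \<omega>)) = exp (- ((a j)^2 * ip M (Z j) (Z j) / 2))" if "j \<in> J" for j
  proof -
    have "centred_gaussian M (\<lambda>\<omega>. \<Sum>i\<in>J. (if i = j then 1 else 0) * Z i \<omega>)" by (rule G)
    moreover have "(\<Sum>i\<in>J. (if i = j then 1 else 0) * Z i \<omega>) = Z j \<omega>" for \<omega>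
      using J that by (simp add: if_distrib[of "\<lambda>x. x * _"] sum.delta cong: if_cong)
    ultimately show ?thesis by (simp add: centred_gaussian_def)
  qed
  have "(CLINT \<omega>|M. iexp (1 * (\<Sum>j\<in>J. a j * Z j \<omega>))) = exp (- (1^2 * (\<Sum>j\<in>J. (a j)^2 * ip M (Z j) (Z j)) / 2))"
    using G[of a] unfolding centred_gaussian_def ipa by blast
  also have "exp (- (1^2 * (\<Sum>j\<in>J. (a j)^2 * ip M (Z j) (Z j)) / 2)) = (\<Prod>j\<in>J. exp (- ((a j)^2 * ip M (Z j) (Z j) / 2)))"
    using J by (simp add: exp_sum[symmetric] sum_divide_distrib sum_negf)
  finally show "(CLINT \<omega>|M. iexp (\<Sum>j\<in>J. a j * Z j \<omega>)) = (\<Prod>j\<in>J. CLINT \<omega>|M. iexp (a j * Z j \<omega>))"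
    by (simp only: mult_1 of_real_prod one cong: prod.cong)
qed


section \<open>Continuous versions\<close>

text \<open>Kolmogorov's criterion by chaining along dyadic points.  On the window \<open>[- K, K]\<close> every
  increment between neighbours at level \<open>n\<close> is at most \<open>J K n = q ^ n + b K n\<close>, where \<open>b K n\<close> is the
  sum of the fourth powers of all these increments divided by \<open>q ^ (3 * n)\<close>: an increment
  exceeding \<open>q ^ n\<close> is bounded by its fourth power divided by \<open>q ^ (3 * n)\<close>.  There are of the order of
  \<open>2 ^ n\<close> increments with fourth moment of the order of \<open>4 ^ - n\<close>, so any \<open>q < 1\<close> with
  \<open>2 * q ^ 3 > 1\<close> makes \<open>\<Sum>n. J K n\<close> finite almost surely.  The step functions
  \<open>y n t = Y (floor (2 ^ n * t) / 2 ^ n)\<close> then converge locally uniformly, and their jumps tend to \<open>0\<close>,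
  so the limit is continuous.\<close>

lemma continuous_version:
  fixes Y :: "real \<Rightarrow> 'a \<Rightarrow> real"
  assumes M: "prob_space M" and meas [measurable]: "\<And>t. Y t \<in> borel_measurable M"
    and mom: "\<And>s t. (\<integral>\<^sup>+\<omega>. ennreal ((Y t \<omega> - Y s \<omega>)^4) \<partial>M) \<le> ennreal (C * (t - s)^2)"
    and zero: "AE \<omega> in M. Y 0 \<omega> = 0"
  obtains Z where "\<And>t. Z t \<in> borel_measurable M" "\<And>\<omega>. continuous_on UNIV (\<lambda>t. Z t \<omega>)"
    "\<And>\<omega>. Z 0 \<omega> = 0" "\<And>t. AE \<omega> in M. Z t \<omega> = Y t \<omega>"
proof -
  interpret prob_space M by fact
  define d where "d n k \<omega> = \<bar>Y (of_int (k + 1) / 2^n) \<omega> - Y (of_int k / 2^n) \<omega>\<bar>" for n :: nat and k :: int and \<omega>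
  have [measurable]: "d n k \<in> borel_measurable M" for n k unfolding d_def by measurable
  define I where "I K n = {- (int K * 2^n) .. int K * 2^n}" for K n :: nat
  define q where "q = (9/10 :: real)"
  define b where "b K n \<omega> = (\<Sum>k\<in>I K n. (d n k \<omega>)^4) / q^(3*n)" for K n \<omega>
  have [measurable]: "b K n \<in> borel_measurable M" for K n unfolding b_def by measurable
  have b0: "0 \<le> b K n \<omega>" for K n \<omega> by (auto simp: b_def q_def intro!: divide_nonneg_pos sum_nonneg)
  \<comment> \<open>Off this event of probability one the version is set to \<open>0\<close>, so that its paths are continuous everywhere.\<close>
  define G where "G = {\<omega>\<in>space M. \<forall>K. (\<Sum>n. ennreal (b K n \<omega>)) \<noteq> \<infinity>}"
  have [measurable]: "G \<in> sets M" unfolding G_def by measurable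
  define D where "D = max C 0"
  have mom': "(\<integral>\<^sup>+\<omega>. ennreal ((Y t \<omega> - Y s \<omega>)^4) \<partial>M) \<le> ennreal (D * (t - s)^2)" for s t
    by (rule order_trans[OF mom]) (auto intro!: ennreal_leI mult_right_mono simp: D_def)
  have "AE \<omega> in M. \<forall>K. (\<Sum>n. ennreal (b K n \<omega>)) \<noteq> \<infinity>"
    unfolding AE_all_countable
  proof
    fix K
    have e1: "(\<integral>\<^sup>+\<omega>. ennreal (b K n \<omega>) \<partial>M) \<le> ennreal ((2 * real K + 1) * D * (1000/1458)^n)" for n
    proof -
      have "(\<integral>\<^sup>+\<omega>. ennreal (b K n \<omega>) \<partial>M) = (\<integral>\<^sup>+\<omega>. ennreal (1 / q^(3*n)) * (\<Sum>k\<in>I K n. ennreal ((d n k \<omega>)^4)) \<partial>M)"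
        by (intro nn_integral_cong, subst sum_ennreal) (auto simp: b_def q_def ennreal_mult[symmetric] sum_nonneg)
      also have "\<dots> = ennreal (1 / q^(3*n)) * (\<Sum>k\<in>I K n. \<integral>\<^sup>+\<omega>. ennreal ((d n k \<omega>)^4) \<partial>M)"
        by (simp add: nn_integral_cmult nn_integral_sum del: sum_ennreal)
      also have "\<dots> \<le> ennreal (1 / q^(3*n)) * (\<Sum>k\<in>I K n. ennreal (D * (1 / 2^n)^2))"
      proof (intro mult_left_mono sum_mono)
        fix k
        have "of_int (k + 1) / 2^n - of_int k / 2^n = (1 / 2^n :: real)" by (simp add: field_simps)
        then show "(\<integral>\<^sup>+\<omega>. ennreal ((d n k \<omega>)^4) \<partial>M) \<le> ennreal (D * (1 / 2^n)^2)"
          using mom'[of "of_int (k + 1) / 2^n" "of_int k / 2^n"] by (simp add: d_def)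
      qed simp
      also have "\<dots> = ennreal (1 / q^(3*n) * ((2 * real K * 2^n + 1) * (D * (1 / 2^n)^2)))"
      proof -
        have "int (card (I K n)) = 2 * int K * 2^n + 1" by (simp add: I_def algebra_simps)
        then have "real_of_int (int (card (I K n))) = 2 * real K * 2^n + 1" by simp
        then have card: "real (card (I K n)) = 2 * real K * 2^n + 1" by simp
        have D0: "0 \<le> D" by (simp add: D_def)
        have q0: "0 \<le> 1 / q^(3*n)" by (simp add: q_def)
        show ?thesis
          by (simp only: sum_constant ennreal_of_nat_eq_real_of_nat card)
             (intro trans[OF _ ennreal_mult[symmetric]] arg_cong2[where f="(*)"] refl ennreal_mult[symmetric] q0 mult_nonneg_nonneg D0, simp_all)
      qed
      also have "\<dots> \<le> ennreal ((2 * real K + 1) * D * (1000/1458)^n)"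
      proof (rule ennreal_leI)
        have "1 / q^(3*n) * ((2 * real K * 2^n + 1) * (D * (1 / 2^n)^2)) \<le>
           1 / q^(3*n) * (((2 * real K + 1) * 2^n) * (D * (1 / 2^n)^2))"
          by (intro mult_left_mono mult_right_mono) (auto simp: D_def q_def algebra_simps)
        also have "\<dots> = (2 * real K + 1) * D * (2^n * (1 / 2^n)^2 / q^(3*n))" by simp
        also have "2^n * (1 / 2^n)^2 / q^(3*n) = (1000/1458::real)^n"
        proof -
          have "q^(3*n) = (q^3)^n" by (simp only: power_mult)
          then have "2^n * (1 / 2^n)^2 / q^(3*n) = (1 / (2 * q^3))^n"
            by (simp add: power2_eq_square power_mult_distrib power_divide)
          also have "1 / (2 * q^3) = 1000/1458"
            by (simp add: q_def power3_eq_cube)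
          finally show ?thesis .
        qed
        finally show "1 / q^(3*n) * ((2 * real K * 2^n + 1) * (D * (1 / 2^n)^2)) \<le> (2 * real K + 1) * D * (1000/1458)^n" .
      qed
      finally show ?thesis .
    qed
    have "(\<integral>\<^sup>+\<omega>. (\<Sum>n. ennreal (b K n \<omega>)) \<partial>M) = (\<Sum>n. \<integral>\<^sup>+\<omega>. ennreal (b K n \<omega>) \<partial>M)"
      by (intro nn_integral_suminf) measurable
    also have "\<dots> \<le> (\<Sum>n. ennreal ((2 * real K + 1) * D * (1000/1458)^n))"
      by (intro suminf_le summableI e1)
    also have "\<dots> < \<infinity>"
      by (subst suminf_ennreal2) (auto simp: D_def intro!: summable_mult summable_geometric)
    finally have "(\<integral>\<^sup>+\<omega>. (\<Sum>n. ennreal (b K n \<omega>)) \<partial>M) \<noteq> \<infinity>" by simp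
    then show "AE \<omega> in M. (\<Sum>n. ennreal (b K n \<omega>)) \<noteq> \<infinity>"
      by (intro nn_integral_PInf_AE) auto
  qed
  then have AEG: "AE \<omega> in M. \<omega> \<in> G" by (rule AE_mp) (auto simp: G_def intro!: AE_I2)
  define y where "y n t \<omega> = Y (of_int \<lfloor>2^n * t\<rfloor> / 2^n) \<omega>" for n :: nat and t :: real and \<omega>
  have [measurable]: "y n t \<in> borel_measurable M" for n t unfolding y_def by measurable
  define J where "J K n \<omega> = q^n + b K n \<omega>" for K n \<omega>
  have sumJ: "summable (\<lambda>n. J K n \<omega>)" if "\<omega> \<in> G" for K \<omega>
    unfolding J_def
  proof (rule summable_add)
    show "summable (\<lambda>n. q^n)" by (simp add: q_def summable_geometric)
    show "summable (\<lambda>n. b K n \<omega>)" using that b0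
      by (intro summable_suminf_not_top) (auto simp: G_def infinity_ennreal_def)
  qed
  have dJ: "d n k \<omega> \<le> J K n \<omega>" if "k \<in> I K n" for n k K \<omega>
  proof (cases "d n k \<omega> \<le> q^n")
    case True then show ?thesis using b0[of K n \<omega>] by (simp add: J_def)
  next
    case False
    have qp: "0 < q^n" by (simp add: q_def)
    have d0: "0 \<le> d n k \<omega>" by (simp add: d_def)
    have "d n k \<omega> * q^(3*n) = d n k \<omega> * (q^n)^3" by (simp add: power_mult mult.commute[of 3 n])
    also have "\<dots> \<le> d n k \<omega> * (d n k \<omega>)^3"
      using False qp by (intro mult_left_mono power_mono d0) auto
    also have "\<dots> = (d n k \<omega>)^4" by (simp add: power_numeral_reduce)
    also have "\<dots> \<le> (\<Sum>k\<in>I K n. (d n k \<omega>)^4)"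
      by (rule member_le_sum[OF that]) (auto simp: I_def)
    finally have "d n k \<omega> \<le> b K n \<omega>" by (simp add: b_def q_def field_simps)
    then show ?thesis using qp by (simp add: J_def)
  qed
  have inI: "\<lfloor>2^n * t\<rfloor> \<in> I K n" if "\<bar>t\<bar> \<le> real K" for t :: real and n K
  proof -
    have "\<bar>2^n * t\<bar> \<le> 2^n * real K" using that by (simp add: abs_mult)
    then have "- (real K * 2^n) \<le> 2^n * t" "2^n * t \<le> real K * 2^n" by (auto simp: abs_le_iff algebra_simps)
    then have "of_int (- (int K * 2^n)) \<le> 2^n * t" "2^n * t \<le> of_int (int K * 2^n)" by simp_all
    then show ?thesis unfolding I_def by (simp only: atLeastAtMost_iff le_floor_iff) (meson floor_mono floor_of_int order_trans order_refl of_int_floor_le of_int_le_iff)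
  qed
  have ystep: "\<bar>y (Suc n) t \<omega> - y n t \<omega>\<bar> \<le> J K (Suc n) \<omega>" if t: "\<bar>t\<bar> \<le> real K" and w: "\<omega> \<in> G" for n t K \<omega>
  proof -
    define k where "k = \<lfloor>2^n * t\<rfloor>"
    define m where "m = \<lfloor>2^Suc n * t\<rfloor>"
    have kk: "of_int k \<le> 2^n * t" "2^n * t < of_int k + 1" unfolding k_def by linarith+
    have "m = 2 * k \<or> m = 2 * k + 1" unfolding m_def using kk by (simp add: floor_eq_iff) linarith
    then show ?thesis
    proof
      assume "m = 2 * k"
      then have "of_int m / 2^Suc n = (of_int k / 2^n :: real)" by simp
      then show ?thesis using b0[of K "Suc n" \<omega>] by (simp add: y_def J_def k_def m_def q_def)
    next
      assume m: "m = 2 * k + 1"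
      have e: "of_int (2 * k) / 2^Suc n = (of_int k / 2^n :: real)" by simp
      have "k \<in> I K n" unfolding k_def by (rule inI[OF t])
      moreover have "int K * 2^Suc n = 2 * (int K * 2^n)" by simp
      ultimately have "2 * k \<in> I K (Suc n)" unfolding I_def atLeastAtMost_iff by linarith
      then have "d (Suc n) (2 * k) \<omega> \<le> J K (Suc n) \<omega>" by (rule dJ)
      then show ?thesis using m e by (simp add: d_def y_def k_def[symmetric] m_def[symmetric] del: power_Suc)
    qed
  qed
  have Jt: "summable (\<lambda>n. J K (Suc n) \<omega>)" if "\<omega> \<in> G" for K \<omega>
    by (subst summable_Suc_iff) (rule sumJ[OF that])
  have J0: "0 \<le> J K n \<omega>" for K n \<omega> using b0 by (simp add: J_def q_def)
  have tail: "\<bar>y (n + m) t \<omega> - y n t \<omega>\<bar> \<le> (\<Sum>j. J K (Suc (j + n)) \<omega>)" if t: "\<bar>t\<bar> \<le> real K" and w: "\<omega> \<in> G" for n m t K \<omega>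
  proof -
    have "\<bar>y (n + m) t \<omega> - y n t \<omega>\<bar> \<le> (\<Sum>j<m. J K (Suc (j + n)) \<omega>)"
    proof (induction m)
      case (Suc m)
      then show ?case using ystep[OF t w, of "n + m"] by (simp add: add.commute)
    qed simp
    also have "\<dots> \<le> (\<Sum>j. J K (Suc (j + n)) \<omega>)"
      using Jt[OF w, of K] J0 by (intro sum_le_suminf) (auto simp: summable_iff_shift[of "\<lambda>n. J K (Suc n) \<omega>"])
    finally show ?thesis .
  qed
  have tail0: "(\<lambda>n. \<Sum>j. J K (Suc (j + n)) \<omega>) \<longlonglongrightarrow> 0" if "\<omega> \<in> G" for K \<omega>
    using suminf_exist_split2[OF Jt[OF that, of K]] by simp
  have conv: "convergent (\<lambda>n. y n t \<omega>)" if w: "\<omega> \<in> G" for t \<omega>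
  proof -
    obtain K where K: "\<bar>t\<bar> \<le> real K" using real_arch_simple by blast
    have "summable (\<lambda>n. y (Suc n) t \<omega> - y n t \<omega>)"
      using ystep[OF K w] by (intro summable_comparison_test'[OF Jt[OF w, of K], of 0]) simp
    then have "convergent (\<lambda>n. \<Sum>k<n. y (Suc k) t \<omega> - y k t \<omega>)" by (simp add: summable_iff_convergent)
    then have "convergent (\<lambda>n. y n t \<omega> - y 0 t \<omega>)" by (simp add: sum_lessThan_telescope[of "\<lambda>k. y k t \<omega>"])
    then have "convergent (\<lambda>n. (y n t \<omega> - y 0 t \<omega>) + y 0 t \<omega>)" by (intro convergent_add convergent_const)
    then show ?thesis by simp
  qed
  define L where "L t \<omega> = lim (\<lambda>n. y n t \<omega>)" for t \<omega>
  have [measurable]: "L t \<in> borel_measurable M" for t unfolding L_def by measurable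
  have Llim: "(\<lambda>n. y n t \<omega>) \<longlonglongrightarrow> L t \<omega>" if "\<omega> \<in> G" for t \<omega>
    using conv[OF that] by (simp add: L_def convergent_LIMSEQ_iff)
  have Ly: "\<bar>L t \<omega> - y n t \<omega>\<bar> \<le> (\<Sum>j. J K (Suc (j + n)) \<omega>)" if t: "\<bar>t\<bar> \<le> real K" and w: "\<omega> \<in> G" for n t K \<omega>
  proof (rule LIMSEQ_le_const2)
    show "(\<lambda>m. \<bar>y (m + n) t \<omega> - y n t \<omega>\<bar>) \<longlonglongrightarrow> \<bar>L t \<omega> - y n t \<omega>\<bar>"
      by (intro tendsto_intros LIMSEQ_ignore_initial_segment Llim w)
    show "\<exists>N. \<forall>m\<ge>N. \<bar>y (m + n) t \<omega> - y n t \<omega>\<bar> \<le> (\<Sum>j. J K (Suc (j + n)) \<omega>)"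
      using tail[OF t w, of n] by (simp add: add.commute)
  qed
  have ynear: "\<bar>y n t \<omega> - y n s \<omega>\<bar> \<le> J K n \<omega>" if st: "s \<le> t" "t < s + 1 / 2^n" "\<bar>s\<bar> \<le> real K" and w: "\<omega> \<in> G" for n s t K \<omega>
  proof -
    define k where "k = \<lfloor>2^n * s\<rfloor>"
    have kI: "k \<in> I K n" unfolding k_def by (rule inI[OF st(3)])
    have a: "2^n * s \<le> 2^n * t" "2^n * t < 2^n * s + 1" using st by (auto simp: field_simps)
    have kk: "of_int k \<le> 2^n * s" "2^n * s < of_int k + 1" unfolding k_def by linarith+
    have "\<lfloor>2^n * t\<rfloor> = k \<or> \<lfloor>2^n * t\<rfloor> = k + 1"
      using a kk unfolding floor_eq_iff of_int_add of_int_1 by linarith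
    then show ?thesis
      using dJ[OF kI, of \<omega>] J0[of K n \<omega>] by (auto simp: y_def k_def[symmetric] d_def)
  qed
  have contL: "continuous_on UNIV (\<lambda>t. L t \<omega>)" if w: "\<omega> \<in> G" for \<omega>
    unfolding continuous_on_iff
  proof (intro ballI allI impI)
    fix t :: real and e :: real assume e: "0 < e"
    obtain K where K: "\<bar>t\<bar> + 1 \<le> real K" using real_arch_simple by blast
    have "(\<lambda>n. J K n \<omega>) \<longlonglongrightarrow> 0" by (rule summable_LIMSEQ_zero[OF sumJ[OF w]])
    then have "\<forall>\<^sub>F n in sequentially. J K n \<omega> < e / 3" using e by (intro order_tendstoD) auto
    moreover have "\<forall>\<^sub>F n in sequentially. (\<Sum>j. J K (Suc (j + n)) \<omega>) < e / 3"
      using e by (intro order_tendstoD(2)[OF tail0[OF w]]) auto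
    ultimately have "\<forall>\<^sub>F n in sequentially. J K n \<omega> < e / 3 \<and> (\<Sum>j. J K (Suc (j + n)) \<omega>) < e / 3"
      by eventually_elim auto
    then obtain n where n: "J K n \<omega> < e / 3" "(\<Sum>j. J K (Suc (j + n)) \<omega>) < e / 3"
      by (auto simp: eventually_sequentially)
    have "dist (L s \<omega>) (L t \<omega>) < e" if s: "dist s t < 1 / 2^n" for s
    proof -
      have "1 / 2^n \<le> (1::real)" by simp
      then have Ks: "\<bar>s\<bar> \<le> real K" "\<bar>t\<bar> \<le> real K" using s K unfolding dist_real_def by linarith+
      have "\<bar>y n s \<omega> - y n t \<omega>\<bar> \<le> J K n \<omega>"
      proof (cases "s \<le> t")
        case True
        then show ?thesis using ynear[of s t n K \<omega>] s Ks w by (simp add: dist_real_def abs_minus_commute)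
      next
        case False
        then show ?thesis using ynear[of t s n K \<omega>] s Ks w by (simp add: dist_real_def)
      qed
      then show ?thesis
        using Ly[OF Ks(1) w, of n] Ly[OF Ks(2) w, of n] n unfolding dist_real_def by linarith
    qed
    then show "\<exists>d>0. \<forall>s\<in>UNIV. dist s t < d \<longrightarrow> dist (L s \<omega>) (L t \<omega>) < e"
      by (intro exI[of _ "1 / 2^n"]) auto
  qed
  have LY: "AE \<omega> in M. L t \<omega> = Y t \<omega>" for t
  proof -
    have e1: "(\<integral>\<^sup>+\<omega>. ennreal ((Y t \<omega> - y n t \<omega>)^4) \<partial>M) \<le> ennreal (D * (1/4)^n)" for n
    proof -
      have "of_int \<lfloor>2^n * t\<rfloor> \<le> 2^n * t" "2^n * t \<le> of_int \<lfloor>2^n * t\<rfloor> + 1" by linarith+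
      then have "of_int \<lfloor>2^n * t\<rfloor> / 2^n \<le> t" "t \<le> (of_int \<lfloor>2^n * t\<rfloor> + 1) / 2^n"
        by (simp_all add: field_simps)
      then have "\<bar>t - of_int \<lfloor>2^n * t\<rfloor> / 2^n\<bar> \<le> 1 / 2^n"
        unfolding add_divide_distrib by linarith
      then have "\<bar>t - of_int \<lfloor>2^n * t\<rfloor> / 2^n\<bar>^2 \<le> (1 / 2^n)^2" by (intro power_mono) auto
      also have "(1 / 2^n)^2 = (1/4::real)^n"
        by (simp add: power_divide power_mult[symmetric] mult.commute[of n 2]) (simp add: power_mult)
      finally have "D * (t - of_int \<lfloor>2^n * t\<rfloor> / 2^n)^2 \<le> D * (1/4)^n"
        by (intro mult_left_mono) (auto simp: D_def)
      then show ?thesis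
        using mom'[of t "of_int \<lfloor>2^n * t\<rfloor> / 2^n"] unfolding y_def by (meson ennreal_leI order_trans)
    qed
    have "(\<integral>\<^sup>+\<omega>. (\<Sum>n. ennreal ((Y t \<omega> - y n t \<omega>)^4)) \<partial>M) = (\<Sum>n. \<integral>\<^sup>+\<omega>. ennreal ((Y t \<omega> - y n t \<omega>)^4) \<partial>M)"
      by (intro nn_integral_suminf) measurable
    also have "\<dots> \<le> (\<Sum>n. ennreal (D * (1/4)^n))" by (intro suminf_le summableI e1)
    also have "\<dots> < \<infinity>"
      by (subst suminf_ennreal2) (auto simp: D_def intro!: summable_mult summable_geometric)
    finally have "AE \<omega> in M. (\<Sum>n. ennreal ((Y t \<omega> - y n t \<omega>)^4)) \<noteq> \<infinity>"
      by (intro nn_integral_PInf_AE) auto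
    then show ?thesis using AEG
    proof eventually_elim
      case (elim \<omega>)
      then have "summable (\<lambda>n. (Y t \<omega> - y n t \<omega>)^4)"
        by (intro summable_suminf_not_top) (auto simp: infinity_ennreal_def)
      then have "(\<lambda>n. (Y t \<omega> - y n t \<omega>)^4) \<longlonglongrightarrow> 0" by (rule summable_LIMSEQ_zero)
      moreover have "(\<lambda>n. (Y t \<omega> - y n t \<omega>)^4) \<longlonglongrightarrow> (Y t \<omega> - L t \<omega>)^4"
        by (intro tendsto_intros Llim elim)
      ultimately have "(Y t \<omega> - L t \<omega>)^4 = 0" by (rule LIMSEQ_unique[symmetric])
      then show ?case by simp
    qed
  qed
  define Z where "Z t \<omega> = (if \<omega> \<in> G then L t \<omega> - L 0 \<omega> else 0)" for t \<omega>
  show ?thesis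
  proof (rule that)
    show "Z t \<in> borel_measurable M" for t unfolding Z_def by measurable
    show "continuous_on UNIV (\<lambda>t. Z t \<omega>)" for \<omega>
      by (cases "\<omega> \<in> G") (auto simp: Z_def intro!: continuous_on_diff continuous_on_const contL)
    show "Z 0 \<omega> = 0" for \<omega> by (simp add: Z_def)
    show "AE \<omega> in M. Z t \<omega> = Y t \<omega>" for t
      using AEG LY[of t] LY[of 0] zero by eventually_elim (simp add: Z_def)
  qed
qed


section \<open>Fourier-type integrals of powers\<close>

lemma Gamma_reflection_real:
  fixes x :: real assumes "0 < x" "x < 1"
  shows "Gamma x * Gamma (1 - x) = pi / sin (pi * x)"
proof -
  have "complex_of_real (Gamma x * Gamma (1 - x)) = complex_of_real (pi / sin (pi * x))"
  proof -
    have eq: "1 - complex_of_real x = complex_of_real (1 - x)" "complex_of_real pi * complex_of_real x = complex_of_real (pi * x)"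
      by simp_all
    then have "complex_of_real (Gamma x) * complex_of_real (Gamma (1 - x)) = complex_of_real pi / complex_of_real (sin (pi * x))"
      using Gamma_reflection_complex[of "complex_of_real x"] by (simp only: Gamma_complex_of_real sin_of_real)
    then show ?thesis by simp
  qed
  then show ?thesis by (simp only: of_real_eq_iff)
qed

text \<open>The substitution \<open>t = x\<^sup>2 / (1 + x\<^sup>2)\<close> turns the Beta integral with parameters \<open>(a + 1) / 2\<close> and
  \<open>(1 - a) / 2\<close> into this one, and the reflection formula evaluates it.\<close>

lemma nn_integral_power_over_quadratic_1:
  assumes a: "-1 < a" "a < 1"
  shows "(\<integral>\<^sup>+x. ennreal (indicator {0<..} x * (x powr a / (1 + x^2))) \<partial>lborel) = ennreal (pi / (2 * cos (pi * a / 2)))"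
proof -
  define p where "p = (a + 1) / 2"
  have p: "0 < p" "p < 1" "0 < 1 - p" using a by (auto simp: p_def)
  define f where "f t = t powr (p - 1) * (1 - t) powr ((1 - p) - 1)" for t :: real
  define g where "g x = x^2 / (1 + x^2)" for x :: real
  define g' where "g' x = 2 * x / (1 + x^2)^2" for x :: real
  have img: "g ` {0<..} = {0<..<1}"
  proof (intro set_eqI iffI)
    fix t assume "t \<in> g ` {0<..}" then show "t \<in> {0<..<1}"
      by (auto simp: g_def field_simps add_pos_pos)
  next
    fix t :: real assume t: "t \<in> {0<..<1}"
    then have "0 < t / (1 - t)" by simp
    then have "sqrt (t / (1 - t)) \<in> {0<..}" "g (sqrt (t / (1 - t))) = t"
      using t by (auto simp: g_def field_simps)
    then show "t \<in> g ` {0<..}" by (metis image_eqI)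
  qed
  have inj: "inj_on g {0<..}"
  proof (rule inj_onI)
    fix x y :: real assume xy: "x \<in> {0<..}" "y \<in> {0<..}" "g x = g y"
    have "1 + x^2 \<noteq> 0" "1 + y^2 \<noteq> 0" by (simp_all add: add_nonneg_eq_0_iff)
    then have "x^2 = y^2" using xy(3) by (simp add: g_def frac_eq_eq algebra_simps)
    then show "x = y" using xy by (simp add: power2_eq_iff_nonneg)
  qed
  have der: "(g has_field_derivative g' x) (at x within {0<..})" for x
  proof -
    have nz: "1 + x^2 \<noteq> 0" by (simp add: add_nonneg_eq_0_iff)
    show ?thesis
      unfolding g_def g'_def by (rule derivative_eq_intros refl | rule nz)+ (use nz in \<open>simp add: power2_eq_square field_simps\<close>)
  qed
  have B: "(f has_integral (pi / sin (pi * p))) {0<..<1}"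
  proof -
    have "(f has_integral Beta p (1 - p)) {0..1}"
      unfolding f_def using has_integral_Beta_real[OF p(1,3)] .
    then have "(f has_integral Beta p (1 - p)) {0<..<1}"
      by (simp add: has_integral_Icc_iff_Ioo)
    then show ?thesis using Gamma_reflection_real[OF p(1,2)] by (simp add: Beta_def)
  qed
  have absB: "f absolutely_integrable_on {0<..<1}"
    using B by (intro nonnegative_absolutely_integrable_1) (auto simp: f_def)
  have main: "(\<lambda>x. \<bar>g' x\<bar> * f (g x)) absolutely_integrable_on {0<..} \<and>
      integral {0<..} (\<lambda>x. \<bar>g' x\<bar> * f (g x)) = pi / sin (pi * p)"
    using has_absolute_integral_change_of_variables_1'[OF _ der inj, of f "pi / sin (pi * p)"] absB B
    by (simp add: img integral_unique)
  have eq: "\<bar>g' x\<bar> * f (g x) = 2 * (x powr a / (1 + x^2))" if "x \<in> {0<..}" for x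
  proof -
    have x: "0 < x" using that by simp
    have s: "0 < 1 + x^2" by (simp add: add_pos_nonneg)
    have 1: "1 - g x = 1 / (1 + x^2)" using s by (simp add: g_def field_simps)
    have A: "(x^2 / (1 + x^2)) powr (p - 1) = x powr (2 * (p - 1)) / (1 + x^2) powr (p - 1)"
      using x by (simp add: powr_divide powr_powr flip: powr_numeral)
    have B: "(1 / (1 + x^2)) powr ((1 - p) - 1) = (1 + x^2) powr p"
      by (simp add: powr_divide powr_minus)
    have C: "(1 + x^2) powr p = (1 + x^2) * (1 + x^2) powr (p - 1)"
      using s by (simp add: powr_mult_base)
    have "f (g x) = x powr (2 * (p - 1)) * (1 + x^2)"
      using s unfolding f_def 1 unfolding g_def A B C by simp
    also have "2 * (p - 1) = a - 1" by (simp add: p_def field_simps)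
    finally have "\<bar>g' x\<bar> * f (g x) = 2 * (x * x powr (a - 1)) / (1 + x^2)"
      using x s by (simp add: g'_def power2_eq_square)
    then show ?thesis using x by (simp add: powr_mult_base)
  qed
  have "((\<lambda>x. \<bar>g' x\<bar> * f (g x)) has_integral (pi / sin (pi * p))) {0<..}"
    using main by (metis absolutely_integrable_on_def has_integral_integral)
  then have "((\<lambda>x. 2 * (x powr a / (1 + x^2))) has_integral (pi / sin (pi * p))) {0<..}"
    by (rule has_integral_eq[rotated]) (simp add: eq)
  from has_integral_mult_right[OF this, of "1/2"]
  have "((\<lambda>x. x powr a / (1 + x^2)) has_integral (pi / sin (pi * p) / 2)) {0<..}"
    by (simp add: mult.commute)
  from nn_integral_has_integral_lebesgue[OF _ this]
  have "(\<integral>\<^sup>+x. ennreal (indicator {0<..} x * (x powr a / (1 + x^2))) \<partial>lborel) = ennreal (pi / sin (pi * p) / 2)"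
    by (simp add: add_nonneg_nonneg)
  also have "sin (pi * p) = cos (pi * a / 2)"
    using sin_add[of "pi * a / 2" "pi / 2"] by (simp add: p_def field_simps)
  finally show ?thesis by (simp add: mult.commute)
qed

lemma nn_integral_power_over_quadratic:
  assumes a: "-1 < a" "a < 1" and c: "c \<noteq> 0"
  shows "(\<integral>\<^sup>+x. ennreal (indicator {0<..} x * (x powr a / (c^2 + x^2))) \<partial>lborel) =
    ennreal (\<bar>c\<bar> powr (a - 1) * (pi / (2 * cos (pi * a / 2))))"
proof -
  have "(\<integral>\<^sup>+x. ennreal (indicator {0<..} x * (x powr a / (c^2 + x^2))) \<partial>lborel) =
    \<bar>c\<bar> * (\<integral>\<^sup>+x. ennreal (indicator {0<..} (0 + \<bar>c\<bar> * x) * ((0 + \<bar>c\<bar> * x) powr a / (c^2 + (0 + \<bar>c\<bar> * x)^2))) \<partial>lborel)"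
    using c by (subst nn_integral_real_affine[where c="\<bar>c\<bar>" and t=0]) auto
  also have "\<dots> = \<bar>c\<bar> * (\<integral>\<^sup>+x. ennreal (\<bar>c\<bar> powr (a - 2)) * ennreal (indicator {0<..} x * (x powr a / (1 + x^2))) \<partial>lborel)"
  proof (intro arg_cong2[where f="(*)"] refl nn_integral_cong)
    fix x :: real
    show "ennreal (indicator {0<..} (0 + \<bar>c\<bar> * x) * ((0 + \<bar>c\<bar> * x) powr a / (c^2 + (0 + \<bar>c\<bar> * x)^2))) =
      ennreal (\<bar>c\<bar> powr (a - 2)) * ennreal (indicator {0<..} x * (x powr a / (1 + x^2)))"
    proof (cases "0 < x")
      case True
      have "c^2 + (\<bar>c\<bar> * x)^2 = \<bar>c\<bar> powr 2 * (1 + x^2)"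
        using c by (simp add: power_mult_distrib algebra_simps)
      then have "(\<bar>c\<bar> * x) powr a / (c^2 + (\<bar>c\<bar> * x)^2) = \<bar>c\<bar> powr (a - 2) * (x powr a / (1 + x^2))"
        using True c by (simp add: powr_mult powr_diff)
      then show ?thesis using True c by (simp add: ennreal_mult[symmetric] zero_less_mult_iff)
    qed (use c in \<open>simp add: zero_less_mult_iff\<close>)
  qed
  also have "\<dots> = \<bar>c\<bar> * (ennreal (\<bar>c\<bar> powr (a - 2)) * ennreal (pi / (2 * cos (pi * a / 2))))"
    by (subst nn_integral_cmult, simp, simp only: nn_integral_power_over_quadratic_1[OF a])
  also have "\<dots> = ennreal (\<bar>c\<bar> * \<bar>c\<bar> powr (a - 2) * (pi / (2 * cos (pi * a / 2))))"
  proof -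
    have "pi * - 1 < pi * a" "pi * a < pi * 1" by (rule mult_strict_left_mono[OF a(1) pi_gt_zero], rule mult_strict_left_mono[OF a(2) pi_gt_zero])
    then have "0 < cos (pi * a / 2)" by (intro cos_gt_zero_pi) linarith+
    then show ?thesis by (simp add: ennreal_mult[symmetric] mult.assoc)
  qed
  also have "\<bar>c\<bar> * \<bar>c\<bar> powr (a - 2) = \<bar>c\<bar> powr (a - 1)" using c by (simp add: powr_mult_base)
  finally show ?thesis .
qed

lemma nn_integral_power_exp:
  assumes p: "0 < p" and k: "0 < k"
  shows "(\<integral>\<^sup>+x. ennreal (indicator {0<..} x * (x powr (p - 1) * exp (- (x * k)))) \<partial>lborel) = ennreal (Gamma p * k powr - p)"
proof -
  have "ennreal (Gamma p) = (\<integral>\<^sup>+t. ennreal (indicator {0..} t * t powr (p - 1) / exp t) \<partial>lborel)"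
    by (rule Gamma_conv_nn_integral_real[OF p])
  also have "\<dots> = \<bar>k\<bar> * (\<integral>\<^sup>+x. ennreal (indicator {0..} (0 + k * x) * (0 + k * x) powr (p - 1) / exp (0 + k * x)) \<partial>lborel)"
    using k by (subst nn_integral_real_affine[where c=k and t=0]) auto
  also have "\<dots> = ennreal k * (\<integral>\<^sup>+x. ennreal (k powr (p - 1)) * ennreal (indicator {0<..} x * (x powr (p - 1) * exp (- (x * k)))) \<partial>lborel)"
    using k by (intro arg_cong2[where f="(*)"] nn_integral_cong)
      (auto simp: indicator_def zero_le_mult_iff powr_mult exp_minus field_simps ennreal_mult[symmetric])
  also have "\<dots> = ennreal (k powr p) * (\<integral>\<^sup>+x. ennreal (indicator {0<..} x * (x powr (p - 1) * exp (- (x * k)))) \<partial>lborel)"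
  proof -
    have "ennreal k * ennreal (k powr (p - 1)) = ennreal (k powr p)"
      using k by (simp add: ennreal_mult[symmetric] powr_mult_base)
    then show ?thesis by (subst nn_integral_cmult, simp, simp only: mult.assoc[symmetric])
  qed
  finally have "ennreal (k powr - p) * ennreal (Gamma p) = ennreal (k powr - p) * (ennreal (k powr p) * (\<integral>\<^sup>+x. ennreal (indicator {0<..} x * (x powr (p - 1) * exp (- (x * k)))) \<partial>lborel))"
    by simp
  also have "\<dots> = (\<integral>\<^sup>+x. ennreal (indicator {0<..} x * (x powr (p - 1) * exp (- (x * k)))) \<partial>lborel)"
  proof -
    have "ennreal (k powr - p) * ennreal (k powr p) = 1"
      using k by (simp only: ennreal_mult[symmetric] powr_ge_zero powr_add[symmetric]) simp
    then show ?thesis by (simp only: mult.assoc[symmetric] mult_1)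
  qed
  finally have "(\<integral>\<^sup>+x. ennreal (indicator {0<..} x * (x powr (p - 1) * exp (- (x * k)))) \<partial>lborel) = ennreal (k powr - p) * ennreal (Gamma p)"
    by (rule sym)
  then show ?thesis
    using Gamma_real_pos[OF p] by (simp only: ennreal_mult[symmetric] powr_ge_zero less_imp_le mult.commute)
qed

lemma nn_integral_exp_1_minus_cos:
  assumes x: "0 < x"
  shows "(\<integral>\<^sup>+k. ennreal (indicator {0<..} k * ((1 - cos (t * k)) * exp (- (x * k)))) \<partial>lborel) = ennreal (t^2 / (x * (t^2 + x^2)))"
proof -
  define F where "F k = - exp (- (x * k)) / x - exp (- (x * k)) * (t * sin (t * k) - x * cos (t * k)) / (t^2 + x^2)" for k
  have s: "0 < t^2 + x^2" using x by (simp add: add_nonneg_pos)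
  have der: "DERIV F k :> (1 - cos (t * k)) * exp (- (x * k))" for k
    unfolding F_def using x s
    by (auto intro!: derivative_eq_intros) (auto simp: field_simps power2_eq_square)
  have e: "((\<lambda>k. exp (- (x * k))) \<longlongrightarrow> 0) at_top"
    using x by (intro filterlim_compose[OF exp_at_bot]) (simp add: filterlim_uminus_at_top[symmetric] filterlim_tendsto_pos_mult_at_top[OF tendsto_const _ filterlim_ident] filterlim_uminus_at_bot)
  have lim: "(F \<longlongrightarrow> 0) at_top"
  proof -
    have "((\<lambda>k. exp (- (x * k)) * ((t * sin (t * k) - x * cos (t * k)) / (t^2 + x^2))) \<longlongrightarrow> 0) at_top"
    proof (rule Lim_null_comparison)
      show "((\<lambda>k. exp (- (x * k)) * ((\<bar>t\<bar> + x) / (t^2 + x^2))) \<longlongrightarrow> 0) at_top"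
        by (rule tendsto_mult_left_zero[OF e])
      have "norm (exp (- (x * k)) * ((t * sin (t * k) - x * cos (t * k)) / (t^2 + x^2))) \<le> exp (- (x * k)) * ((\<bar>t\<bar> + x) / (t^2 + x^2))" for k
      proof -
        have "\<bar>t * sin (t * k)\<bar> \<le> \<bar>t\<bar>" "\<bar>x * cos (t * k)\<bar> \<le> x"
          using x by (simp_all add: abs_mult mult_left_le)
        then have "\<bar>t * sin (t * k) - x * cos (t * k)\<bar> \<le> \<bar>t\<bar> + x" by linarith
        then show ?thesis using s by (auto simp: abs_mult intro!: mult_left_mono divide_right_mono)
      qed
      then show "\<forall>\<^sub>F k in at_top. norm (exp (- (x * k)) * ((t * sin (t * k) - x * cos (t * k)) / (t^2 + x^2))) \<le> exp (- (x * k)) * ((\<bar>t\<bar> + x) / (t^2 + x^2))" by simp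
    qed
    from tendsto_diff[OF tendsto_divide[OF tendsto_minus[OF e] tendsto_const, of x] this] x
    show ?thesis by (simp add: F_def[abs_def])
  qed
  have "(\<integral>\<^sup>+k. ennreal (indicator {0<..} k * ((1 - cos (t * k)) * exp (- (x * k)))) \<partial>lborel) =
    (\<integral>\<^sup>+k. ennreal ((1 - cos (t * k)) * exp (- (x * k))) * indicator {0..} k \<partial>lborel)"
    by (intro nn_integral_cong) (auto simp: indicator_def)
  also have "\<dots> = ennreal (0 - F 0)"
    by (rule nn_integral_FTC_atLeast[OF _ der _ lim]) auto
  also have "0 - F 0 = t^2 / (x * (t^2 + x^2))" using x s by (simp add: F_def field_simps power2_eq_square)
  finally show ?thesis .
qed


text \<open>The power of \<open>k\<close> is written as \<open>\<Gamma> (p + 1) * k powr - (p + 1) = \<integral>\<^sup>+x. x powr p * exp (- (x * k))\<close>; after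
  exchanging the integrals, the inner one is elementary and the outer one is
  \<open>nn_integral_power_over_quadratic\<close>.\<close>

lemma nn_integral_1_minus_cos_power:
  assumes p: "0 < p" "p < 2"
  shows "(\<integral>\<^sup>+k. ennreal (indicator {0<..} k * ((1 - cos (t * k)) * k powr - (p + 1))) \<partial>lborel) =
    ennreal (\<bar>t\<bar> powr p * (pi / (2 * Gamma (p + 1) * sin (pi * p / 2))))"
proof (cases "t = 0")
  case False
  define G where "G = Gamma (p + 1)"
  have G: "0 < G" unfolding G_def using p by (intro Gamma_real_pos) auto
  have sp: "0 < sin (pi * p / 2)"
  proof (rule sin_gt_zero)
    show "0 < pi * p / 2" using p by simp
    have "pi * p < pi * 2" by (rule mult_strict_left_mono[OF p(2) pi_gt_zero])
    then show "pi * p / 2 < pi" by linarith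
  qed
  let ?f = "\<lambda>k x. ennreal (indicator {0<..} k * (indicator {0<..} x * ((1 - cos (t * k)) * (x powr p * exp (- (x * k))))))"
  have "ennreal G * (\<integral>\<^sup>+k. ennreal (indicator {0<..} k * ((1 - cos (t * k)) * k powr - (p + 1))) \<partial>lborel) =
     (\<integral>\<^sup>+k. ennreal G * ennreal (indicator {0<..} k * ((1 - cos (t * k)) * k powr - (p + 1))) \<partial>lborel)"
    by (subst nn_integral_cmult) auto
  also have "\<dots> = (\<integral>\<^sup>+k. (\<integral>\<^sup>+x. ?f k x \<partial>lborel) \<partial>lborel)"
  proof (rule nn_integral_cong)
    fix k :: real
    show "ennreal G * ennreal (indicator {0<..} k * ((1 - cos (t * k)) * k powr - (p + 1))) = (\<integral>\<^sup>+x. ?f k x \<partial>lborel)"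
    proof (cases "0 < k")
      case True
      have "(\<integral>\<^sup>+x. ?f k x \<partial>lborel) = (\<integral>\<^sup>+x. ennreal (1 - cos (t * k)) * ennreal (indicator {0<..} x * (x powr (p + 1 - 1) * exp (- (x * k)))) \<partial>lborel)"
        using True by (intro nn_integral_cong) (auto simp: ennreal_mult[symmetric] indicator_def)
      also have "\<dots> = ennreal (1 - cos (t * k)) * ennreal (Gamma (p + 1) * k powr - (p + 1))"
        using p by (subst nn_integral_cmult, simp, subst nn_integral_power_exp[OF _ True]) auto
      also have "\<dots> = ennreal G * ennreal (indicator {0<..} k * ((1 - cos (t * k)) * k powr - (p + 1)))"
        using True G by (simp add: ennreal_mult[symmetric] G_def[symmetric] mult_ac)
      finally show ?thesis by simp
    qed simp
  qed
  also have "\<dots> = (\<integral>\<^sup>+x. (\<integral>\<^sup>+k. ?f k x \<partial>lborel) \<partial>lborel)"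
    by (rule lborel_pair.Fubini'[symmetric]) measurable
  also have "\<dots> = (\<integral>\<^sup>+x. ennreal (t^2) * ennreal (indicator {0<..} x * (x powr (p - 1) / (t^2 + x^2))) \<partial>lborel)"
  proof (rule nn_integral_cong)
    fix x :: real
    show "(\<integral>\<^sup>+k. ?f k x \<partial>lborel) = ennreal (t^2) * ennreal (indicator {0<..} x * (x powr (p - 1) / (t^2 + x^2)))"
    proof (cases "0 < x")
      case True
      have "(\<integral>\<^sup>+k. ?f k x \<partial>lborel) = (\<integral>\<^sup>+k. ennreal (x powr p) * ennreal (indicator {0<..} k * ((1 - cos (t * k)) * exp (- (x * k)))) \<partial>lborel)"
        using True by (intro nn_integral_cong) (auto simp: ennreal_mult[symmetric] indicator_def mult_ac)
      also have "\<dots> = ennreal (x powr p) * ennreal (t^2 / (x * (t^2 + x^2)))"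
        by (subst nn_integral_cmult, simp, subst nn_integral_exp_1_minus_cos[OF True]) auto
      also have "\<dots> = ennreal (x powr p * (t^2 / (x * (t^2 + x^2))))"
        using True by (intro ennreal_mult[symmetric]) (auto simp: add_nonneg_nonneg)
      also have "x powr p * (t^2 / (x * (t^2 + x^2))) = t^2 * (x powr (p - 1) / (t^2 + x^2))"
        using True by (simp add: powr_diff)
      also have "ennreal \<dots> = ennreal (t^2) * ennreal (x powr (p - 1) / (t^2 + x^2))"
        by (intro ennreal_mult) (auto simp: add_nonneg_nonneg)
      finally show ?thesis using True by simp
    qed simp
  qed
  also have "\<dots> = ennreal (t^2) * ennreal (\<bar>t\<bar> powr (p - 1 - 1) * (pi / (2 * cos (pi * (p - 1) / 2))))"
    using p False by (subst nn_integral_cmult, simp, subst nn_integral_power_over_quadratic) auto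
  also have "cos (pi * (p - 1) / 2) = sin (pi * p / 2)"
    using cos_diff[of "pi * p / 2" "pi / 2"] by (simp add: field_simps)
  also have "ennreal (t^2) * ennreal (\<bar>t\<bar> powr (p - 1 - 1) * (pi / (2 * sin (pi * p / 2)))) =
      ennreal (t^2 * (\<bar>t\<bar> powr (p - 1 - 1) * (pi / (2 * sin (pi * p / 2)))))"
    using sp by (intro ennreal_mult[symmetric]) auto
  also have "t^2 * (\<bar>t\<bar> powr (p - 1 - 1) * (pi / (2 * sin (pi * p / 2)))) = \<bar>t\<bar> powr p * (pi / (2 * sin (pi * p / 2)))"
  proof -
    have "t^2 * \<bar>t\<bar> powr (p - 2) = \<bar>t\<bar> powr p"
      using False by (simp add: powr_diff)
    then show ?thesis by simp
  qed
  also have "\<dots> = G * (\<bar>t\<bar> powr p * (pi / (2 * G * sin (pi * p / 2))))" using G by simp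
  also have "ennreal \<dots> = ennreal G * ennreal (\<bar>t\<bar> powr p * (pi / (2 * G * sin (pi * p / 2))))"
    using G sp by (intro ennreal_mult) auto
  finally show ?thesis
    using G unfolding G_def[symmetric] by (subst (asm) ennreal_mult_cancel_left) auto
qed (use p in simp)

text \<open>Adding and subtracting the exponential makes the integrand nonnegative, so that the fundamental
  theorem for nonnegative functions applies.\<close>

lemma has_bochner_integral_exp_sin:
  fixes t x :: real
  assumes x: "0 < x"
  shows "has_bochner_integral lborel (\<lambda>k. indicator {0<..} k * (sin (t * k) * exp (- (x * k)))) (t / (t^2 + x^2))"
proof -
  define F where "F k = - exp (- (x * k)) / x - exp (- (x * k)) * (x * sin (t * k) + t * cos (t * k)) / (t^2 + x^2)" for k
  have s: "0 < t^2 + x^2" using x by (simp add: add_nonneg_pos)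
  have der: "DERIV F k :> (1 + sin (t * k)) * exp (- (x * k))" for k
    unfolding F_def using x s
    by (auto intro!: derivative_eq_intros) (auto simp: field_simps power2_eq_square)
  have e: "((\<lambda>k. exp (- (x * k))) \<longlongrightarrow> 0) at_top"
    using x by (intro filterlim_compose[OF exp_at_bot]) (simp add: filterlim_uminus_at_top[symmetric] filterlim_tendsto_pos_mult_at_top[OF tendsto_const _ filterlim_ident] filterlim_uminus_at_bot)
  have lim: "(F \<longlongrightarrow> 0) at_top"
  proof -
    have "((\<lambda>k. exp (- (x * k)) * ((x * sin (t * k) + t * cos (t * k)) / (t^2 + x^2))) \<longlongrightarrow> 0) at_top"
    proof (rule Lim_null_comparison)
      show "((\<lambda>k. exp (- (x * k)) * ((\<bar>t\<bar> + x) / (t^2 + x^2))) \<longlongrightarrow> 0) at_top"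
        by (rule tendsto_mult_left_zero[OF e])
      have "norm (exp (- (x * k)) * ((x * sin (t * k) + t * cos (t * k)) / (t^2 + x^2))) \<le> exp (- (x * k)) * ((\<bar>t\<bar> + x) / (t^2 + x^2))" for k
      proof -
        have "\<bar>t * cos (t * k)\<bar> \<le> \<bar>t\<bar>" "\<bar>x * sin (t * k)\<bar> \<le> x"
          using x by (simp_all add: abs_mult mult_left_le)
        then have "\<bar>x * sin (t * k) + t * cos (t * k)\<bar> \<le> \<bar>t\<bar> + x" by linarith
        then show ?thesis using s by (auto simp: abs_mult intro!: mult_left_mono divide_right_mono)
      qed
      then show "\<forall>\<^sub>F k in at_top. norm (exp (- (x * k)) * ((x * sin (t * k) + t * cos (t * k)) / (t^2 + x^2))) \<le> exp (- (x * k)) * ((\<bar>t\<bar> + x) / (t^2 + x^2))" by simp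
    qed
    from tendsto_diff[OF tendsto_divide[OF tendsto_minus[OF e] tendsto_const, of x] this] x
    show ?thesis by (simp add: F_def[abs_def])
  qed
  have sin1: "0 \<le> 1 + sin y" for y :: real using sin_ge_minus_one[of y] by linarith
  have n1: "(\<integral>\<^sup>+k. ennreal (indicator {0<..} k * ((1 + sin (t * k)) * exp (- (x * k)))) \<partial>lborel) = ennreal (1 / x + t / (t^2 + x^2))"
  proof -
    have "AE k in lborel. k \<noteq> (0::real)" by (rule AE_lborel_singleton)
    then have "(\<integral>\<^sup>+k. ennreal (indicator {0<..} k * ((1 + sin (t * k)) * exp (- (x * k)))) \<partial>lborel) =
      (\<integral>\<^sup>+k. ennreal ((1 + sin (t * k)) * exp (- (x * k))) * indicator {0..} k \<partial>lborel)"
      by (intro nn_integral_cong_AE, eventually_elim) (auto simp: indicator_def)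
    also have "\<dots> = ennreal (0 - F 0)"
      by (rule nn_integral_FTC_atLeast[OF _ der _ lim]) (auto simp: sin1)
    also have "0 - F 0 = 1 / x + t / (t^2 + x^2)" by (simp add: F_def)
    finally show ?thesis .
  qed
  have nz: "0 \<le> 1 / x + t / (t^2 + x^2)"
  proof -
    have "- t * x \<le> t^2 + x^2" using sum_squares_ge_zero[of "t + x" 0] sum_power2_ge_zero[of t x] zero_le_power2[of "t + x"] zero_le_power2[of "t - x"]
      by (simp add: power2_eq_square algebra_simps)
    then have "0 \<le> (t^2 + x^2 + t * x) / (x * (t^2 + x^2))" using x s by (intro divide_nonneg_pos) auto
    also have "\<dots> = 1 / x + t / (t^2 + x^2)" using x s by (simp add: field_simps)
    finally show ?thesis .
  qed
  have h1: "has_bochner_integral lborel (\<lambda>k. indicator {0<..} k * ((1 + sin (t * k)) * exp (- (x * k)))) (1 / x + t / (t^2 + x^2))"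
    by (rule has_bochner_integral_nn_integral[OF _ _ _ n1]) (use nz in \<open>auto simp: sin1 intro!: mult_nonneg_nonneg\<close>)
  have n2: "(\<integral>\<^sup>+k. ennreal (indicator {0<..} k * exp (- (x * k))) \<partial>lborel) = ennreal (1 / x)"
  proof -
    have "(\<integral>\<^sup>+k. ennreal (indicator {0<..} k * exp (- (x * k))) \<partial>lborel) =
       (\<integral>\<^sup>+k. ennreal (indicator {0<..} k * (k powr (1 - 1) * exp (- (k * x)))) \<partial>lborel)"
      by (intro nn_integral_cong) (auto simp: indicator_def mult.commute)
    also have "\<dots> = ennreal (1 / x)" using nn_integral_power_exp[OF _ x, of 1] x by (simp add: powr_minus_divide)
    finally show ?thesis .
  qed
  have h2: "has_bochner_integral lborel (\<lambda>k. indicator {0<..} k * exp (- (x * k))) (1 / x)"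
    by (rule has_bochner_integral_nn_integral[OF _ _ _ n2]) (use x in auto)
  have "has_bochner_integral lborel (\<lambda>k. indicator {0<..} k * ((1 + sin (t * k)) * exp (- (x * k))) - indicator {0<..} k * exp (- (x * k))) (1 / x + t / (t^2 + x^2) - 1 / x)"
    by (rule has_bochner_integral_diff[OF h1 h2])
  then show ?thesis by (simp add: algebra_simps)
qed

text \<open>The same exchange of integrals as in \<open>nn_integral_1_minus_cos_power\<close>.  A single term
  \<open>sin (s * k) * k powr - (\<alpha> + 1)\<close> is not integrable near \<open>0\<close> when \<open>\<alpha> \<ge> 1\<close>; in the
  combination below the linear terms cancel, which restores integrability for \<open>\<alpha> < 3\<close>.\<close>

lemma sin_power_integral_swap:
  fixes \<alpha> s t :: real
  assumes a: "0 < \<alpha>"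
    and int: "integrable lborel (\<lambda>k. indicator {0<..} k * ((sin (s * k) - sin (t * k) - sin ((s - t) * k)) * k powr - (\<alpha> + 1)))"
  defines "h \<equiv> \<lambda>x. indicator {0<..} x * (x powr \<alpha> * (s / (s^2 + x^2) - t / (t^2 + x^2) - (s - t) / ((s - t)^2 + x^2)))"
  shows "integrable lborel h"
    "(\<integral>x. h x \<partial>lborel) = Gamma (\<alpha> + 1) * (\<integral>k. indicator {0<..} k * ((sin (s * k) - sin (t * k) - sin ((s - t) * k)) * k powr - (\<alpha> + 1)) \<partial>lborel)"
proof -
  define A where "A k = sin (s * k) - sin (t * k) - sin ((s - t) * k)" for k
  define f where "f k x = indicator {0<..} k * (indicator {0<..} x * (A k * (x powr \<alpha> * exp (- (x * k)))))" for k x :: real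
  have [measurable]: "A \<in> borel_measurable borel" unfolding A_def by measurable
  have [measurable]: "(\<lambda>(k, x). f k x) \<in> borel_measurable (lborel \<Otimes>\<^sub>M lborel)" unfolding f_def by measurable
  have G: "0 < Gamma (\<alpha> + 1)" using a by (intro Gamma_real_pos) auto
  have b: "has_bochner_integral lborel (\<lambda>x. indicator {0<..} x * (x powr \<alpha> * exp (- (x * k)))) (Gamma (\<alpha> + 1) * k powr - (\<alpha> + 1))" if "0 < k" for k
    by (rule has_bochner_integral_nn_integral) (use nn_integral_power_exp[OF _ that, of "\<alpha> + 1"] a G in auto)
  have fk: "has_bochner_integral lborel (f k) (indicator {0<..} k * (Gamma (\<alpha> + 1) * (A k * k powr - (\<alpha> + 1))))" for k
  proof (cases "0 < k")
    case True
    have "has_bochner_integral lborel (\<lambda>x. A k * (indicator {0<..} x * (x powr \<alpha> * exp (- (x * k))))) (A k * (Gamma (\<alpha> + 1) * k powr - (\<alpha> + 1)))"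
      by (rule has_bochner_integral_mult_right[OF b[OF True]])
    moreover have "f k = (\<lambda>x. A k * (indicator {0<..} x * (x powr \<alpha> * exp (- (x * k)))))"
      using True by (auto simp: f_def fun_eq_iff)
    ultimately show ?thesis using True by (simp add: mult_ac)
  qed (simp add: f_def[abs_def] has_bochner_integral_zero)
  have nfk: "has_bochner_integral lborel (\<lambda>x. norm (f k x)) (Gamma (\<alpha> + 1) * norm (indicator {0<..} k * (A k * k powr - (\<alpha> + 1))))" for k
  proof (cases "0 < k")
    case True
    have "has_bochner_integral lborel (\<lambda>x. \<bar>A k\<bar> * (indicator {0<..} x * (x powr \<alpha> * exp (- (x * k))))) (\<bar>A k\<bar> * (Gamma (\<alpha> + 1) * k powr - (\<alpha> + 1)))"
      by (rule has_bochner_integral_mult_right[OF b[OF True]])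
    moreover have "(\<lambda>x. norm (f k x)) = (\<lambda>x. \<bar>A k\<bar> * (indicator {0<..} x * (x powr \<alpha> * exp (- (x * k)))))"
      using True by (auto simp: f_def fun_eq_iff abs_mult)
    ultimately show ?thesis using True by (simp add: mult_ac abs_mult)
  qed (simp add: f_def[abs_def] has_bochner_integral_zero)
  have intp: "integrable (lborel \<Otimes>\<^sub>M lborel) (\<lambda>(k, x). f k x)"
  proof (rule lborel_pair.Fubini_integrable)
    have "(\<lambda>k. \<integral>x. norm ((\<lambda>(k, x). f k x) (k, x)) \<partial>lborel) = (\<lambda>k. Gamma (\<alpha> + 1) * norm (indicator {0<..} k * (A k * k powr - (\<alpha> + 1))))"
      using has_bochner_integral_integral_eq[OF nfk] by (simp add: fun_eq_iff)
    then show "integrable lborel (\<lambda>k. \<integral>x. norm ((\<lambda>(k, x). f k x) (k, x)) \<partial>lborel)"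
      using int unfolding A_def by simp
    show "AE k in lborel. integrable lborel (\<lambda>x. (\<lambda>(k, x). f k x) (k, x))"
      using fk by (auto simp: has_bochner_integral_iff)
  qed measurable
  have hx: "(\<integral>k. f k x \<partial>lborel) = h x" for x
  proof (cases "0 < x")
    case True
    have "has_bochner_integral lborel (\<lambda>k. x powr \<alpha> * (indicator {0<..} k * (sin (s * k) * exp (- (x * k))) - indicator {0<..} k * (sin (t * k) * exp (- (x * k))) - indicator {0<..} k * (sin ((s - t) * k) * exp (- (x * k)))))
       (x powr \<alpha> * (s / (s^2 + x^2) - t / (t^2 + x^2) - (s - t) / ((s - t)^2 + x^2)))"
      by (intro has_bochner_integral_mult_right has_bochner_integral_diff has_bochner_integral_exp_sin True)
    moreover have "(\<lambda>k. f k x) = (\<lambda>k. x powr \<alpha> * (indicator {0<..} k * (sin (s * k) * exp (- (x * k))) - indicator {0<..} k * (sin (t * k) * exp (- (x * k))) - indicator {0<..} k * (sin ((s - t) * k) * exp (- (x * k)))))"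
      using True by (auto simp: f_def A_def fun_eq_iff indicator_def algebra_simps)
    ultimately have "has_bochner_integral lborel (\<lambda>k. f k x) (x powr \<alpha> * (s / (s^2 + x^2) - t / (t^2 + x^2) - (s - t) / ((s - t)^2 + x^2)))"
      by (simp only:)
    from has_bochner_integral_integral_eq[OF this] show ?thesis using True by (simp add: h_def)
  qed (simp add: f_def h_def)
  have "integrable lborel (\<lambda>x. \<integral>k. f k x \<partial>lborel)"
    by (rule lborel_pair.integrable_snd[OF intp])
  then show "integrable lborel h" by (simp only: hx)
  have "(\<integral>x. h x \<partial>lborel) = (\<integral>x. (\<integral>k. f k x \<partial>lborel) \<partial>lborel)" by (simp only: hx)
  also have "\<dots> = (\<integral>k. (\<integral>x. f k x \<partial>lborel) \<partial>lborel)" by (rule lborel_pair.Fubini_integral[OF intp])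
  also have "\<dots> = (\<integral>k. Gamma (\<alpha> + 1) * (indicator {0<..} k * (A k * k powr - (\<alpha> + 1))) \<partial>lborel)"
    by (rule Bochner_Integration.integral_cong) (auto simp: has_bochner_integral_integral_eq[OF fk])
  finally show "(\<integral>x. h x \<partial>lborel) = Gamma (\<alpha> + 1) * (\<integral>k. indicator {0<..} k * ((sin (s * k) - sin (t * k) - sin ((s - t) * k)) * k powr - (\<alpha> + 1)) \<partial>lborel)"
    by (simp only: A_def integral_mult_right_zero)
qed

text \<open>The regularised value of \<open>\<integral>x. x powr \<alpha> * s / (s\<^sup>2 + x\<^sup>2)\<close> over the half line.  The integral
  converges at infinity only for \<open>\<alpha> < 1\<close>; beyond that it is defined up to a multiple of \<open>s\<close>, which
  disappears in the combination \<open>s, t, s - t\<close>.\<close>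

definition sin_power_value :: "real \<Rightarrow> real \<Rightarrow> real" where
  "sin_power_value \<alpha> s =
    (if \<alpha> = 1 then - (s * ln \<bar>s\<bar>) else sgn s * \<bar>s\<bar> powr \<alpha> * (pi / (2 * cos (pi * \<alpha> / 2))))"

lemma has_bochner_integral_power_over_quadratic:
  assumes a: "-1 < a" "a < 1" and c: "c \<noteq> 0"
  shows "has_bochner_integral lborel (\<lambda>x. indicator {0<..} x * (x powr a / (c^2 + x^2)))
    (\<bar>c\<bar> powr (a - 1) * (pi / (2 * cos (pi * a / 2))))"
proof (rule has_bochner_integral_nn_integral[OF _ _ _ nn_integral_power_over_quadratic[OF assms]])
  have "pi * - 1 < pi * a" "pi * a < pi * 1" by (rule mult_strict_left_mono[OF a(1) pi_gt_zero], rule mult_strict_left_mono[OF a(2) pi_gt_zero])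
  then have "0 < cos (pi * a / 2)" by (intro cos_gt_zero_pi) linarith+
  then show "0 \<le> \<bar>c\<bar> powr (a - 1) * (pi / (2 * cos (pi * a / 2)))" by simp
qed (auto simp: add_nonneg_nonneg)

lemma sin_power_integral_value:
  fixes \<alpha> s t :: real
  assumes a: "0 < \<alpha>" "\<alpha> < 2"
  defines "h \<equiv> \<lambda>x. indicator {0<..} x * (x powr \<alpha> * (s / (s^2 + x^2) - t / (t^2 + x^2) - (s - t) / ((s - t)^2 + x^2)))"
  assumes int: "integrable lborel h"
  shows "(\<integral>x. h x \<partial>lborel) = sin_power_value \<alpha> s - sin_power_value \<alpha> t - sin_power_value \<alpha> (s - t)"
proof -
  consider "\<alpha> < 1" | "\<alpha> = 1" | "1 < \<alpha>" by linarith
  then show ?thesis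
  proof cases
    case 1
    have *: "has_bochner_integral lborel (\<lambda>x. indicator {0<..} x * (x powr \<alpha> * (c / (c^2 + x^2)))) (sin_power_value \<alpha> c)" for c
    proof (cases "c = 0")
      case False
      have "has_bochner_integral lborel (\<lambda>x. c * (indicator {0<..} x * (x powr \<alpha> / (c^2 + x^2)))) (c * (\<bar>c\<bar> powr (\<alpha> - 1) * (pi / (2 * cos (pi * \<alpha> / 2)))))"
        using a 1 False by (intro has_bochner_integral_mult_right has_bochner_integral_power_over_quadratic) auto
      moreover have "c * (\<bar>c\<bar> powr (\<alpha> - 1) * (pi / (2 * cos (pi * \<alpha> / 2)))) = sin_power_value \<alpha> c"
      proof -
        have "c * \<bar>c\<bar> powr (\<alpha> - 1) = sgn c * \<bar>c\<bar> powr \<alpha>"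
          using False by (simp add: powr_diff sgn_if)
        then show ?thesis using 1 by (simp add: sin_power_value_def)
      qed
      ultimately show ?thesis by (simp add: mult_ac)
    qed (simp add: sin_power_value_def has_bochner_integral_zero)
    have "has_bochner_integral lborel (\<lambda>x. indicator {0<..} x * (x powr \<alpha> * (s / (s^2 + x^2))) - indicator {0<..} x * (x powr \<alpha> * (t / (t^2 + x^2))) - indicator {0<..} x * (x powr \<alpha> * ((s - t) / ((s - t)^2 + x^2))))
       (sin_power_value \<alpha> s - sin_power_value \<alpha> t - sin_power_value \<alpha> (s - t))"
      by (intro has_bochner_integral_diff *)
    then have "has_bochner_integral lborel h (sin_power_value \<alpha> s - sin_power_value \<alpha> t - sin_power_value \<alpha> (s - t))"
      unfolding h_def by (simp only: right_diff_distrib)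
    then show ?thesis by (rule has_bochner_integral_integral_eq)
  next
    case 3
    \<comment> \<open>For \<open>\<alpha> > 1\<close> one subtracts \<open>c / x\<^sup>2\<close> from \<open>c / (c\<^sup>2 + x\<^sup>2)\<close>; the subtracted terms add up to \<open>0\<close>.\<close>
    have *: "has_bochner_integral lborel (\<lambda>x. indicator {0<..} x * (x powr (\<alpha> - 2) * (c^3 / (c^2 + x^2)))) (- sin_power_value \<alpha> c)" for c
    proof (cases "c = 0")
      case False
      have "has_bochner_integral lborel (\<lambda>x. c^3 * (indicator {0<..} x * (x powr (\<alpha> - 2) / (c^2 + x^2)))) (c^3 * (\<bar>c\<bar> powr (\<alpha> - 2 - 1) * (pi / (2 * cos (pi * (\<alpha> - 2) / 2)))))"
        using a 3 False by (intro has_bochner_integral_mult_right has_bochner_integral_power_over_quadratic) auto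
      moreover have "c^3 * (\<bar>c\<bar> powr (\<alpha> - 2 - 1) * (pi / (2 * cos (pi * (\<alpha> - 2) / 2)))) = - sin_power_value \<alpha> c"
      proof -
        have "c^3 = sgn c * \<bar>c\<bar> ^ 3" by (simp add: sgn_if)
        then have "c^3 * \<bar>c\<bar> powr (\<alpha> - 3) = sgn c * \<bar>c\<bar> powr \<alpha>"
          using False by (simp add: powr_diff)
        moreover have "cos (pi * (\<alpha> - 2) / 2) = - cos (pi * \<alpha> / 2)"
          using cos_diff[of "pi * \<alpha> / 2" pi] by (simp add: field_simps)
        ultimately show ?thesis using 3 by (simp add: sin_power_value_def)
      qed
      ultimately show ?thesis by (simp add: mult_ac)
    qed (simp add: sin_power_value_def has_bochner_integral_zero)
    have "has_bochner_integral lborel (\<lambda>x. indicator {0<..} x * (x powr (\<alpha> - 2) * (t^3 / (t^2 + x^2))) + indicator {0<..} x * (x powr (\<alpha> - 2) * ((s - t)^3 / ((s - t)^2 + x^2))) - indicator {0<..} x * (x powr (\<alpha> - 2) * (s^3 / (s^2 + x^2))))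
       (- sin_power_value \<alpha> t + - sin_power_value \<alpha> (s - t) - - sin_power_value \<alpha> s)"
      by (intro has_bochner_integral_diff has_bochner_integral_add *)
    moreover have "h = (\<lambda>x. indicator {0<..} x * (x powr (\<alpha> - 2) * (t^3 / (t^2 + x^2))) + indicator {0<..} x * (x powr (\<alpha> - 2) * ((s - t)^3 / ((s - t)^2 + x^2))) - indicator {0<..} x * (x powr (\<alpha> - 2) * (s^3 / (s^2 + x^2))))"
    proof
      fix x
      show "h x = indicator {0<..} x * (x powr (\<alpha> - 2) * (t^3 / (t^2 + x^2))) + indicator {0<..} x * (x powr (\<alpha> - 2) * ((s - t)^3 / ((s - t)^2 + x^2))) - indicator {0<..} x * (x powr (\<alpha> - 2) * (s^3 / (s^2 + x^2)))"
      proof (cases "0 < x")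
        case True
        have e: "x^2 * (c / (c^2 + x^2)) = c - c^3 / (c^2 + x^2)" for c
        proof -
          have "c^2 + x^2 \<noteq> 0" using True by (simp add: add_nonneg_eq_0_iff)
          then show ?thesis by (simp add: field_simps power2_eq_square power3_eq_cube)
        qed
        have "x powr \<alpha> = x powr (\<alpha> - 2) * x^2" using True by (simp add: powr_diff)
        then have "h x = x powr (\<alpha> - 2) * (x^2 * (s / (s^2 + x^2)) - x^2 * (t / (t^2 + x^2)) - x^2 * ((s - t) / ((s - t)^2 + x^2)))"
          using True by (simp add: h_def algebra_simps)
        then show ?thesis using True unfolding e by (simp add: algebra_simps)
      qed (simp add: h_def)
    qed
    ultimately show ?thesis by (simp add: has_bochner_integral_integral_eq)
  next
    case 2
    \<comment> \<open>For \<open>\<alpha> = 1\<close> there is an elementary primitive; its logarithms at infinity cancel.\<close>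
    define g where "g x = x * (s / (s^2 + x^2) - t / (t^2 + x^2) - (s - t) / ((s - t)^2 + x^2))" for x
    define L where "L c x = c / 2 * ln (c^2 + x^2)" for c x :: real
    define F where "F x = L s x - L t x - L (s - t) x" for x
    have gh: "h = (\<lambda>x. indicator {0<..} x *\<^sub>R g x)" using 2 by (auto simp: h_def g_def fun_eq_iff indicator_def)
    have e: "einterval 0 \<infinity> = {0<..}" by (auto simp: einterval_def)
    have L0: "(L c \<longlongrightarrow> c * ln \<bar>c\<bar>) (at_right 0)" for c
    proof (cases "c = 0")
      case False
      have "((\<lambda>x. c / 2 * ln (c^2 + x^2)) \<longlongrightarrow> c / 2 * ln (c^2 + 0^2)) (at_right 0)"
        using False by (intro tendsto_intros) auto
      moreover have "ln (c^2) = 2 * ln \<bar>c\<bar>" using False ln_realpow[of "\<bar>c\<bar>" 2] by simp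
      ultimately show ?thesis by (simp add: L_def[abs_def])
    qed (simp add: L_def[abs_def])
    have Linf: "((\<lambda>x. L c x - c * ln x) \<longlongrightarrow> 0) at_top" for c
    proof -
      have "((\<lambda>x. c / 2 * ln (1 + c^2 / x^2)) \<longlongrightarrow> c / 2 * ln (1 + 0)) at_top"
        by (intro tendsto_intros tendsto_divide_0[OF tendsto_const] filterlim_at_top_imp_at_infinity filterlim_pow_at_top filterlim_ident) auto
      moreover have "\<forall>\<^sub>F x in at_top. c / 2 * ln (1 + c^2 / x^2) = L c x - c * ln x"
        using eventually_gt_at_top[of 0]
      proof eventually_elim
        case (elim x)
        have "1 + c^2 / x^2 = (c^2 + x^2) / x^2" using elim by (simp add: field_simps)
        moreover have "0 < c^2 + x^2" using elim by (simp add: add_nonneg_pos)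
        ultimately have "ln (1 + c^2 / x^2) = ln (c^2 + x^2) - 2 * ln x" using elim by (simp add: ln_div ln_realpow)
        then have q: "ln (c^2 + x^2) = ln (1 + c^2 / x^2) + 2 * ln x" by simp
        show ?case unfolding L_def q by (simp add: algebra_simps)
      qed
      ultimately have "((\<lambda>x. L c x - c * ln x) \<longlongrightarrow> c / 2 * ln (1 + 0)) at_top"
        by (rule Lim_transform_eventually)
      then show ?thesis by simp
    qed
    have "(LBINT x=0..\<infinity>. g x) = 0 - (s * ln \<bar>s\<bar> - t * ln \<bar>t\<bar> - (s - t) * ln \<bar>s - t\<bar>)"
    proof (rule interval_integral_FTC_integrable[where F=F])
      fix x :: real assume "(0::ereal) < ereal x"
      then have x: "0 < x" by simp
      have p: "c^2 + x^2 \<noteq> 0" "0 < c^2 + x^2" for c using x by (auto simp: add_nonneg_eq_0_iff add_nonneg_pos)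
      have "DERIV (L c) x :> x * (c / (c^2 + x^2))" for c
      proof -
        have "((\<lambda>x. ln (c^2 + x^2)) has_real_derivative (2 * x / (c^2 + x^2))) (at x)"
          by (auto intro!: derivative_eq_intros p)
        from DERIV_cmult[OF this, of "c / 2"] show ?thesis by (simp add: L_def[abs_def] mult_ac)
      qed
      then have "DERIV F x :> g x" unfolding F_def[abs_def] g_def right_diff_distrib by (intro DERIV_diff)
      then show "(F has_vector_derivative g x) (at x)" by (simp add: has_real_derivative_iff_has_vector_derivative)
      show "isCont g x" unfolding g_def[abs_def] by (intro continuous_intros p)
    next
      show "set_integrable lborel (einterval 0 \<infinity>) g" using int unfolding set_integrable_def e gh .
      have "(F \<longlongrightarrow> s * ln \<bar>s\<bar> - t * ln \<bar>t\<bar> - (s - t) * ln \<bar>s - t\<bar>) (at_right 0)"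
        unfolding F_def[abs_def] by (intro tendsto_diff L0)
      then show "((F \<circ> real_of_ereal) \<longlongrightarrow> s * ln \<bar>s\<bar> - t * ln \<bar>t\<bar> - (s - t) * ln \<bar>s - t\<bar>) (at_right 0)"
        by (simp add: ereal_tendsto_simps zero_ereal_def)
      have "((\<lambda>x. (L s x - s * ln x) - (L t x - t * ln x) - (L (s - t) x - (s - t) * ln x)) \<longlongrightarrow> 0 - 0 - 0) at_top"
        by (intro tendsto_diff Linf)
      then have "(F \<longlongrightarrow> 0) at_top" by (simp add: F_def[abs_def] algebra_simps)
      then show "((F \<circ> real_of_ereal) \<longlongrightarrow> 0) (at_left \<infinity>)" by (simp add: ereal_tendsto_simps)
    qed simp
    moreover have "(LBINT x=0..\<infinity>. g x) = (\<integral>x. h x \<partial>lborel)"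
      by (simp add: interval_lebesgue_integral_def set_lebesgue_integral_def e gh)
    ultimately show ?thesis using 2 by (simp add: sin_power_value_def)
  qed
qed


section \<open>The spectral representation\<close>

text \<open>With \<open>c = 1\<close> this is, up to a sign, the half-line Fourier transform of the kernel for the exponent
  \<open>H\<close>; with \<open>H = 1/2\<close> and \<open>c = \<i>\<close> it is, up to the same sign, that of the indicator of the
  interval from \<open>0\<close> to \<open>t\<close>.  The factor \<open>1 / sqrt pi\<close> makes the correspondence with functions of time isometric.\<close>

definition spectral :: "real \<Rightarrow> complex \<Rightarrow> real \<Rightarrow> real \<Rightarrow> complex" where
  "spectral H c t \<xi> =
    (if 0 < \<xi> then complex_of_real (\<xi> powr - (H + 1/2) / sqrt pi) * (c * (cis (t * \<xi>) - 1)) else 0)"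

lemma spectral_measurable [measurable]: "spectral H c t \<in> borel_measurable borel"
proof -
  have [measurable]: "(\<lambda>\<xi>. cis (t * \<xi>)) \<in> borel_measurable borel"
    unfolding cis_conv_exp by measurable
  show ?thesis unfolding spectral_def by measurable
qed

lemma inner_complex_mult:
  fixes a z w :: complex shows "(a * z) \<bullet> (a * w) = (cmod a)^2 * (z \<bullet> w)"
  unfolding inner_complex_def cmod_power2 by (simp add: algebra_simps power2_eq_square)

lemma spectral_inner:
  assumes "cmod c = 1"
  shows "spectral H c t \<xi> \<bullet> spectral H c s \<xi> =
     (1 / pi) * (indicator {0<..} \<xi> * ((1 - cos (t * \<xi>)) * \<xi> powr - (2 * H + 1)) + indicator {0<..} \<xi> * ((1 - cos (s * \<xi>)) * \<xi> powr - (2 * H + 1))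
      - indicator {0<..} \<xi> * ((1 - cos ((t - s) * \<xi>)) * \<xi> powr - (2 * H + 1)))"
proof (cases "0 < \<xi>")
  case True
  have e: "(\<xi> powr - (H + 1/2) / sqrt pi)^2 = \<xi> powr - (2 * H + 1) / pi"
    using True by (simp add: power_divide power2_eq_square powr_add[symmetric])
  have i: "(cis (t * \<xi>) - 1) \<bullet> (cis (s * \<xi>) - 1) = (1 - cos (t * \<xi>)) + (1 - cos (s * \<xi>)) - (1 - cos ((t - s) * \<xi>))"
    by (simp add: inner_complex_def left_diff_distrib cos_diff algebra_simps)
  have "spectral H c t \<xi> \<bullet> spectral H c s \<xi> = (\<xi> powr - (H + 1/2) / sqrt pi)^2 * ((cmod c)^2 * ((cis (t * \<xi>) - 1) \<bullet> (cis (s * \<xi>) - 1)))"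
    using True unfolding spectral_def by (simp only: if_True inner_complex_mult norm_of_real power2_abs)
  also have "\<dots> = (\<xi> powr - (2 * H + 1) / pi) * ((1 - cos (t * \<xi>)) + (1 - cos (s * \<xi>)) - (1 - cos ((t - s) * \<xi>)))"
    by (simp only: e i assms) simp
  finally show ?thesis using True by (simp add: field_simps)
qed (simp add: spectral_def)

lemma spectral_gram:
  assumes H: "0 < H" "H < 1" and c: "cmod c = 1"
  shows "sq_int lborel (spectral H c t)"
    and "ip lborel (spectral H c t) (spectral H c s) =
      kappa H * (\<bar>t\<bar> powr (2 * H) + \<bar>s\<bar> powr (2 * H) - \<bar>t - s\<bar> powr (2 * H))"
proof -
  have sp: "0 < sin (pi * H)"
  proof (rule sin_gt_zero)
    show "0 < pi * H" using H by simp
    show "pi * H < pi" using mult_strict_left_mono[OF H(2) pi_gt_zero] by simp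
  qed
  have G: "0 < Gamma (2 * H + 1)" using H by (intro Gamma_real_pos) auto
  have k: "0 < kappa H" using sp G by (simp add: kappa_def)
  have b: "has_bochner_integral lborel (\<lambda>\<xi>. indicator {0<..} \<xi> * ((1 - cos (r * \<xi>)) * \<xi> powr - (2 * H + 1))) (\<bar>r\<bar> powr (2 * H) * (pi * kappa H))" for r
  proof (rule has_bochner_integral_nn_integral)
    have "pi * (2 * H) / 2 = pi * H" by simp
    then have "pi / (2 * Gamma (2 * H + 1) * sin (pi * (2 * H) / 2)) = pi * kappa H"
      by (simp only: kappa_def divide_inverse)
    moreover have "0 < 2 * H" "2 * H < 2" using H by auto
    ultimately show "(\<integral>\<^sup>+\<xi>. ennreal (indicator {0<..} \<xi> * ((1 - cos (r * \<xi>)) * \<xi> powr - (2 * H + 1))) \<partial>lborel) = ennreal (\<bar>r\<bar> powr (2 * H) * (pi * kappa H))"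
      by (simp only: nn_integral_1_minus_cos_power)
    show "0 \<le> \<bar>r\<bar> powr (2 * H) * (pi * kappa H)" using k by simp
    show "AE \<xi> in lborel. 0 \<le> indicator {0<..} \<xi> * ((1 - cos (r * \<xi>)) * \<xi> powr - (2 * H + 1))"
      by (intro AE_I2 mult_nonneg_nonneg) auto
    show "(\<lambda>\<xi>. indicator {0<..} \<xi> * ((1 - cos (r * \<xi>)) * \<xi> powr - (2 * H + 1))) \<in> borel_measurable lborel"
      by measurable
  qed
  have main: "has_bochner_integral lborel (\<lambda>\<xi>. spectral H c t \<xi> \<bullet> spectral H c s \<xi>)
    ((1 / pi) * (\<bar>t\<bar> powr (2 * H) * (pi * kappa H) + \<bar>s\<bar> powr (2 * H) * (pi * kappa H) - \<bar>t - s\<bar> powr (2 * H) * (pi * kappa H)))" for t s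
    unfolding spectral_inner[OF c]
    by (intro has_bochner_integral_mult_right has_bochner_integral_diff has_bochner_integral_add b)
  show "sq_int lborel (spectral H c t)"
    using main[of t t] by (simp add: sq_int_def has_bochner_integral_iff)
  show "ip lborel (spectral H c t) (spectral H c s) =
      kappa H * (\<bar>t\<bar> powr (2 * H) + \<bar>s\<bar> powr (2 * H) - \<bar>t - s\<bar> powr (2 * H))"
    using main[of t s] by (simp add: ip_def has_bochner_integral_integral_eq algebra_simps)
qed

text \<open>The product of the two factors \<open>cis - 1\<close> gives exactly the combination of sines of
  \<open>sin_power_integral_swap\<close>; its integrability is that of a product of square integrable functions.\<close>

lemma spectral_cross:
  assumes H: "0 < H" "H < 1"
  shows "ip lborel (spectral H 1 t) (spectral (1/2) \<i> s) =
    (sin_power_value (H + 1/2) s - sin_power_value (H + 1/2) t - sin_power_value (H + 1/2) (s - t)) / (pi * Gamma (H + 3/2))"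
proof -
  define A where "A \<xi> = indicator {0<..} \<xi> * ((sin (s * \<xi>) - sin (t * \<xi>) - sin ((s - t) * \<xi>)) * \<xi> powr - ((H + 1/2) + 1))" for \<xi>
  have pt: "spectral H 1 t \<xi> \<bullet> spectral (1/2) \<i> s \<xi> = (1 / pi) * A \<xi>" for \<xi>
  proof (cases "0 < \<xi>")
    case True
    have e: "(\<xi> powr - (H + 1/2) / sqrt pi) * (\<xi> powr - (1/2 + 1/2) / sqrt pi) = \<xi> powr - ((H + 1/2) + 1) / pi"
    proof -
      have "\<xi> powr - (H + 1/2) * \<xi> powr - (1/2 + 1/2) = \<xi> powr - ((H + 1/2) + 1)"
        by (subst powr_add[symmetric]) simp
      then show ?thesis by (simp only: times_divide_times_eq real_sqrt_mult_self abs_of_pos[OF pi_gt_zero])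
    qed
    have i: "(1 * (cis (t * \<xi>) - 1)) \<bullet> (\<i> * (cis (s * \<xi>) - 1)) = sin (s * \<xi>) - sin (t * \<xi>) - sin ((s - t) * \<xi>)"
      by (simp add: inner_complex_def left_diff_distrib sin_diff algebra_simps)
    have "spectral H 1 t \<xi> \<bullet> spectral (1/2) \<i> s \<xi> = ((\<xi> powr - (H + 1/2) / sqrt pi) * (\<xi> powr - (1/2 + 1/2) / sqrt pi)) * ((1 * (cis (t * \<xi>) - 1)) \<bullet> (\<i> * (cis (s * \<xi>) - 1)))"
      using True unfolding spectral_def if_P[OF True] by (simp only: scaleR_conv_of_real[symmetric] inner_scaleR_left inner_scaleR_right mult.assoc) (simp only: mult_ac)
    then show ?thesis using True unfolding e i by (simp add: A_def)
  qed (simp add: spectral_def A_def)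
  have "integrable lborel (\<lambda>\<xi>. spectral H 1 t \<xi> \<bullet> spectral (1/2) \<i> s \<xi>)"
    by (intro integrable_inner spectral_gram) (use H in auto)
  then have "integrable lborel (\<lambda>\<xi>. pi * ((1 / pi) * A \<xi>))"
    unfolding pt by (rule integrable_mult_right)
  then have iA: "integrable lborel A" by simp
  have G: "0 < Gamma (H + 3/2)" using H by (intro Gamma_real_pos) auto
  have al: "0 < H + 1/2" "H + 1/2 < 2" using H by auto
  note sw = sin_power_integral_swap[OF al(1) iA[unfolded A_def]]
  have "H + 1/2 + 1 = H + 3/2" by simp
  then have "Gamma (H + 3/2) * (\<integral>\<xi>. A \<xi> \<partial>lborel) = sin_power_value (H + 1/2) s - sin_power_value (H + 1/2) t - sin_power_value (H + 1/2) (s - t)"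
    using sw(2) sin_power_integral_value[OF al sw(1)] by (simp only: A_def)
  then show ?thesis using G by (simp add: ip_def pt field_simps)
qed

text \<open>Real coefficients: a complex function is reached by combining even real parts (cosines) with odd
  imaginary parts (sines).\<close>

definition trig_span :: "(real \<Rightarrow> complex) set" where
  "trig_span = {g. \<exists>l. g = (\<lambda>\<xi>. lincomb l (\<lambda>t. cis (t * \<xi>) - 1))}"

lemma trig_span_add: "g \<in> trig_span \<Longrightarrow> h \<in> trig_span \<Longrightarrow> (\<lambda>\<xi>. g \<xi> + h \<xi>) \<in> trig_span"
proof -
  assume "g \<in> trig_span" "h \<in> trig_span"
  then obtain l l' where "g = (\<lambda>\<xi>. lincomb l (\<lambda>t. cis (t * \<xi>) - 1))" "h = (\<lambda>\<xi>. lincomb l' (\<lambda>t. cis (t * \<xi>) - 1))"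
    by (auto simp: trig_span_def)
  then have "(\<lambda>\<xi>. g \<xi> + h \<xi>) = (\<lambda>\<xi>. lincomb (l @ l') (\<lambda>t. cis (t * \<xi>) - 1))" by simp
  then show ?thesis unfolding trig_span_def by blast
qed

lemma trig_span_scale: "g \<in> trig_span \<Longrightarrow> (\<lambda>\<xi>. a *\<^sub>R g \<xi>) \<in> trig_span"
proof -
  assume "g \<in> trig_span"
  then obtain l where "g = (\<lambda>\<xi>. lincomb l (\<lambda>t. cis (t * \<xi>) - 1))" by (auto simp: trig_span_def)
  then have "(\<lambda>\<xi>. a *\<^sub>R g \<xi>) = (\<lambda>\<xi>. lincomb (map (\<lambda>(c, i). (a * c, i)) l) (\<lambda>t. cis (t * \<xi>) - 1))"
    by (simp add: lincomb_scale[where f="\<lambda>i. i"])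
  then show ?thesis unfolding trig_span_def by blast
qed

lemma trig_span_base: "(\<lambda>\<xi>. cis (t * \<xi>) - 1) \<in> trig_span"
proof -
  have "(\<lambda>\<xi>. cis (t * \<xi>) - 1) = (\<lambda>\<xi>. lincomb [(1, t)] (\<lambda>t. cis (t * \<xi>) - 1))" by simp
  then show ?thesis unfolding trig_span_def by blast
qed

text \<open>The identity \<open>2 * cos r * (cis t - 1) = (cis (t + r) - 1) + (cis (t - r) - 1) - (cis r - 1) - (cis (- r) - 1)\<close>:
  the correction terms come from the condition that all elements vanish at \<open>\<xi> = 0\<close>.\<close>

lemma trig_span_cos: 
  assumes "g \<in> trig_span" shows "(\<lambda>\<xi>. cos (r * \<xi>) *\<^sub>R g \<xi>) \<in> trig_span"
proof -
  from assms obtain l where g: "g = (\<lambda>\<xi>. lincomb l (\<lambda>t. cis (t * \<xi>) - 1))" by (auto simp: trig_span_def)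
  have "(\<lambda>\<xi>. cos (r * \<xi>) *\<^sub>R lincomb l (\<lambda>t. cis (t * \<xi>) - 1)) \<in> trig_span"
  proof (induction l)
    case Nil
    have "(\<lambda>\<xi>. 0 *\<^sub>R (cis (0 * \<xi>) - 1)) \<in> trig_span" by (intro trig_span_scale trig_span_base)
    then show ?case by simp
  next
    case (Cons a l)
    obtain c t where a: "a = (c, t)" by (cases a)
    have e: "cos (r * \<xi>) *\<^sub>R (cis (t * \<xi>) - 1) = (1/2) *\<^sub>R (cis ((t + r) * \<xi>) - 1) + (1/2) *\<^sub>R (cis ((t - r) * \<xi>) - 1)
        + (- 1/2) *\<^sub>R (cis (r * \<xi>) - 1) + (- 1/2) *\<^sub>R (cis ((- r) * \<xi>) - 1)" for \<xi>
      by (simp add: complex_eq_iff distrib_right left_diff_distrib cos_add cos_diff sin_add sin_diff)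
         (simp add: field_simps)
    have "(\<lambda>\<xi>. cos (r * \<xi>) *\<^sub>R (cis (t * \<xi>) - 1)) \<in> trig_span"
      unfolding e by (intro trig_span_add trig_span_scale trig_span_base)
    then have "(\<lambda>\<xi>. c *\<^sub>R (cos (r * \<xi>) *\<^sub>R (cis (t * \<xi>) - 1)) + cos (r * \<xi>) *\<^sub>R lincomb l (\<lambda>t. cis (t * \<xi>) - 1)) \<in> trig_span"
      by (intro trig_span_add trig_span_scale Cons)
    then show ?case by (simp add: a scaleR_add_right mult_ac)
  qed
  then show ?thesis by (simp add: g)
qed

lemma trig_span_poly_cos:
  assumes "real_polynomial_function (p :: real \<Rightarrow> real)" "g \<in> trig_span"
  shows "(\<lambda>\<xi>. p (cos (r * \<xi>)) *\<^sub>R g \<xi>) \<in> trig_span"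
  using assms
proof (induction p arbitrary: g rule: real_polynomial_function.induct)
  case (linear f)
  have "f x = f 1 * x" for x
    using linear_scale[OF bounded_linear.linear[OF linear(1)], of x 1] by simp
  then have "(\<lambda>\<xi>. f (cos (r * \<xi>)) *\<^sub>R g \<xi>) = (\<lambda>\<xi>. f 1 *\<^sub>R (cos (r * \<xi>) *\<^sub>R g \<xi>))"
    by (metis scaleR_scaleR)
  then show ?case using trig_span_scale[OF trig_span_cos[OF linear(2)]] by simp
next
  case (const c)
  then show ?case by (rule trig_span_scale)
next
  case (add f1 f2)
  then show ?case using trig_span_add[OF add.IH(1)[OF add.prems] add.IH(2)[OF add.prems]] by (simp add: scaleR_add_left)
next
  case (mult f1 f2)
  then show ?case using mult.IH(1)[OF mult.IH(2)[OF mult.prems]] by simp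
qed


section \<open>Density of the spectral functions\<close>

lemma one_minus_cos_le: "\<bar>cos x - 1\<bar> \<le> \<bar>x :: real\<bar>"
proof -
  have "1 - cos x = 2 * (sin (x / 2))^2" using cos_double_sin[of "x / 2"] by simp
  moreover have "(sin (x / 2))^2 \<le> \<bar>sin (x / 2)\<bar>"
    using mult_left_le[of "\<bar>sin (x / 2)\<bar>" "\<bar>sin (x / 2)\<bar>"] abs_sin_le_one[of "x / 2"]
    by (simp add: power2_eq_square abs_mult[symmetric])
  moreover have "\<bar>sin (x / 2)\<bar> \<le> \<bar>x / 2\<bar>" by (rule abs_sin_x_le_abs_x)
  moreover have "cos x \<le> 1" by simp
  ultimately show ?thesis by simp
qed

text \<open>A function supported in \<open>[\<delta>, A]\<close> is viewed through \<open>\<theta> = \<xi> / n\<close>, where \<open>A / n < pi\<close>.  As \<open>cos\<close> is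
  injective on \<open>[0, pi]\<close>, the quotients \<open>u / (cos \<theta> - 1)\<close> and \<open>v / sin \<theta>\<close> are continuous functions of
  \<open>cos \<theta>\<close> and can be approximated by polynomials in \<open>cos \<theta>\<close>.  Multiplying back by
  \<open>cos \<theta> - 1\<close> and \<open>\<i> * sin \<theta>\<close> stays in \<open>trig_span\<close> and supplies the factor \<open>min 1 \<xi>\<close>, which
  makes the error square integrable against the weight at \<open>0\<close>.  Beyond half a period,
  \<open>\<xi> > pi * n\<close>, the approximation is the even or odd periodic continuation; it is bounded
  there uniformly in \<open>n\<close> but not small.\<close>

lemma trig_span_approx:
  fixes u v :: "real \<Rightarrow> real"
  assumes dA: "0 < \<delta>" "\<delta> \<le> A" and n: "1 \<le> n" and An: "A < pi * real n"
    and u: "continuous_on UNIV u" "\<And>\<xi>. \<xi> \<notin> {\<delta>..A} \<Longrightarrow> u \<xi> = 0" "\<And>\<xi>. \<bar>u \<xi>\<bar> \<le> C"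
    and v: "continuous_on UNIV v" "\<And>\<xi>. \<xi> \<notin> {\<delta>..A} \<Longrightarrow> v \<xi> = 0" "\<And>\<xi>. \<bar>v \<xi>\<bar> \<le> C"
  shows "\<exists>g\<in>trig_span. \<forall>\<xi>>0. norm (g \<xi> - Complex (u \<xi>) (v \<xi>)) \<le> (2 * C + 3) * min 1 \<xi> \<and>
      (\<xi> \<le> pi * real n \<longrightarrow> norm (g \<xi> - Complex (u \<xi>) (v \<xi>)) \<le> 3 / real n * min 1 \<xi>)"
proof -
  have n0: "0 < real n" using n by simp
  have C0: "0 \<le> C" using u(3)[of 0] by linarith
  define K where "K = {\<delta> / n .. A / n}"
  have K: "0 < \<theta>" "\<theta> < pi" if "\<theta> \<in> K" for \<theta>
  proof -
    have "0 < \<delta> / n" "A / n < pi" using dA(1) n0 An by (auto simp: field_simps)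
    then show "0 < \<theta>" "\<theta> < pi" using that unfolding K_def by auto
  qed
  have "\<exists>\<theta>0\<in>K. \<forall>\<theta>\<in>K. min (1 - cos \<theta>0) (sin \<theta>0) \<le> min (1 - cos \<theta>) (sin \<theta>)"
    using dA n0 by (intro continuous_attains_inf) (auto simp: K_def divide_right_mono intro!: continuous_intros)
  then obtain \<theta>0 where \<theta>0: "\<theta>0 \<in> K" "\<And>\<theta>. \<theta> \<in> K \<Longrightarrow> min (1 - cos \<theta>0) (sin \<theta>0) \<le> min (1 - cos \<theta>) (sin \<theta>)"
    by blast
  \<comment> \<open>Replacing the denominators by their maximum with \<open>m\<close> changes nothing on the support and removes the zeros.\<close>
  define m where "m = min (1 - cos \<theta>0) (sin \<theta>0)"
  have "0 < sin \<theta>0" using K[OF \<theta>0(1)] by (rule sin_gt_zero)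
  moreover have "cos \<theta>0 < cos 0" using K[OF \<theta>0(1)] by (intro cos_monotone_0_pi) auto
  ultimately have m: "0 < m" by (simp add: m_def)
  have mK: "m \<le> 1 - cos \<theta>" "m \<le> sin \<theta>" if "\<theta> \<in> K" for \<theta>
    using \<theta>0(2)[OF that] unfolding m_def by auto
  define G1 where "G1 x = - u (n * arccos x) / max m (1 - x)" for x
  define G2 where "G2 x = v (n * arccos x) / max m (sqrt (1 - x^2))" for x
  have cu: "continuous_on S (\<lambda>x. u (h x))" "continuous_on S (\<lambda>x. v (h x))" if "continuous_on S h" for S and h :: "real \<Rightarrow> real"
    using continuous_on_compose2[OF u(1) that] continuous_on_compose2[OF v(1) that] by auto
  have cG: "continuous_on {-1..1} G1" "continuous_on {-1..1} G2"
  proof -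
    have "max m y \<noteq> 0" for y using m by (simp add: max_def)
    then show "continuous_on {-1..1} G1" "continuous_on {-1..1} G2"
      unfolding G1_def G2_def by (auto intro!: continuous_intros cu)
  qed
  have en: "0 < 1 / real n" using n0 by simp
  obtain p1 where p1: "real_polynomial_function p1" "\<And>x. x \<in> {-1..1} \<Longrightarrow> \<bar>G1 x - p1 x\<bar> < 1 / n"
    using Stone_Weierstrass_real_polynomial_function[OF compact_Icc cG(1) en] by blast
  obtain p2 where p2: "real_polynomial_function p2" "\<And>x. x \<in> {-1..1} \<Longrightarrow> \<bar>G2 x - p2 x\<bar> < 1 / n"
    using Stone_Weierstrass_real_polynomial_function[OF compact_Icc cG(2) en] by blast
  have k1: "(x - 1) * G1 x = u (n * arccos x)" if "x \<in> {-1..1}" for x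
  proof (cases "n * arccos x \<in> {\<delta>..A}")
    case True
    then have "arccos x \<in> K" using n0 by (auto simp: K_def field_simps)
    then have "m \<le> 1 - x" using mK(1)[of "arccos x"] that by simp
    then show ?thesis using m by (simp add: G1_def max_absorb2 field_simps)
  qed (use u(2) in \<open>simp add: G1_def\<close>)
  have k2: "sqrt (1 - x^2) * G2 x = v (n * arccos x)" if "x \<in> {-1..1}" for x
  proof (cases "n * arccos x \<in> {\<delta>..A}")
    case True
    then have "arccos x \<in> K" using n0 by (auto simp: K_def field_simps)
    then have "m \<le> sqrt (1 - x^2)" using mK(2)[of "arccos x"] that by (simp add: sin_arccos)
    then have "max m (sqrt (1 - x^2)) = sqrt (1 - x^2)" "sqrt (1 - x^2) \<noteq> 0" using m by linarith+
    moreover have "s * (y / s) = y" if "s \<noteq> 0" for s y :: real using that by simp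
    ultimately show ?thesis unfolding G2_def by metis
  qed (use v(2) in \<open>simp add: G2_def\<close>)
  define r where "r = 1 / real n"
  define g where "g \<xi> = p1 (cos (r * \<xi>)) *\<^sub>R complex_of_real (cos (r * \<xi>) - 1) + p2 (cos (r * \<xi>)) *\<^sub>R (\<i> * complex_of_real (sin (r * \<xi>)))" for \<xi>
  have "g \<in> trig_span"
  proof -
    have "complex_of_real (cos (r * \<xi>) - 1) = (1/2) *\<^sub>R (cis (r * \<xi>) - 1) + (1/2) *\<^sub>R (cis ((- r) * \<xi>) - 1)" for \<xi>
      by (simp add: complex_eq_iff)
    then have 1: "(\<lambda>\<xi>. complex_of_real (cos (r * \<xi>) - 1)) \<in> trig_span"
      by (simp only:) (intro trig_span_add trig_span_scale trig_span_base)
    have "\<i> * complex_of_real (sin (r * \<xi>)) = (1/2) *\<^sub>R (cis (r * \<xi>) - 1) + (- 1/2) *\<^sub>R (cis ((- r) * \<xi>) - 1)" for \<xi>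
      by (simp add: complex_eq_iff)
    then have 2: "(\<lambda>\<xi>. \<i> * complex_of_real (sin (r * \<xi>))) \<in> trig_span"
      by (simp only:) (intro trig_span_add trig_span_scale trig_span_base)
    show ?thesis unfolding g_def[abs_def]
      by (intro trig_span_add trig_span_poly_cos p1(1) p2(1) 1 2)
  qed
  moreover have "norm (g \<xi> - Complex (u \<xi>) (v \<xi>)) \<le> (2 * C + 3) * min 1 \<xi> \<and>
      (\<xi> \<le> pi * real n \<longrightarrow> norm (g \<xi> - Complex (u \<xi>) (v \<xi>)) \<le> 3 / real n * min 1 \<xi>)" if xi: "0 < \<xi>" for \<xi>
  proof -
    define x where "x = cos (r * \<xi>)"
    define sn where "sn = sin (r * \<xi>)"
    have x: "x \<in> {-1..1}" by (simp add: x_def)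
    have rx: "0 < r * \<xi>" "r * \<xi> \<le> \<xi>"
    proof -
      show "0 < r * \<xi>" using xi n0 by (simp add: r_def)
      have "r * \<xi> \<le> 1 * \<xi>" using xi n by (intro mult_right_mono) (auto simp: r_def)
      then show "r * \<xi> \<le> \<xi>" by simp
    qed
    have b1: "\<bar>x - 1\<bar> \<le> 2 * min 1 \<xi>"
    proof -
      have "\<bar>x - 1\<bar> \<le> 2" using x by auto
      moreover have "\<bar>x - 1\<bar> \<le> \<xi>" using one_minus_cos_le[of "r * \<xi>"] rx unfolding x_def by linarith
      ultimately show ?thesis using xi by (auto simp: min_def)
    qed
    have b2: "\<bar>sn\<bar> \<le> min 1 \<xi>"
      using abs_sin_x_le_abs_x[of "r * \<xi>"] rx by (auto simp: sn_def)
    have e1: "\<bar>(x - 1) * p1 x - (x - 1) * G1 x\<bar> \<le> 2 / n * min 1 \<xi>"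
    proof -
      have "\<bar>(x - 1) * p1 x - (x - 1) * G1 x\<bar> = \<bar>x - 1\<bar> * \<bar>G1 x - p1 x\<bar>"
        by (simp add: right_diff_distrib[symmetric] abs_mult abs_minus_commute)
      also have "\<dots> \<le> (2 * min 1 \<xi>) * (1 / n)"
        using b1 p1(2)[OF x] xi by (intro mult_mono) auto
      finally show ?thesis by simp
    qed
    have e2: "\<bar>sn * p2 x - sn * G2 x\<bar> \<le> 1 / n * min 1 \<xi>"
    proof -
      have "\<bar>sn * p2 x - sn * G2 x\<bar> = \<bar>sn\<bar> * \<bar>G2 x - p2 x\<bar>"
        by (simp add: right_diff_distrib[symmetric] abs_mult abs_minus_commute)
      also have "\<dots> \<le> min 1 \<xi> * (1 / n)"
        using b2 p2(2)[OF x] xi by (intro mult_mono) auto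
      finally show ?thesis by simp
    qed
    have nrm: "norm (g \<xi> - Complex (u \<xi>) (v \<xi>)) \<le> \<bar>(x - 1) * p1 x - u \<xi>\<bar> + \<bar>sn * p2 x - v \<xi>\<bar>"
      using cmod_le[of "g \<xi> - Complex (u \<xi>) (v \<xi>)"] by (simp add: g_def x_def sn_def mult.commute)
    have sabs: "\<bar>sn\<bar> = sqrt (1 - x^2)"
      using sin_squared_eq[of "r * \<xi>"] by (simp add: x_def sn_def flip: real_sqrt_abs)
    have mn: "3 / real n * min 1 \<xi> \<le> (2 * C + 3) * min 1 \<xi>"
    proof (rule mult_right_mono)
      have "3 / real n \<le> 3 / 1" using n by (intro divide_left_mono) auto
      then show "3 / real n \<le> 2 * C + 3" using C0 by linarith
    qed (use xi in simp)
    show ?thesis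
    proof (cases "\<xi> \<le> pi * real n")
      case True
      then have rp: "r * \<xi> \<le> pi" using n0 by (simp add: r_def field_simps)
      have "arccos x = r * \<xi>" unfolding x_def using rx rp by (intro arccos_cos) auto
      then have na: "n * arccos x = \<xi>" using n0 by (simp add: r_def)
      have "0 \<le> sn" unfolding sn_def using rx rp by (intro sin_ge_zero) auto
      then have s: "sn = sqrt (1 - x^2)" using sabs by simp
      have "norm (g \<xi> - Complex (u \<xi>) (v \<xi>)) \<le> 2 / n * min 1 \<xi> + 1 / n * min 1 \<xi>"
        using nrm e1 e2 k1[OF x] k2[OF x] unfolding na s by linarith
      also have "\<dots> = 3 / real n * min 1 \<xi>" by (simp add: add_divide_distrib[symmetric] distrib_right[symmetric])
      finally show ?thesis using mn by auto
    next
      case False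
      then have "A < \<xi>" using An by simp
      then have z: "u \<xi> = 0" "v \<xi> = 0" using u(2)[of \<xi>] v(2)[of \<xi>] by auto
      have "1 \<le> pi * real n" using n pi_ge_two by (smt (verit) mult_le_cancel_left1 n0 of_nat_1 of_nat_le_iff)
      then have m1: "min 1 \<xi> = 1" using False by simp
      have "\<bar>(x - 1) * G1 x\<bar> \<le> C" using u(3) by (simp only: k1[OF x])
      moreover have "\<bar>sn * G2 x\<bar> \<le> C"
      proof -
        have "\<bar>sn * G2 x\<bar> = \<bar>sqrt (1 - x^2) * G2 x\<bar>"
          by (simp only: abs_mult sabs[symmetric] abs_idempotent)
        then show ?thesis using v(3) by (simp only: k2[OF x])
      qed
      moreover have "2 / real n \<le> 2" "1 / real n \<le> 1" using n by (simp_all add: divide_le_eq)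
      ultimately have "norm (g \<xi> - Complex (u \<xi>) (v \<xi>)) \<le> 2 * C + 3"
        using nrm e1 e2 unfolding z m1 by linarith
      then show ?thesis using False m1 by simp
    qed
  qed
  ultimately show ?thesis by blast
qed

lemma integrable_weight:
  fixes H :: real
  assumes H: "0 < H" "H < 1"
  shows "integrable lborel (\<lambda>\<xi>. indicator {0<..} \<xi> * (\<xi> powr - (2 * H + 1) * (min 1 \<xi>)^2))"
proof -
  have e1: "((\<lambda>x. x powr (1 - 2 * H)) has_integral (1 powr (1 - 2 * H + 1) / (1 - 2 * H + 1))) {0..1}"
    by (rule has_integral_powr_from_0) (use H in auto)
  have e2: "((\<lambda>x. x powr - (2 * H + 1)) has_integral - (1 powr (- (2 * H + 1) + 1)) / (- (2 * H + 1) + 1)) {1..}"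
    by (rule has_integral_powr_to_inf) (use H in auto)
  have i1: "integrable lborel (\<lambda>x. indicator {0..1} x * x powr (1 - 2 * H))"
    using nn_integral_has_integral_lebesgue[OF _ e1] by (intro integrableI_nonneg) auto
  have i2: "integrable lborel (\<lambda>x. indicator {1..} x * x powr - (2 * H + 1))"
    using nn_integral_has_integral_lebesgue[OF _ e2] by (intro integrableI_nonneg) auto
  show ?thesis
  proof (rule Bochner_Integration.integrable_bound[OF Bochner_Integration.integrable_add[OF i1 i2]])
    show "AE x in lborel. norm (indicator {0<..} x * (x powr - (2 * H + 1) * (min 1 x)^2)) \<le>
       norm (indicator {0..1} x * x powr (1 - 2 * H) + indicator {1..} x * x powr - (2 * H + 1))"
    proof (rule AE_I2)
      fix x :: real
      show "norm (indicator {0<..} x * (x powr - (2 * H + 1) * (min 1 x)^2)) \<le>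
       norm (indicator {0..1} x * x powr (1 - 2 * H) + indicator {1..} x * x powr - (2 * H + 1))"
      proof (cases "0 < x \<and> x \<le> 1")
        case True
        then have "x powr - (2 * H + 1) * x^2 = x powr (1 - 2 * H)"
          by (simp add: powr_add[symmetric] flip: powr_numeral)
        then show ?thesis using True by (auto simp: indicator_def)
      qed (auto simp: indicator_def)
    qed
  qed measurable
qed

text \<open>First \<open>f\<close> is cut off to a compact subset of the open half line.  Dividing by the weight gives a
  continuous function \<open>\<psi>\<close> with compact support, to which \<open>trig_span_approx\<close> applies.  Its error bounds
  give convergence to \<open>0\<close> at each frequency, dominated by \<open>C * min 1 \<xi>\<close>, and this is square
  integrable against the weight since \<open>1 < 2 * H + 1 < 3\<close>.\<close>

lemma spectral_dense:
  assumes H: "0 < H" "H < 1" and c: "cmod c = 1"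
    and f: "sq_int lborel f" and cont: "continuous_on {0<..} f" and f0: "\<And>\<xi>. \<xi> \<le> 0 \<Longrightarrow> f \<xi> = 0"
    and \<epsilon>: "0 < \<epsilon>"
  shows "\<exists>l. sq_dist lborel (\<lambda>\<xi>. lincomb l (\<lambda>t. spectral H c t \<xi>)) f < \<epsilon>"
proof -
  have [measurable]: "f \<in> borel_measurable borel" using f by (simp add: sq_int_def)
  define cut where "cut n \<xi> = max 0 (min 1 (real n * \<xi> - 1)) * max 0 (min 1 (real n - \<xi>))" for n \<xi>
  have cut01: "0 \<le> cut n \<xi>" "cut n \<xi> \<le> 1" for n \<xi> by (auto simp: cut_def intro!: mult_le_one)
  have [measurable]: "cut n \<in> borel_measurable borel" for n unfolding cut_def by measurable
  define \<phi> where "\<phi> n \<xi> = cut n \<xi> *\<^sub>R f \<xi>" for n \<xi>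
  have if2: "integrable lborel (\<lambda>\<xi>. f \<xi> \<bullet> f \<xi>)" using f by (simp add: sq_int_def)
  have \<phi>sq: "sq_int lborel (\<phi> n)" for n
    unfolding sq_int_def
  proof
    show "\<phi> n \<in> borel_measurable lborel" unfolding \<phi>_def by measurable
    show "integrable lborel (\<lambda>\<xi>. \<phi> n \<xi> \<bullet> \<phi> n \<xi>)"
    proof (rule Bochner_Integration.integrable_bound[OF if2])
      show "AE \<xi> in lborel. norm (\<phi> n \<xi> \<bullet> \<phi> n \<xi>) \<le> norm (f \<xi> \<bullet> f \<xi>)"
      proof (rule AE_I2)
        fix \<xi>
        have "cut n \<xi> * cut n \<xi> \<le> 1" using cut01 by (intro mult_le_one) auto
        then show "norm (\<phi> n \<xi> \<bullet> \<phi> n \<xi>) \<le> norm (f \<xi> \<bullet> f \<xi>)"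
          by (simp add: \<phi>_def mult.assoc[symmetric] mult_left_le_one_le cut01)
      qed
    qed (unfold \<phi>_def, measurable)
  qed
  have "(\<lambda>n. sq_dist lborel (\<phi> n) f) \<longlonglongrightarrow> integral\<^sup>L lborel (\<lambda>_::real. 0)"
    unfolding ip_def
  proof (rule integral_dominated_convergence)
    show "integrable lborel (\<lambda>\<xi>. f \<xi> \<bullet> f \<xi>)" by (rule if2)
    show "AE \<xi> in lborel. norm ((\<phi> n \<xi> - f \<xi>) \<bullet> (\<phi> n \<xi> - f \<xi>)) \<le> f \<xi> \<bullet> f \<xi>" for n
    proof (rule AE_I2)
      fix \<xi>
      have "\<phi> n \<xi> - f \<xi> = (cut n \<xi> - 1) *\<^sub>R f \<xi>" by (simp add: \<phi>_def algebra_simps)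
      moreover have "(cut n \<xi> - 1) * (cut n \<xi> - 1) \<le> 1"
        using cut01[of n \<xi>] mult_le_one[of "1 - cut n \<xi>" "1 - cut n \<xi>"] by (simp add: algebra_simps)
      ultimately show "norm ((\<phi> n \<xi> - f \<xi>) \<bullet> (\<phi> n \<xi> - f \<xi>)) \<le> f \<xi> \<bullet> f \<xi>"
        by (simp add: mult.assoc[symmetric] mult_left_le_one_le)
    qed
    show "AE \<xi> in lborel. (\<lambda>n. (\<phi> n \<xi> - f \<xi>) \<bullet> (\<phi> n \<xi> - f \<xi>)) \<longlonglongrightarrow> 0"
    proof (rule AE_I2)
      fix \<xi> :: real
      show "(\<lambda>n. (\<phi> n \<xi> - f \<xi>) \<bullet> (\<phi> n \<xi> - f \<xi>)) \<longlonglongrightarrow> 0"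
      proof (cases "0 < \<xi>")
        case True
        obtain n1 where n1: "2 / \<xi> \<le> real n1" using real_arch_simple by blast
        obtain n2 where n2: "\<xi> + 1 \<le> real n2" using real_arch_simple by blast
        have "cut n \<xi> = 1" if "n \<ge> max n1 n2" for n
        proof -
          have "2 / \<xi> \<le> real n" "\<xi> + 1 \<le> real n" using n1 n2 that by auto
          then have "2 \<le> real n * \<xi>" "1 \<le> real n - \<xi>" using True by (auto simp: field_simps)
          then show ?thesis by (simp add: cut_def)
        qed
        then have "\<forall>\<^sub>F n in sequentially. (\<phi> n \<xi> - f \<xi>) \<bullet> (\<phi> n \<xi> - f \<xi>) = 0"
          unfolding eventually_sequentially \<phi>_def by (intro exI[of _ "max n1 n2"]) auto
        then show ?thesis by (rule tendsto_eventually)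
      qed (simp add: \<phi>_def f0)
    qed
  qed (unfold \<phi>_def, measurable)
  then have "\<forall>\<^sub>F n in sequentially. sq_dist lborel (\<phi> n) f < \<epsilon> / 4 \<and> 1 \<le> n"
    using \<epsilon> by (intro eventually_conj order_tendstoD(2) eventually_ge_at_top) auto
  then obtain N where N: "sq_dist lborel (\<phi> N) f < \<epsilon> / 4" "1 \<le> N"
    by (auto simp: eventually_sequentially)
  have N0: "0 < real N" using N(2) by simp
  define a where "a = 1 / real N"
  have a0: "0 < a" using N0 by (simp add: a_def)
  have aN: "a \<le> real N"
  proof -
    have "1 / real N \<le> 1" using N(2) by simp
    then show ?thesis using N(2) unfolding a_def by linarith
  qed
  have supp: "\<phi> N \<xi> = 0" if "\<xi> \<notin> {a..real N}" for \<xi>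
  proof (cases "\<xi> < a")
    case True
    then have "real N * \<xi> - 1 \<le> 0" using N0 by (simp add: a_def field_simps)
    then show ?thesis by (simp add: \<phi>_def cut_def)
  next
    case False
    then have "real N - \<xi> \<le> 0" using that by auto
    then show ?thesis by (simp add: \<phi>_def cut_def)
  qed
  have c\<phi>: "continuous_on UNIV (\<phi> N)"
  proof -
    have "continuous_on {0<..} (\<phi> N)" unfolding \<phi>_def cut_def by (intro continuous_intros cont)
    moreover have "continuous_on {..<a} (\<phi> N)"
    proof -
      have "continuous_on {..<a} (\<lambda>\<xi>. 0 :: complex)" by simp
      then show ?thesis by (rule continuous_on_eq) (auto simp: supp)
    qed
    ultimately have "continuous_on ({0<..} \<union> {..<a}) (\<phi> N)" by (intro continuous_on_open_Un) auto
    moreover have "{0<..} \<union> {..<a} = UNIV" using a0 by auto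
    ultimately show ?thesis by simp
  qed
  \<comment> \<open>The maximum with \<open>a\<close> only keeps the power continuous; \<open>\<phi> N\<close> vanishes below \<open>a\<close>.\<close>
  define \<psi> where "\<psi> \<xi> = cnj c * \<phi> N \<xi> * complex_of_real (sqrt pi * max \<xi> a powr (H + 1/2))" for \<xi>
  have c\<psi>: "continuous_on UNIV \<psi>"
    unfolding \<psi>_def using a0 by (intro continuous_intros c\<phi>) (auto simp: max_def)
  have s\<psi>: "\<psi> \<xi> = 0" if "\<xi> \<notin> {a..real N}" for \<xi> using supp[OF that] by (simp add: \<psi>_def)
  have "compact (\<psi> ` {a..real N})"
    by (intro compact_continuous_image compact_Icc continuous_on_subset[OF c\<psi>]) auto
  then obtain C where C: "0 < C" "\<And>\<xi>. \<xi> \<in> {a..real N} \<Longrightarrow> norm (\<psi> \<xi>) \<le> C"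
    using compact_imp_bounded bounded_pos[of "\<psi> ` {a..real N}"] by auto
  have C': "norm (\<psi> \<xi>) \<le> C" for \<xi> using C s\<psi>[of \<xi>] by (cases "\<xi> \<in> {a..real N}") auto
  have apx: "\<exists>g\<in>trig_span. \<forall>\<xi>>0. norm (g \<xi> - \<psi> \<xi>) \<le> (2 * C + 3) * min 1 \<xi> \<and>
      (\<xi> \<le> pi * real (N + n) \<longrightarrow> norm (g \<xi> - \<psi> \<xi>) \<le> 3 / real (N + n) * min 1 \<xi>)" for n
  proof -
    have "real N * 1 < real (N + n) * pi"
      using N0 pi_gt3 by (intro mult_le_less_imp_less) auto
    then have lt: "real N < pi * real (N + n)" by (simp add: mult.commute)
    have "\<exists>g\<in>trig_span. \<forall>\<xi>>0. norm (g \<xi> - Complex (Re (\<psi> \<xi>)) (Im (\<psi> \<xi>))) \<le> (2 * C + 3) * min 1 \<xi> \<and>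
      (\<xi> \<le> pi * real (N + n) \<longrightarrow> norm (g \<xi> - Complex (Re (\<psi> \<xi>)) (Im (\<psi> \<xi>))) \<le> 3 / real (N + n) * min 1 \<xi>)"
    proof (rule trig_span_approx[OF a0 aN _ lt])
      show "1 \<le> N + n" using N(2) by simp
      show "continuous_on UNIV (\<lambda>\<xi>. Re (\<psi> \<xi>))" "continuous_on UNIV (\<lambda>\<xi>. Im (\<psi> \<xi>))"
        by (intro continuous_intros c\<psi>)+
      show "\<bar>Re (\<psi> \<xi>)\<bar> \<le> C" "\<bar>Im (\<psi> \<xi>)\<bar> \<le> C" for \<xi>
        using C'[of \<xi>] abs_Re_le_cmod[of "\<psi> \<xi>"] abs_Im_le_cmod[of "\<psi> \<xi>"] by auto
    qed (simp_all add: s\<psi>)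
    then show ?thesis by simp
  qed
  have "\<forall>n. \<exists>l. \<forall>\<xi>>0. norm (lincomb l (\<lambda>t. cis (t * \<xi>) - 1) - \<psi> \<xi>) \<le> (2 * C + 3) * min 1 \<xi> \<and>
      (\<xi> \<le> pi * real (N + n) \<longrightarrow> norm (lincomb l (\<lambda>t. cis (t * \<xi>) - 1) - \<psi> \<xi>) \<le> 3 / real (N + n) * min 1 \<xi>)"
  proof
    fix n
    obtain g where g: "g \<in> trig_span" "\<forall>\<xi>>0. norm (g \<xi> - \<psi> \<xi>) \<le> (2 * C + 3) * min 1 \<xi> \<and>
        (\<xi> \<le> pi * real (N + n) \<longrightarrow> norm (g \<xi> - \<psi> \<xi>) \<le> 3 / real (N + n) * min 1 \<xi>)"
      using apx[of n] by (rule bexE)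
    then obtain l where "g = (\<lambda>\<xi>. lincomb l (\<lambda>t. cis (t * \<xi>) - 1))" unfolding trig_span_def by blast
    with g(2) show "\<exists>l. \<forall>\<xi>>0. norm (lincomb l (\<lambda>t. cis (t * \<xi>) - 1) - \<psi> \<xi>) \<le> (2 * C + 3) * min 1 \<xi> \<and>
      (\<xi> \<le> pi * real (N + n) \<longrightarrow> norm (lincomb l (\<lambda>t. cis (t * \<xi>) - 1) - \<psi> \<xi>) \<le> 3 / real (N + n) * min 1 \<xi>)"
      by (intro exI[of _ l]) simp
  qed
  then obtain l where l': "\<forall>n. \<forall>\<xi>>0. norm (lincomb (l n) (\<lambda>t. cis (t * \<xi>) - 1) - \<psi> \<xi>) \<le> (2 * C + 3) * min 1 \<xi> \<and>
      (\<xi> \<le> pi * real (N + n) \<longrightarrow> norm (lincomb (l n) (\<lambda>t. cis (t * \<xi>) - 1) - \<psi> \<xi>) \<le> 3 / real (N + n) * min 1 \<xi>)"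
    by (rule choice[THEN exE])
  have l: "0 < \<xi> \<Longrightarrow> norm (lincomb (l n) (\<lambda>t. cis (t * \<xi>) - 1) - \<psi> \<xi>) \<le> (2 * C + 3) * min 1 \<xi>"
    "0 < \<xi> \<Longrightarrow> \<xi> \<le> pi * real (N + n) \<Longrightarrow> norm (lincomb (l n) (\<lambda>t. cis (t * \<xi>) - 1) - \<psi> \<xi>) \<le> 3 / real (N + n) * min 1 \<xi>" for n \<xi>
    using l' by blast+
  define D where "D n \<xi> = lincomb (l n) (\<lambda>t. spectral H c t \<xi>) - \<phi> N \<xi>" for n \<xi>
  have Dn: "norm (D n \<xi>) = \<xi> powr - (H + 1/2) / sqrt pi * norm (lincomb (l n) (\<lambda>t. cis (t * \<xi>) - 1) - \<psi> \<xi>)" if "0 < \<xi>" for n \<xi>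
  proof -
    define w where "w = complex_of_real (\<xi> powr - (H + 1/2) / sqrt pi)"
    have "lincomb (l n) (\<lambda>t. spectral H c t \<xi>) = lincomb (l n) (\<lambda>t. (w * c) * (cis (t * \<xi>) - 1))"
      using that by (simp add: spectral_def w_def mult.assoc)
    also have "\<dots> = (w * c) * lincomb (l n) (\<lambda>t. cis (t * \<xi>) - 1)"
      by (rule lincomb_linear[symmetric]) (auto intro!: linearI simp: algebra_simps)
    finally have 1: "lincomb (l n) (\<lambda>t. spectral H c t \<xi>) = (w * c) * lincomb (l n) (\<lambda>t. cis (t * \<xi>) - 1)" .
    have 2: "\<phi> N \<xi> = (w * c) * \<psi> \<xi>"
    proof (cases "\<xi> \<in> {a..real N}")
      case True
      have "(\<xi> powr - (H + 1/2) / sqrt pi) * (sqrt pi * max \<xi> a powr (H + 1/2)) = 1"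
        using True that by (simp add: max_absorb1 powr_add[symmetric])
      then have "w * complex_of_real (sqrt pi * max \<xi> a powr (H + 1/2)) = 1"
        unfolding w_def by (metis of_real_1 of_real_mult)
      moreover have "c * cnj c = 1" using c complex_norm_square[of c] by simp
      moreover have "(w * c) * \<psi> \<xi> = (c * cnj c) * (w * complex_of_real (sqrt pi * max \<xi> a powr (H + 1/2))) * \<phi> N \<xi>"
        unfolding \<psi>_def by (simp only: mult_ac)
      ultimately show ?thesis by simp
    qed (simp add: supp s\<psi>)
    have "norm w = \<xi> powr - (H + 1/2) / sqrt pi" unfolding w_def norm_of_real by simp
    then show ?thesis
      unfolding D_def 1 2 right_diff_distrib[symmetric] norm_mult c by (simp only: mult_1_right)
  qed
  have D0: "D n \<xi> = 0" if "\<not> 0 < \<xi>" for n \<xi>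
  proof -
    have "lincomb L (\<lambda>t. spectral H c t \<xi>) = 0" for L
      using that by (induction L) (auto simp: spectral_def)
    moreover have "\<phi> N \<xi> = 0" using that a0 by (intro supp) auto
    ultimately show ?thesis by (simp add: D_def)
  qed
  have Dsq: "sq_int lborel (D n)" for n
    unfolding D_def by (intro sq_int_diff sq_int_lincomb spectral_gram H c \<phi>sq)
  have [measurable]: "D n \<in> borel_measurable borel" for n using Dsq[of n] by (simp add: sq_int_def)
  have sqe: "(\<xi> powr - (H + 1/2) / sqrt pi)^2 = \<xi> powr - (2 * H + 1) / pi" if "0 < \<xi>" for \<xi>
    using that by (simp add: power_divide power2_eq_square powr_add[symmetric])
  have "(\<lambda>n. \<integral>\<xi>. D n \<xi> \<bullet> D n \<xi> \<partial>lborel) \<longlonglongrightarrow> integral\<^sup>L lborel (\<lambda>_::real. 0)"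
  proof (rule integral_dominated_convergence)
    show "integrable lborel (\<lambda>\<xi>. (2 * C + 3)^2 / pi * (indicator {0<..} \<xi> * (\<xi> powr - (2 * H + 1) * (min 1 \<xi>)^2)))"
      by (intro integrable_mult_right integrable_weight H)
    show "AE \<xi> in lborel. norm (D n \<xi> \<bullet> D n \<xi>) \<le> (2 * C + 3)^2 / pi * (indicator {0<..} \<xi> * (\<xi> powr - (2 * H + 1) * (min 1 \<xi>)^2))" for n
    proof (rule AE_I2)
      fix \<xi> :: real
      show "norm (D n \<xi> \<bullet> D n \<xi>) \<le> (2 * C + 3)^2 / pi * (indicator {0<..} \<xi> * (\<xi> powr - (2 * H + 1) * (min 1 \<xi>)^2))"
      proof (cases "0 < \<xi>")
        case True
        have "norm (D n \<xi> \<bullet> D n \<xi>) = (norm (D n \<xi>))^2" by (simp add: power2_norm_eq_inner)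
        also have "\<dots> \<le> (\<xi> powr - (H + 1/2) / sqrt pi * ((2 * C + 3) * min 1 \<xi>))^2"
          unfolding Dn[OF True] using l(1)[OF True, of n] by (intro power_mono mult_left_mono) auto
        also have "\<dots> = (2 * C + 3)^2 / pi * (\<xi> powr - (2 * H + 1) * (min 1 \<xi>)^2)"
          unfolding power_mult_distrib sqe[OF True] by simp
        finally show ?thesis using True by simp
      qed (simp add: D0)
    qed
    show "AE \<xi> in lborel. (\<lambda>n. D n \<xi> \<bullet> D n \<xi>) \<longlonglongrightarrow> 0"
    proof (rule AE_I2)
      fix \<xi> :: real
      show "(\<lambda>n. D n \<xi> \<bullet> D n \<xi>) \<longlonglongrightarrow> 0"
      proof (cases "0 < \<xi>")
        case True
        define B where "B = \<xi> powr - (H + 1/2) / sqrt pi * 3"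
        obtain n0 where n0: "\<xi> \<le> real n0" using real_arch_simple by blast
        have ev: "norm (D n \<xi>) \<le> B * inverse (real n)" if "n \<ge> Suc n0" for n
        proof -
          have "\<xi> \<le> 1 * real (N + n)" using n0 that by simp
          also have "\<dots> \<le> pi * real (N + n)" using pi_ge_two by (intro mult_right_mono) auto
          finally have "norm (lincomb (l n) (\<lambda>t. cis (t * \<xi>) - 1) - \<psi> \<xi>) \<le> 3 / real (N + n) * min 1 \<xi>"
            by (rule l(2)[OF True])
          also have "\<dots> \<le> 3 / real n * 1"
            using that True by (intro mult_mono divide_left_mono) auto
          finally have fin: "norm (lincomb (l n) (\<lambda>t. cis (t * \<xi>) - 1) - \<psi> \<xi>) \<le> 3 / real n * 1" .
          have "norm (D n \<xi>) \<le> \<xi> powr - (H + 1/2) / sqrt pi * (3 / real n * 1)"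
            unfolding Dn[OF True] by (rule mult_left_mono[OF fin]) simp
          also have "\<dots> = B * inverse (real n)"
            unfolding B_def by (simp only: divide_inverse mult_1_right mult.assoc)
          finally show ?thesis .
        qed
        have "(\<lambda>n. B * inverse (real n)) \<longlonglongrightarrow> B * 0" by (intro tendsto_intros lim_inverse_n)
        then have z: "(\<lambda>n. B * inverse (real n)) \<longlonglongrightarrow> 0" by simp
        have "(\<lambda>n. D n \<xi>) \<longlonglongrightarrow> 0"
          by (rule Lim_null_comparison[OF _ z]) (use ev in \<open>auto simp: eventually_sequentially\<close>)
        from tendsto_inner[OF this this] show ?thesis by simp
      qed (simp add: D0)
    qed
  qed measurable
  then have "\<forall>\<^sub>F n in sequentially. (\<integral>\<xi>. D n \<xi> \<bullet> D n \<xi> \<partial>lborel) < \<epsilon> / 4"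
    using \<epsilon> by (intro order_tendstoD(2)) auto
  then obtain n where n: "ip lborel (D n) (D n) < \<epsilon> / 4"
    by (auto simp: eventually_sequentially ip_def)
  have "sq_dist lborel (\<lambda>\<xi>. lincomb (l n) (\<lambda>t. spectral H c t \<xi>)) f \<le>
     2 * ip lborel (D n) (D n) + 2 * sq_dist lborel (\<phi> N) f"
    unfolding D_def by (intro ip_triangle sq_int_lincomb spectral_gram H c \<phi>sq f)
  also have "\<dots> < \<epsilon>" using n N(1) by simp
  finally show ?thesis by blast
qed


section \<open>The kernel in the time domain\<close>

text \<open>The primitive of the kernel that vanishes at \<open>0\<close>.  The linear term for \<open>\<alpha> = 1\<close> comes from
  integrating the logarithm.\<close>

definition kernel_primitive :: "real \<Rightarrow> real \<Rightarrow> real" where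
  "kernel_primitive \<alpha> s = (sin_power_value \<alpha> s + (if \<alpha> = 1 then s else 0)) / (pi * Gamma (\<alpha> + 1))"

lemma kernel_primitive_deriv:
  assumes a: "0 < \<alpha>" "\<alpha> < 2" and s: "s \<noteq> 0"
  shows "(kernel_primitive \<alpha> has_real_derivative S_kernel \<alpha> s) (at s)"
proof (cases "\<alpha> = 1")
  case True
  have d: "((\<lambda>s. (- (s * ln (e * s)) + s) / pi) has_real_derivative (- ln (e * s) / pi)) (at s)" if "0 < e * s" for e
    using that s by (auto intro!: derivative_eq_intros)
  have "Gamma (1 + 1 :: real) = 1" using Gamma_fact[of 1, where 'a=real] by simp
  then have k: "kernel_primitive \<alpha> r = (- (r * ln \<bar>r\<bar>) + r) / pi" for r
    by (simp add: kernel_primitive_def sin_power_value_def True)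
  define e where "e = sgn s"
  have es: "0 < e * s" using s by (auto simp: e_def sgn_if)
  have "((\<lambda>s. (- (s * ln (e * s)) + s) / pi) has_real_derivative S_kernel \<alpha> s) (at s)"
    using d[OF es] s by (simp add: S_kernel_def True e_def sgn_if split: if_splits)
  moreover have "\<forall>\<^sub>F r in nhds s. (- (r * ln (e * r)) + r) / pi = kernel_primitive \<alpha> r"
  proof -
    have "open {r. 0 < e * r}" by (intro open_Collect_less continuous_intros)
    then have "\<forall>\<^sub>F r in nhds s. r \<in> {r. 0 < e * r}" using es by (intro eventually_nhds_in_open) auto
    then show ?thesis
    proof eventually_elim
      case (elim r)
      then have "e * r = \<bar>r\<bar>" using s by (auto simp: e_def sgn_if split: if_splits)
      then show ?case by (simp add: k)
    qed
  qed
  ultimately show ?thesis by (rule DERIV_cong_ev[OF refl _ refl, THEN iffD1, rotated])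
next
  case False
  define K where "K = pi / (2 * cos (pi * \<alpha> / 2)) / (pi * Gamma (\<alpha> + 1))"
  define e where "e = sgn s"
  have es: "0 < e * s" using s by (auto simp: e_def sgn_if)
  have ee: "e * e = 1" using s by (simp add: e_def sgn_if)
  have "((\<lambda>r. e * (e * r) powr \<alpha> * K) has_real_derivative (e * (\<alpha> * (e * s) powr (\<alpha> - 1) * e) * K)) (at s)"
    using es by (auto intro!: derivative_eq_intros)
  moreover have "e * (\<alpha> * (e * s) powr (\<alpha> - 1) * e) * K = S_kernel \<alpha> s"
  proof -
    have "e * s = \<bar>s\<bar>" using s by (auto simp: e_def sgn_if)
    moreover have "\<alpha> * K = 1 / (2 * Gamma \<alpha> * cos (pi * \<alpha> / 2))"
      using a Gamma_plus1[of \<alpha>] by (simp add: K_def add.commute nonpos_Ints_def)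
    moreover have "e * (\<alpha> * (e * s) powr (\<alpha> - 1) * e) * K = (e * e) * (e * s) powr (\<alpha> - 1) * (\<alpha> * K)" by simp
    ultimately show ?thesis by (simp add: S_kernel_def False ee)
  qed
  moreover have "\<forall>\<^sub>F r in nhds s. e * (e * r) powr \<alpha> * K = kernel_primitive \<alpha> r"
  proof -
    have "open {r. 0 < e * r}" by (intro open_Collect_less continuous_intros)
    then have "\<forall>\<^sub>F r in nhds s. r \<in> {r. 0 < e * r}" using es by (intro eventually_nhds_in_open) auto
    then show ?thesis
    proof eventually_elim
      case (elim r)
      then have "e * r = \<bar>r\<bar>" "sgn r = e" using s by (auto simp: e_def sgn_if split: if_splits)
      then show ?case by (simp add: kernel_primitive_def sin_power_value_def False K_def)
    qed
  qed
  ultimately have "((\<lambda>r. e * (e * r) powr \<alpha> * K) has_real_derivative S_kernel \<alpha> s) (at s)"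
      "\<forall>\<^sub>F r in nhds s. e * (e * r) powr \<alpha> * K = kernel_primitive \<alpha> r" by simp_all
  then show ?thesis by (rule DERIV_cong_ev[OF refl _ refl, THEN iffD1, rotated])
qed

lemma kernel_primitive_0 [simp]: "kernel_primitive \<alpha> 0 = 0"
  by (simp add: kernel_primitive_def sin_power_value_def)

lemma kernel_primitive_minus: "kernel_primitive \<alpha> (- s) = - kernel_primitive \<alpha> s"
  by (simp add: kernel_primitive_def sin_power_value_def sgn_minus diff_divide_distrib add_divide_distrib)

lemma tendsto_x_ln_abs: "((\<lambda>x::real. x * ln \<bar>x\<bar>) \<longlongrightarrow> 0) (at 0)"
proof (rule Lim_null_comparison)
  show "((\<lambda>x. 2 * sqrt \<bar>x\<bar>) \<longlongrightarrow> 0) (at (0::real))"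
    by (rule tendsto_eq_intros refl | simp)+
  have "norm (x * ln \<bar>x\<bar>) \<le> 2 * sqrt \<bar>x\<bar>" if "x \<noteq> 0" "\<bar>x\<bar> < 1" for x :: real
  proof -
    define y where "y = sqrt \<bar>x\<bar>"
    have y: "0 < y" "\<bar>x\<bar> = y * y" using that by (auto simp: y_def)
    have "ln (1 / y) \<le> 1 / y - 1" using y by (intro ln_le_minus_one) auto
    then have "- ln y \<le> 1 / y" using y by (simp add: ln_div)
    then have "y * y * (2 * (- ln y)) \<le> y * y * (2 * (1 / y))" using y by (intro mult_left_mono) auto
    also have "\<dots> = 2 * y" using y by simp
    finally have "\<bar>x\<bar> * - ln \<bar>x\<bar> \<le> 2 * y" using y by (simp add: ln_mult)
    moreover have "ln \<bar>x\<bar> \<le> 0" using that by simp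
    ultimately show ?thesis by (simp add: abs_mult y_def)
  qed
  then show "\<forall>\<^sub>F x in at 0. norm (x * ln \<bar>x\<bar>) \<le> 2 * sqrt \<bar>x\<bar>"
    unfolding eventually_at by (intro exI[of _ 1]) (auto simp: dist_real_def)
qed

lemma kernel_primitive_continuous:
  assumes a: "0 < \<alpha>" "\<alpha> < 2"
  shows "continuous_on S (kernel_primitive \<alpha>)"
proof -
  have "isCont (kernel_primitive \<alpha>) s" for s
  proof (cases "s = 0")
    case False
    then show ?thesis using kernel_primitive_deriv[OF a False] DERIV_isCont by blast
  next
    case True
    have "(sin_power_value \<alpha> \<longlongrightarrow> 0) (at 0)"
    proof (cases "\<alpha> = 1")
      case True
      from tendsto_minus[OF tendsto_x_ln_abs] show ?thesis by (simp add: sin_power_value_def[abs_def] True)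
    next
      case False
      show ?thesis
      proof (rule Lim_null_comparison)
        have "((\<lambda>x::real. \<bar>x\<bar> powr \<alpha>) \<longlongrightarrow> \<bar>0\<bar> powr \<alpha>) (at 0)"
          using a by (intro tendsto_powr2 tendsto_intros) auto
        then show "((\<lambda>x::real. \<bar>x\<bar> powr \<alpha> * \<bar>pi / (2 * cos (pi * \<alpha> / 2))\<bar>) \<longlongrightarrow> 0) (at 0)"
          by (intro tendsto_mult_left_zero) simp
        show "\<forall>\<^sub>F x in at 0. norm (sin_power_value \<alpha> x) \<le> \<bar>x\<bar> powr \<alpha> * \<bar>pi / (2 * cos (pi * \<alpha> / 2))\<bar>"
          by (intro always_eventually allI) (auto simp: sin_power_value_def False abs_mult sgn_if)
      qed
    qed
    moreover have "((\<lambda>s. if \<alpha> = 1 then s else 0) \<longlongrightarrow> 0) (at (0::real))" by (cases "\<alpha> = 1") auto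
    ultimately have lim: "(kernel_primitive \<alpha> \<longlongrightarrow> (0 + 0) / (pi * Gamma (\<alpha> + 1))) (at 0)"
    proof -
      have "0 < Gamma (\<alpha> + 1)" using a by (intro Gamma_real_pos) auto
      then show ?thesis using \<open>(sin_power_value \<alpha> \<longlongrightarrow> 0) (at 0)\<close> \<open>((\<lambda>s. if \<alpha> = 1 then s else 0) \<longlongrightarrow> 0) (at (0::real))\<close>
        unfolding kernel_primitive_def[abs_def] by (intro tendsto_divide tendsto_add tendsto_const) auto
    qed
    then show ?thesis using True by (simp add: isCont_def)
  qed
  then show ?thesis by (simp add: continuous_at_imp_continuous_on)
qed

lemma S_kernel_measurable [measurable]: "S_kernel \<alpha> \<in> borel_measurable borel"
  unfolding S_kernel_def by measurable

text \<open>The primitive is continuous, and differentiable except at one point, so the kernel has the stated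
  Henstock-Kurzweil integral.  On a bounded interval a nonconstant affine function of the kernel is nonnegative,
  which turns this into Lebesgue integrability in spite of the singularity.\<close>

lemma S_kernel_integral:
  assumes a: "0 < \<alpha>" "\<alpha> < 2" and le: "x \<le> y"
  shows "set_integrable lborel {x..y} (\<lambda>u. S_kernel \<alpha> (u - t))"
    and "(LINT u:{x..y}|lborel. S_kernel \<alpha> (u - t)) = kernel_primitive \<alpha> (y - t) - kernel_primitive \<alpha> (x - t)"
proof -
  have hi: "((\<lambda>u. S_kernel \<alpha> (u - t)) has_integral (kernel_primitive \<alpha> (y - t) - kernel_primitive \<alpha> (x - t))) {x..y}"
  proof (rule fundamental_theorem_of_calculus_interior_strong[of "{t}"])
    show "continuous_on {x..y} (\<lambda>u. kernel_primitive \<alpha> (u - t))"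
      by (intro continuous_on_compose2[OF kernel_primitive_continuous[OF a, of UNIV]] continuous_intros) auto
    fix u assume "u \<in> {x<..<y} - {t}"
    then have "u - t \<noteq> 0" by auto
    from kernel_primitive_deriv[OF a this] DERIV_shift[of "kernel_primitive \<alpha>" "S_kernel \<alpha> (u - t)" u "- t"]
    have "((\<lambda>u. kernel_primitive \<alpha> (u - t)) has_real_derivative S_kernel \<alpha> (u - t)) (at u)"
      by simp
    then show "((\<lambda>u. kernel_primitive \<alpha> (u - t)) has_vector_derivative S_kernel \<alpha> (u - t)) (at u)"
      by (simp add: has_real_derivative_iff_has_vector_derivative)
  qed (use le in auto)
  have "\<exists>C c. c \<noteq> 0 \<and> (\<forall>u\<in>{x..y}. 0 \<le> C + c * S_kernel \<alpha> (u - t))"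
  proof (cases "\<alpha> = 1")
    case True
    define R where "R = \<bar>x - t\<bar> + \<bar>y - t\<bar> + 1"
    have "0 \<le> ln R + pi * S_kernel \<alpha> (u - t)" if "u \<in> {x..y}" for u
    proof (cases "u = t")
      case False
      have "\<bar>u - t\<bar> \<le> R" using that by (auto simp: R_def)
      then have "ln \<bar>u - t\<bar> \<le> ln R" using False by (intro ln_mono) (auto simp: R_def)
      then show ?thesis by (simp add: S_kernel_def True)
    qed (simp add: S_kernel_def True R_def)
    then show ?thesis using pi_neq_zero by blast
  next
    case False
    show ?thesis
    proof (cases "2 * Gamma \<alpha> * cos (pi * \<alpha> / 2) = 0")
      case True
      then have "S_kernel \<alpha> w = 0" for w
        using \<open>\<alpha> \<noteq> 1\<close> by (simp only: S_kernel_def if_False div_by_0)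
      then show ?thesis by (intro exI[of _ 0] exI[of _ 1]) auto
    next
      case nz: False
      define D where "D = 2 * Gamma \<alpha> * cos (pi * \<alpha> / 2)"
      have D: "D \<noteq> 0" using nz by (simp only: D_def not_False_eq_True)
      have "S_kernel \<alpha> w = \<bar>w\<bar> powr (\<alpha> - 1) / D" for w
        using \<open>\<alpha> \<noteq> 1\<close> unfolding S_kernel_def D_def by (simp only: if_False)
      then have "0 \<le> 0 + D * S_kernel \<alpha> w" for w using D by simp
      then show ?thesis using D by blast
    qed
  qed
  then obtain C c where Cc: "c \<noteq> 0" "\<And>u. u \<in> {x..y} \<Longrightarrow> 0 \<le> C + c * S_kernel \<alpha> (u - t)" by blast
  have "\<exists>I. ((\<lambda>u. C + c * S_kernel \<alpha> (u - t)) has_integral I) {x..y}"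
    using has_integral_add[OF has_integral_const_real[of C x y] has_integral_mult_right[OF hi, of c]] by blast
  then obtain I where "((\<lambda>u. C + c * S_kernel \<alpha> (u - t)) has_integral I) {x..y}" by blast
  from nn_integral_has_integral_lebesgue[OF Cc(2) this]
  have "integrable lborel (\<lambda>u. indicator {x..y} u * (C + c * S_kernel \<alpha> (u - t)))"
    by (intro integrableI_nonneg) (auto simp: Cc(2) indicator_def)
  moreover have "integrable lborel (\<lambda>u. indicator {x..y} u * C)"
    by (intro integrable_mult_left) (auto simp: integrable_indicator_iff emeasure_lborel_Icc_eq)
  ultimately have "integrable lborel (\<lambda>u. (indicator {x..y} u * (C + c * S_kernel \<alpha> (u - t)) - indicator {x..y} u * C) / c)"
    by (intro integrable_divide Bochner_Integration.integrable_diff)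
  then show si: "set_integrable lborel {x..y} (\<lambda>u. S_kernel \<alpha> (u - t))"
    unfolding set_integrable_def using Cc(1) by (simp add: right_diff_distrib[symmetric])
  show "(LINT u:{x..y}|lborel. S_kernel \<alpha> (u - t)) = kernel_primitive \<alpha> (y - t) - kernel_primitive \<alpha> (x - t)"
    using set_borel_integral_eq_integral(2)[OF si] integral_unique[OF hi] by simp
qed

text \<open>The positive and the negative part of \<open>h\<close> are densities of finite measures with the same
  distribution function.\<close>

lemma AE_zero_if_integrals_zero:
  fixes h :: "real \<Rightarrow> real"
  assumes h: "integrable lborel h" and z: "\<And>x. (\<integral>u. indicator {..x} u * h u \<partial>lborel) = 0"
  shows "AE u in lborel. h u = 0"
proof -
  have [measurable]: "h \<in> borel_measurable borel" using h by auto
  define D where "D f = density lborel (\<lambda>u. ennreal (f u))" for f :: "real \<Rightarrow> real"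
  have D: "finite_borel_measure (D f)" "cdf (D f) x = (\<integral>u. indicator {..x} u * f u \<partial>lborel)"
    if f: "integrable lborel f" and pos: "\<And>u. 0 \<le> f u" for f x
  proof -
    have [measurable]: "f \<in> borel_measurable borel" using f by auto
    have em: "emeasure (D f) A = ennreal (\<integral>u. indicator A u * f u \<partial>lborel)" if [measurable]: "A \<in> sets borel" for A
    proof -
      have i: "integrable lborel (\<lambda>u. indicator A u * f u)"
        using integrable_real_mult_indicator[OF _ f, of A] by (simp add: mult.commute)
      have "emeasure (D f) A = (\<integral>\<^sup>+u. ennreal (indicator A u * f u) \<partial>lborel)"
        unfolding D_def by (subst emeasure_density) (auto intro!: nn_integral_cong simp: indicator_def)
      also have "\<dots> = ennreal (\<integral>u. indicator A u * f u \<partial>lborel)"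
        by (rule nn_integral_eq_integral[OF i]) (auto simp: pos)
      finally show ?thesis .
    qed
    have "finite_measure (D f)"
      by (rule finite_measureI) (simp add: em[of UNIV, simplified] D_def[symmetric] em, simp add: D_def em[unfolded D_def])
    then show "finite_borel_measure (D f)"
      by (intro finite_borel_measure.intro finite_borel_measure_axioms.intro) (auto simp: D_def)
    show "cdf (D f) x = (\<integral>u. indicator {..x} u * f u \<partial>lborel)"
      unfolding cdf_def measure_def by (subst em) (auto intro!: integral_nonneg_AE simp: pos)
  qed
  define p where "p u = max 0 (h u)" for u
  define q where "q u = max 0 (- h u)" for u
  have pq: "integrable lborel p" "integrable lborel q" "\<And>u. 0 \<le> p u" "\<And>u. 0 \<le> q u" "\<And>u. h u = p u - q u"
    using h unfolding p_def q_def by (auto intro!: integrable_max)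
  have [measurable]: "p \<in> borel_measurable borel" "q \<in> borel_measurable borel" using pq(1,2) by auto
  have "cdf (D p) = cdf (D q)"
  proof
    fix x
    have i: "integrable lborel (\<lambda>u. indicator {..x} u * p u)" "integrable lborel (\<lambda>u. indicator {..x} u * q u)"
      using integrable_real_mult_indicator[OF _ pq(1), of "{..x}"] integrable_real_mult_indicator[OF _ pq(2), of "{..x}"] by (simp_all add: mult.commute)
    have "(\<integral>u. indicator {..x} u * h u \<partial>lborel) = (\<integral>u. indicator {..x} u * p u \<partial>lborel) - (\<integral>u. indicator {..x} u * q u \<partial>lborel)"
      unfolding pq(5) right_diff_distrib by (rule Bochner_Integration.integral_diff[OF i])
    then show "cdf (D p) x = cdf (D q) x" using z[of x] by (simp add: D pq)
  qed
  then have "D p = D q" by (intro cdf_unique' D pq)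
  then have "AE u in lborel. ennreal (p u) = ennreal (q u)"
    unfolding D_def by (subst (asm) sigma_finite_measure.density_unique_iff[OF sigma_finite_lborel]) auto
  then show ?thesis by eventually_elim (simp add: pq)
qed

definition signed_ind :: "real \<Rightarrow> real \<Rightarrow> real" where
  "signed_ind s u = (if 0 \<le> s then indicator {0<..s} u else - indicator {s<..0} u)"

lemma signed_ind_measurable [measurable]: "signed_ind s \<in> borel_measurable borel"
  unfolding signed_ind_def by measurable

lemma signed_ind_diff: "a \<le> b \<Longrightarrow> signed_ind b u - signed_ind a u = indicator {a<..b} u"
  by (auto simp: signed_ind_def indicator_def)

lemma signed_ind_gram:
  "sq_int lborel (signed_ind s)" "ip lborel (signed_ind s) (signed_ind r) = (\<bar>s\<bar> + \<bar>r\<bar> - \<bar>s - r\<bar>) / 2"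
proof -
  have b: "has_bochner_integral lborel (\<lambda>u. signed_ind s u \<bullet> signed_ind r u) ((\<bar>s\<bar> + \<bar>r\<bar> - \<bar>s - r\<bar>) / 2)" for s r
  proof -
    have i: "has_bochner_integral lborel (indicator {a<..b} :: real \<Rightarrow> real) (b - a)" if "a \<le> b" for a b
      using has_bochner_integral_real_indicator[of "{a<..b}" lborel] that by simp
    consider "0 \<le> s" "0 \<le> r" | "s < 0" "r < 0" | "0 \<le> s" "r < 0" | "s < 0" "0 \<le> r" by linarith
    then show ?thesis
    proof cases
      case 1
      then have "(\<lambda>u. signed_ind s u \<bullet> signed_ind r u) = indicator {0<..min s r}"
        by (auto simp: signed_ind_def indicator_def fun_eq_iff)
      moreover have "(\<bar>s\<bar> + \<bar>r\<bar> - \<bar>s - r\<bar>) / 2 = min s r - 0" using 1 by (auto simp: min_def)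
      ultimately show ?thesis using i[of 0 "min s r"] 1 by simp
    next
      case 2
      then have "(\<lambda>u. signed_ind s u \<bullet> signed_ind r u) = indicator {max s r<..0}"
        by (auto simp: signed_ind_def indicator_def fun_eq_iff)
      moreover have "(\<bar>s\<bar> + \<bar>r\<bar> - \<bar>s - r\<bar>) / 2 = 0 - max s r" using 2 by (auto simp: max_def)
      ultimately show ?thesis using i[of "max s r" 0] 2 by simp
    next
      case 3
      then have "(\<lambda>u. signed_ind s u \<bullet> signed_ind r u) = (\<lambda>u. 0)"
        by (auto simp: signed_ind_def indicator_def fun_eq_iff)
      then show ?thesis using 3 by (simp add: has_bochner_integral_zero)
    next
      case 4
      then have "(\<lambda>u. signed_ind s u \<bullet> signed_ind r u) = (\<lambda>u. 0)"
        by (auto simp: signed_ind_def indicator_def fun_eq_iff)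
      then show ?thesis using 4 by (simp add: has_bochner_integral_zero)
    qed
  qed
  show "sq_int lborel (signed_ind s)" using b[of s s] by (auto simp: sq_int_def has_bochner_integral_iff)
  show "ip lborel (signed_ind s) (signed_ind r) = (\<bar>s\<bar> + \<bar>r\<bar> - \<bar>s - r\<bar>) / 2"
    using has_bochner_integral_integral_eq[OF b[of s r]] by (simp add: ip_def)
qed

lemma signed_ind_S_kernel:
  assumes a: "0 < \<alpha>" "\<alpha> < 2"
  shows "has_bochner_integral lborel (\<lambda>u. signed_ind s u * S_kernel \<alpha> (u - t)) (kernel_primitive \<alpha> (s - t) - kernel_primitive \<alpha> (- t))"
proof -
  have i: "has_bochner_integral lborel (\<lambda>u. indicator {x<..y} u * S_kernel \<alpha> (u - t)) (kernel_primitive \<alpha> (y - t) - kernel_primitive \<alpha> (x - t))"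
    if "x \<le> y" for x y
  proof -
    have "has_bochner_integral lborel (\<lambda>u. indicator {x..y} u *\<^sub>R S_kernel \<alpha> (u - t)) (kernel_primitive \<alpha> (y - t) - kernel_primitive \<alpha> (x - t))"
      using S_kernel_integral[OF a that, of t]
      by (simp add: has_bochner_integral_iff set_integrable_def set_lebesgue_integral_def)
    moreover have "AE u in lborel. indicator {x..y} u *\<^sub>R S_kernel \<alpha> (u - t) = indicator {x<..y} u * S_kernel \<alpha> (u - t)"
      using AE_lborel_singleton[of x] by eventually_elim (auto simp: indicator_def)
    ultimately show ?thesis
      by (subst has_bochner_integral_cong_AE[symmetric]) auto
  qed
  show ?thesis
  proof (cases "0 \<le> s")
    case True
    then show ?thesis using i[of 0 s] by (simp add: signed_ind_def[abs_def])
  next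
    case False
    then show ?thesis using has_bochner_integral_minus[OF i[of s 0]] by (simp add: signed_ind_def[abs_def])
  qed
qed

lemma kappa_half: "kappa (1/2) = 1/2"
proof -
  have "Gamma (1 + 1 :: real) = 1" using Gamma_fact[of 1, where 'a=real] by simp
  then show ?thesis by (simp add: kappa_def)
qed

lemma spectral_half_gram:
  assumes "cmod c = 1"
  shows "ip lborel (spectral (1/2) c s) (spectral (1/2) c r) = (\<bar>s\<bar> + \<bar>r\<bar> - \<bar>s - r\<bar>) / 2"
  using spectral_gram(2)[of "1/2" c s r] assms by (simp add: kappa_half)

lemma spectral_continuous: "continuous_on {0<..} (spectral H c t)"
proof -
  have "continuous_on {0<..} (\<lambda>\<xi>. complex_of_real (\<xi> powr - (H + 1/2) / sqrt pi) * (c * (cis (t * \<xi>) - 1)))"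
    by (intro continuous_intros) auto
  then show ?thesis by (rule continuous_on_eq) (auto simp: spectral_def)
qed

lemma spectral_approx:
  assumes "0 < H" "H < 1" "0 < H'" "H' < 1" "cmod c = 1" "cmod c' = 1" "0 < \<epsilon>"
  shows "\<exists>l. sq_dist lborel (\<lambda>\<xi>. lincomb l (\<lambda>t. spectral H c t \<xi>)) (spectral H' c' s) < \<epsilon>"
  by (rule spectral_dense[OF assms(1,2,5) spectral_gram(1)[OF assms(3,4,6)] spectral_continuous _ assms(7)])
     (simp add: spectral_def)

text \<open>The coefficients that approximate \<open>spectral H 1 t\<close> by the spectral functions of indicators also
  approximate the kernel by step functions.  The limit \<open>g t\<close> of these step functions exists by
  isometry; it is identified with the kernel by its integrals over intervals.\<close>

lemma kernel_approx:
  assumes H: "0 < H" "H < 1"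
  obtains L where "L2_lim lborel (\<lambda>n \<xi>. lincomb (L n) (\<lambda>s. spectral (1/2) \<i> s \<xi>)) (spectral H 1 t)"
    and "(\<lambda>n. \<integral>\<^sup>+u. ennreal ((lincomb (L n) (\<lambda>s. signed_ind s u) - (S_kernel (H + 1/2) u - S_kernel (H + 1/2) (u - t)))^2) \<partial>lborel) \<longlonglongrightarrow> 0"
proof -
  have sqs: "sq_int lborel (spectral (1/2) \<i> s)" "sq_int lborel (spectral H 1 s)" for s
    by (rule spectral_gram; use H in simp)+
  obtain g L where g: "\<And>t. sq_int lborel (g t)"
    and L1: "\<And>t. L2_lim lborel (\<lambda>n \<xi>. lincomb (L t n) (\<lambda>s. spectral (1/2) \<i> s \<xi>)) (spectral H 1 t)"
    and L2: "\<And>t. L2_lim lborel (\<lambda>n u. lincomb (L t n) (\<lambda>s. signed_ind s u)) (g t)"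
    and gs: "\<And>s t. ip lborel (signed_ind s) (g t) = ip lborel (spectral (1/2) \<i> s) (spectral H 1 t)"
  proof (rule gram_transfer[of lborel signed_ind lborel "spectral (1/2) \<i>" "spectral H 1"])
    show "ip lborel (signed_ind s) (signed_ind r) = ip lborel (spectral (1/2) \<i> s) (spectral (1/2) \<i> r)" for s r
      by (simp add: signed_ind_gram spectral_half_gram)
    show "\<exists>l. sq_dist lborel (\<lambda>\<xi>. lincomb l (\<lambda>t. spectral (1/2) \<i> t \<xi>)) (spectral H 1 k) < \<epsilon>"
      if "0 < \<epsilon>" for k \<epsilon>
      by (rule spectral_approx) (use H that in auto)
  qed (auto simp: signed_ind_gram sqs)
  define \<alpha> where "\<alpha> = H + 1/2"
  have al: "0 < \<alpha>" "\<alpha> < 2" using H by (auto simp: \<alpha>_def)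
  define k where "k u = S_kernel \<alpha> u - S_kernel \<alpha> (u - t)" for u
  have [measurable]: "g t \<in> borel_measurable borel" using g[of t] by (simp add: sq_int_def)
  have [measurable]: "k \<in> borel_measurable borel" unfolding k_def by measurable
  have kb: "has_bochner_integral lborel (\<lambda>u. signed_ind s u * k u) (kernel_primitive \<alpha> s - kernel_primitive \<alpha> t - kernel_primitive \<alpha> (s - t))" for s
  proof -
    have "has_bochner_integral lborel (\<lambda>u. signed_ind s u * S_kernel \<alpha> (u - 0) - signed_ind s u * S_kernel \<alpha> (u - t))
       (kernel_primitive \<alpha> (s - 0) - kernel_primitive \<alpha> (- 0) - (kernel_primitive \<alpha> (s - t) - kernel_primitive \<alpha> (- t)))"
      by (intro has_bochner_integral_diff signed_ind_S_kernel al)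
    then show ?thesis by (simp add: k_def right_diff_distrib kernel_primitive_minus algebra_simps)
  qed
  have gb: "has_bochner_integral lborel (\<lambda>u. signed_ind s u * g t u) (kernel_primitive \<alpha> s - kernel_primitive \<alpha> t - kernel_primitive \<alpha> (s - t))" for s
  proof -
    have "integrable lborel (\<lambda>u. signed_ind s u * g t u)"
      using integrable_inner[OF signed_ind_gram(1)[of s] g[of t]] by simp
    moreover have "(\<integral>u. signed_ind s u * g t u \<partial>lborel) = ip lborel (spectral H 1 t) (spectral (1/2) \<i> s)"
      using gs[of s t] ip_commute[of lborel "spectral (1/2) \<i> s"] by (simp add: ip_def[of lborel "signed_ind s"])
    moreover have "H + 3/2 = \<alpha> + 1" by (simp add: \<alpha>_def)
    then have "ip lborel (spectral H 1 t) (spectral (1/2) \<i> s) = kernel_primitive \<alpha> s - kernel_primitive \<alpha> t - kernel_primitive \<alpha> (s - t)"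
      unfolding spectral_cross[OF H] \<alpha>_def[symmetric] kernel_primitive_def
      by (auto simp: diff_divide_distrib[symmetric] add_divide_distrib[symmetric])
    ultimately show ?thesis by (simp add: has_bochner_integral_iff)
  qed
  have "AE u in lborel. indicator {- real n<..real n} u * (g t u - k u) = 0" for n
  proof (rule AE_zero_if_integrals_zero)
    have dif: "has_bochner_integral lborel (\<lambda>u. indicator {a<..b} u * (g t u - k u)) 0" if "a \<le> b" for a b
    proof -
      have "has_bochner_integral lborel (\<lambda>u. (signed_ind b u * g t u - signed_ind b u * k u) - (signed_ind a u * g t u - signed_ind a u * k u))
        (((kernel_primitive \<alpha> b - kernel_primitive \<alpha> t - kernel_primitive \<alpha> (b - t)) - (kernel_primitive \<alpha> b - kernel_primitive \<alpha> t - kernel_primitive \<alpha> (b - t)))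
         - ((kernel_primitive \<alpha> a - kernel_primitive \<alpha> t - kernel_primitive \<alpha> (a - t)) - (kernel_primitive \<alpha> a - kernel_primitive \<alpha> t - kernel_primitive \<alpha> (a - t))))"
        by (intro has_bochner_integral_diff gb kb)
      moreover have "(signed_ind b u * g t u - signed_ind b u * k u) - (signed_ind a u * g t u - signed_ind a u * k u) = indicator {a<..b} u * (g t u - k u)" for u
        unfolding signed_ind_diff[OF that, symmetric] by (simp add: algebra_simps)
      ultimately show ?thesis by simp
    qed
    show "integrable lborel (\<lambda>u. indicator {- real n<..real n} u * (g t u - k u))"
      using dif[of "- real n" "real n"] by (simp add: has_bochner_integral_iff)
    fix x
    show "(\<integral>u. indicator {..x} u * (indicator {- real n<..real n} u * (g t u - k u)) \<partial>lborel) = 0"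
    proof (cases "- real n \<le> x")
      case True
      have e: "indicator {..x} u * (indicator {- real n<..real n} u * (g t u - k u)) = indicator {- real n<..min x (real n)} u * (g t u - k u)" for u
        by (auto simp: indicator_def)
      have "- real n \<le> min x (real n)" using True by simp
      then show ?thesis unfolding e by (intro has_bochner_integral_integral_eq dif)
    next
      case False
      then have e: "indicator {..x} u * (indicator {- real n<..real n} u * (g t u - k u)) = 0" for u
        by (auto simp: indicator_def)
      show ?thesis unfolding e by simp
    qed
  qed
  then have "AE u in lborel. \<forall>n. indicator {- real n<..real n} u * (g t u - k u) = 0"
    unfolding AE_all_countable by blast
  then have gk: "AE u in lborel. g t u = k u"
  proof eventually_elim
    case (elim u)
    obtain n where "\<bar>u\<bar> + 1 \<le> real n" using real_arch_simple by blast
    then have "u \<in> {- real n<..real n}" by auto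
    then show ?case using elim[rule_format, of n] by simp
  qed
  show ?thesis
  proof (rule that[OF L1])
    have sq: "sq_int lborel (\<lambda>u. lincomb (L t n) (\<lambda>s. signed_ind s u))" for n
      by (intro sq_int_lincomb signed_ind_gram)
    have "(\<integral>\<^sup>+u. ennreal ((lincomb (L t n) (\<lambda>s. signed_ind s u) - k u)^2) \<partial>lborel) =
       ennreal (sq_dist lborel (\<lambda>u. lincomb (L t n) (\<lambda>s. signed_ind s u)) (g t))" for n
      unfolding nn_integral_inner_self[OF sq_int_diff[OF sq g], symmetric]
      using gk by (intro nn_integral_cong_AE) (auto simp: power2_eq_square)
    moreover have "(\<lambda>n. ennreal (sq_dist lborel (\<lambda>u. lincomb (L t n) (\<lambda>s. signed_ind s u)) (g t))) \<longlonglongrightarrow> ennreal 0"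
      using L2[of t] by (intro tendsto_ennrealI) (simp add: L2_lim_def)
    ultimately show "(\<lambda>n. \<integral>\<^sup>+u. ennreal ((lincomb (L t n) (\<lambda>s. signed_ind s u) - (S_kernel (H + 1/2) u - S_kernel (H + 1/2) (u - t)))^2) \<partial>lborel) \<longlonglongrightarrow> 0"
      by (simp add: k_def \<alpha>_def)
  qed
qed


section \<open>Construction of the Brownian motion\<close>

lemma measurable_axis [measurable]:
  fixes f :: "'a \<Rightarrow> 'b::euclidean_space"
  assumes "f \<in> borel_measurable M"
  shows "(\<lambda>x. axis i (f x) :: 'b ^ 'n) \<in> borel_measurable M"
proof -
  have "linear (axis i :: 'b \<Rightarrow> 'b ^ 'n)"
    by (rule linearI) (auto simp: axis_def vec_eq_iff)
  then have "continuous_on UNIV (axis i :: 'b \<Rightarrow> 'b ^ 'n)" by (simp add: linear_conv_bounded_linear linear_continuous_on)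
  from borel_measurable_continuous_on[OF this assms] show ?thesis .
qed

lemma axis_sq_int: "sq_int M f \<Longrightarrow> sq_int M (\<lambda>x. axis i (f x) :: 'b::euclidean_space ^ 'n)"
  by (auto simp: sq_int_def inner_axis_axis)

lemma axis_ip: "ip M (\<lambda>x. axis i (f x) :: 'b::euclidean_space ^ 'n) (\<lambda>x. axis j (g x)) = (if i = j then ip M f g else 0)"
  by (simp add: ip_def inner_axis_axis)

lemma axis_lincomb: "lincomb (map (\<lambda>(c, t). (c, (t, i))) l) (\<lambda>(t, j). axis j (f t)) = (axis i (lincomb l f) :: 'b::real_vector ^ 'n)"
proof -
  have "linear (axis i :: 'b \<Rightarrow> 'b ^ 'n)"
    by (rule linearI) (auto simp: axis_def vec_eq_iff)
  from lincomb_linear[OF this, of l f] show ?thesis by (simp add: lincomb_index)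
qed

lemma axis_diff: "axis i a - axis i b = (axis i (a - b) :: 'b::real_vector ^ 'n)"
  by (auto simp: axis_def vec_eq_iff)

lemma L2_lim_scale: "L2_lim M f g \<Longrightarrow> L2_lim M (\<lambda>n x. c *\<^sub>R f n x) (\<lambda>x. c *\<^sub>R g x)"
proof -
  assume l: "L2_lim M f g"
  have "sq_dist M (\<lambda>x. c *\<^sub>R f n x) (\<lambda>x. c *\<^sub>R g x) = c * c * sq_dist M (f n) g" for n
    unfolding scaleR_diff_right[symmetric] by (simp add: ip_def)
  moreover have "(\<lambda>n. c * c * sq_dist M (f n) g) \<longlonglongrightarrow> c * c * 0"
    using l by (intro tendsto_intros) (simp add: L2_lim_def)
  ultimately show ?thesis using l by (simp add: L2_lim_def sq_int_scale)
qed

lemma L2_lim_add: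
  assumes f: "L2_lim M f g" and h: "L2_lim M h k"
  shows "L2_lim M (\<lambda>n x. f n x + h n x) (\<lambda>x. g x + k x)"
proof -
  have sq: "sq_int M (f n)" "sq_int M g" "sq_int M (h n)" "sq_int M k" for n
    using f h by (auto simp: L2_lim_def)
  have b: "sq_dist M (\<lambda>x. f n x + h n x) (\<lambda>x. g x + k x) \<le>
     2 * sq_dist M (f n) g + 2 * sq_dist M (h n) k" for n
    using ip_triangle[OF sq_int_add[OF sq(1)[of n] sq(3)[of n]] sq_int_add[OF sq(2) sq(3)[of n]] sq_int_add[OF sq(2,4)]]
    by (simp add: algebra_simps)
  have "(\<lambda>n. 2 * sq_dist M (f n) g + 2 * sq_dist M (h n) k) \<longlonglongrightarrow> 2 * 0 + 2 * 0"
    using f h by (intro tendsto_intros) (auto simp: L2_lim_def)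
  then have z: "(\<lambda>n. 2 * sq_dist M (f n) g + 2 * sq_dist M (h n) k) \<longlonglongrightarrow> 0"
    by simp
  have "(\<lambda>n. sq_dist M (\<lambda>x. f n x + h n x) (\<lambda>x. g x + k x)) \<longlonglongrightarrow> 0"
  proof (rule Lim_null_comparison[OF always_eventually[OF allI] z])
    show "norm (sq_dist M (\<lambda>x. f n x + h n x) (\<lambda>x. g x + k x)) \<le>
      2 * sq_dist M (f n) g + 2 * sq_dist M (h n) k" for n
      unfolding real_norm_def abs_of_nonneg[OF ip_nonneg] by (rule b)
  qed
  then show ?thesis using sq by (simp add: L2_lim_def sq_int_add)
qed

lemma L2_lim_lincomb:
  assumes "\<And>k. L2_lim M (F k) (G k)"
  shows "L2_lim M (\<lambda>n x. lincomb l (\<lambda>k. F k n x)) (\<lambda>x. lincomb l (\<lambda>k. G k x))"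
proof (induction l)
  case Nil
  then show ?case by (simp add: L2_lim_def sq_int_0 ip_def)
next
  case (Cons a l)
  then show ?case using L2_lim_add[OF L2_lim_scale[OF assms] Cons] by (cases a) simp
qed

lemma lincomb_lincomb:
  "\<exists>l'. \<forall>F :: 'i \<Rightarrow> 'v::real_vector. lincomb l (\<lambda>k. lincomb (L k) F) = lincomb l' F"
proof (induction l)
  case Nil
  show ?case by (rule exI[of _ "[]"]) simp
next
  case (Cons a l)
  obtain c k where a: "a = (c, k)" by (cases a)
  from Cons obtain l' where "\<forall>F :: 'i \<Rightarrow> 'v. lincomb l (\<lambda>k. lincomb (L k) F) = lincomb l' F" by blast
  then show ?case
    by (intro exI[of _ "map (\<lambda>(d, i). (c * d, i)) (L k) @ l'"]) (simp add: a lincomb_scale[where f="\<lambda>i. i"])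
qed

lemma sum_lincomb:
  "finite J \<Longrightarrow> \<exists>l'. \<forall>F :: 'i \<Rightarrow> 'v::real_vector. (\<Sum>j\<in>J. a j *\<^sub>R lincomb (L j) F) = lincomb l' F"
proof (induction J rule: finite_induct)
  case empty
  show ?case by (rule exI[of _ "[]"]) simp
next
  case (insert j J)
  from insert.IH obtain l' where "\<forall>F :: 'i \<Rightarrow> 'v. (\<Sum>j\<in>J. a j *\<^sub>R lincomb (L j) F) = lincomb l' F" by blast
  then show ?case using insert.hyps
    by (intro exI[of _ "map (\<lambda>(d, i). (a j * d, i)) (L j) @ l'"]) (simp add: lincomb_scale[where f="\<lambda>i. i"])
qed

text \<open>The definition of a Gaussian process tests with one vector for each time; a list may contain the
  same time with several coordinates, and these are collected in the vector \<open>v l t\<close>.\<close>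

lemma (in prob_space) gaussian_process_lincomb:
  fixes X :: "real \<Rightarrow> 'a \<Rightarrow> real ^ 'd"
  assumes G: "gaussian_process M X" and E: "\<And>t i. expectation (\<lambda>\<omega>. X t \<omega> $ i) = 0"
  shows "centred_gaussian M (\<lambda>\<omega>. lincomb l (\<lambda>(t, i). X t \<omega> $ i))"
proof -
  have X [measurable]: "X t \<in> borel_measurable M" for t using G by (simp add: gaussian_process_def)
  have Xi [measurable]: "(\<lambda>\<omega>. X t \<omega> $ i) \<in> borel_measurable M" for t i
    using borel_measurable_inner[OF X[of t] borel_measurable_const[of "axis i 1"]] by (simp add: cart_eq_inner_axis)
  have gl: "gaussian_law (distr M borel (\<lambda>\<omega>. \<Sum>t\<in>T. v t \<bullet> X t \<omega>))" if "finite T" for T v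
    using G that by (simp add: gaussian_process_def)
  have "centred_gaussian M (\<lambda>\<omega>. X t \<omega> $ i)" for t i
  proof (rule gaussian_law_centred)
    show "gaussian_law (distr M borel (\<lambda>\<omega>. X t \<omega> $ i))"
      using gl[of "{t}" "\<lambda>_. axis i 1"] by (simp add: cart_eq_inner_axis inner_commute)
  qed (simp_all add: E)
  then have sq: "sq_int M (\<lambda>\<omega>. X t \<omega> $ i)" for t i by (simp add: centred_gaussian_def)
  have int: "integrable M (\<lambda>\<omega>. X t \<omega> $ i)" for t i
    using integrable_inner[OF sq[of t i], of "\<lambda>_. 1"] by (simp add: sq_int_def)
  define v where "v l t = (\<Sum>(c, (s, i))\<leftarrow>l. if s = t then axis i c else (0 :: real ^ 'd))" for l :: "(real \<times> real \<times> 'd) list" and t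
  have eq: "lincomb l (\<lambda>(t, i). X t \<omega> $ i) = (\<Sum>t\<in>T. v l t \<bullet> X t \<omega>)" if "finite T" "fst ` snd ` set l \<subseteq> T" for l T \<omega>
    using that(2)
  proof (induction l)
    case Nil
    then show ?case by (simp add: v_def)
  next
    case (Cons a l)
    obtain c s i where a: "a = (c, (s, i))" by (cases a) auto
    have vc: "v (a # l) t = (if s = t then axis i c else 0) + v l t" for t by (simp add: v_def a)
    have "(\<Sum>t\<in>T. v (a # l) t \<bullet> X t \<omega>) = (\<Sum>t\<in>T. (if s = t then axis i c else 0) \<bullet> X t \<omega>) + (\<Sum>t\<in>T. v l t \<bullet> X t \<omega>)"
      by (simp add: vc inner_add_left sum.distrib)
    also have "(\<Sum>t\<in>T. (if s = t then axis i c else 0) \<bullet> X t \<omega>) = (\<Sum>t\<in>T. if s = t then axis i c \<bullet> X t \<omega> else 0)"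
      by (intro sum.cong) auto
    also have "\<dots> = c * X s \<omega> $ i"
      using Cons.prems \<open>finite T\<close> by (simp add: a inner_axis' )
    finally show ?case using Cons by (simp add: a)
  qed
  have El: "integrable M (\<lambda>\<omega>. lincomb l (\<lambda>(t, i). X t \<omega> $ i)) \<and> expectation (\<lambda>\<omega>. lincomb l (\<lambda>(t, i). X t \<omega> $ i)) = 0"
  proof (induction l)
    case (Cons a l)
    obtain c s i where a: "a = (c, (s, i))" by (cases a) auto
    show ?case using Cons by (simp add: a int E)
  qed simp
  show ?thesis
  proof (rule gaussian_law_centred)
    show "gaussian_law (distr M borel (\<lambda>\<omega>. lincomb l (\<lambda>(t, i). X t \<omega> $ i)))"
      using gl[of "fst ` snd ` set l" "v l"] by (simp add: eq[of "fst ` snd ` set l"])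
  qed (use El in auto)
qed

lemma sq_int_cong_AE:
  assumes "sq_int M f" "g \<in> borel_measurable M" "AE x in M. g x = f x"
  shows "sq_int M g"
proof -
  have [measurable]: "f \<in> borel_measurable M" "g \<in> borel_measurable M" using assms by (auto simp: sq_int_def)
  have "integrable M (\<lambda>x. g x \<bullet> g x) = integrable M (\<lambda>x. f x \<bullet> f x)"
    using assms(3) by (intro integrable_cong_AE) auto
  then show ?thesis using assms by (simp add: sq_int_def)
qed

lemma ip_cong_AE:
  assumes "sq_int M f" "sq_int M h" "sq_int M g" "sq_int M k" "AE x in M. g x = f x" "AE x in M. k x = h x"
  shows "ip M g k = ip M f h"
proof -
  have [measurable]: "f \<in> borel_measurable M" "g \<in> borel_measurable M" "h \<in> borel_measurable M" "k \<in> borel_measurable M"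
    using assms by (auto simp: sq_int_def)
  show ?thesis unfolding ip_def using assms(5,6) by (intro integral_cong_AE) auto
qed

lemma (in prob_space) centred_gaussian_cong_AE:
  assumes f: "centred_gaussian M f" and [measurable]: "g \<in> borel_measurable M" and e: "AE x in M. g x = f x"
  shows "centred_gaussian M g"
proof -
  have sf: "sq_int M f" using f by (simp add: centred_gaussian_def)
  then have [measurable]: "f \<in> borel_measurable M" by (simp add: sq_int_def)
  have sg: "sq_int M g" by (rule sq_int_cong_AE[OF sf _ e]) simp
  have "(CLINT \<omega>|M. iexp (u * g \<omega>)) = (CLINT \<omega>|M. iexp (u * f \<omega>))" for u
    using e by (intro integral_cong_AE) auto
  then show ?thesis using f sg ip_cong_AE[OF sf sf sg sg e e] by (simp add: centred_gaussian_def)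
qed

text \<open>The spectral functions are placed along the coordinate axes of \<open>complex ^ 'd\<close>, so that
  orthogonality of the axes mirrors the independence of the coordinates of \<open>X\<close>.\<close>

lemma (in prob_space) fractional_brownian_motion_whitening:
  fixes X :: "real \<Rightarrow> 'a \<Rightarrow> real ^ 'd"
  assumes H: "0 < H" "H < 1" and X: "fractional_brownian_motion M H X"
  obtains Y :: "real \<times> 'd \<Rightarrow> 'a \<Rightarrow> real" where "\<And>k. sq_int M (Y k)"
    "\<And>l. centred_gaussian M (\<lambda>\<omega>. lincomb l (\<lambda>k. Y k \<omega>))"
    "\<And>s i r j. ip M (Y (s, i)) (Y (r, j)) = (if i = j then (\<bar>s\<bar> + \<bar>r\<bar> - \<bar>s - r\<bar>) / 2 else 0)"
    "\<And>t i s j. ip M (\<lambda>\<omega>. X t \<omega> $ i) (Y (s, j)) = (if i = j then ip lborel (spectral H 1 t) (spectral (1/2) \<i> s) else 0)"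
proof -
  have G: "gaussian_process M X" and E: "\<And>t i. expectation (\<lambda>\<omega>. X t \<omega> $ i) = 0"
    and cov: "\<And>s t i j. expectation (\<lambda>\<omega>. X s \<omega> $ i * X t \<omega> $ j) =
        (if i = j then kappa H * (\<bar>t\<bar> powr (2 * H) + \<bar>s\<bar> powr (2 * H) - \<bar>t - s\<bar> powr (2 * H)) else 0)"
    using X by (auto simp: fractional_brownian_motion_def)
  define X' where "X' = (\<lambda>(t, i) \<omega>. X t \<omega> $ i)"
  define e where "e = (\<lambda>(t, i) \<xi>. axis i (spectral H 1 t \<xi>) :: complex ^ 'd)"
  define b where "b = (\<lambda>(s, i) \<xi>. axis i (spectral (1/2) \<i> s \<xi>) :: complex ^ 'd)"
  have gX: "centred_gaussian M (\<lambda>\<omega>. lincomb l (\<lambda>k. X' k \<omega>))" for l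
    using gaussian_process_lincomb[OF G E, of l] by (simp add: X'_def case_prod_unfold)
  have sqX: "sq_int M (X' k)" for k
    using gX[of "[(1, k)]"] by (simp add: centred_gaussian_def)
  have sqs: "sq_int lborel (spectral (1/2) \<i> s)" "sq_int lborel (spectral H 1 s)" for s
    by (rule spectral_gram; use H in simp)+
  have sqe: "sq_int lborel (e k)" "sq_int lborel (b k)" for k
    by (auto simp: e_def b_def case_prod_unfold intro!: axis_sq_int sqs)
  obtain Y L where Y: "\<And>k. sq_int M (Y k)"
    and L: "\<And>k. L2_lim M (\<lambda>n \<omega>. lincomb (L k n) (\<lambda>i. X' i \<omega>)) (Y k)"
    and YY: "\<And>k k'. ip M (Y k) (Y k') = ip lborel (b k) (b k')"
    and XY: "\<And>i k. ip M (X' i) (Y k) = ip lborel (e i) (b k)"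
  proof (rule gram_transfer[of M X' lborel e b])
    show "ip M (X' k) (X' k') = ip lborel (e k) (e k')" for k k'
    proof (cases k, cases k')
      fix t i s j assume k: "k = (t, i)" "k' = (s, j)"
      have "ip M (X' k) (X' k') = expectation (\<lambda>\<omega>. X t \<omega> $ i * X s \<omega> $ j)"
        by (simp add: ip_def X'_def k)
      also have "\<dots> = (if i = j then ip lborel (spectral H 1 t) (spectral H 1 s) else 0)"
        using spectral_gram(2)[OF H, of 1 t s] by (simp add: cov abs_minus_commute[of s t] algebra_simps)
      also have "\<dots> = ip lborel (e k) (e k')" by (simp add: e_def k axis_ip)
      finally show ?thesis .
    qed
    show "\<exists>l. sq_dist lborel (\<lambda>\<xi>. lincomb l (\<lambda>i. e i \<xi>)) (b k) < \<epsilon>" if "0 < \<epsilon>" for k \<epsilon>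
    proof (cases k)
      case (Pair s i)
      have "\<exists>l. sq_dist lborel (\<lambda>\<xi>. lincomb l (\<lambda>t. spectral H 1 t \<xi>)) (\<lambda>\<xi>. spectral (1/2) \<i> s \<xi>) < \<epsilon>"
        by (rule spectral_approx) (use H that in auto)
      then obtain l where l: "sq_dist lborel (\<lambda>\<xi>. lincomb l (\<lambda>t. spectral H 1 t \<xi>)) (\<lambda>\<xi>. spectral (1/2) \<i> s \<xi>) < \<epsilon>"
        by blast
      have e': "(\<lambda>k. e k \<xi>) = (\<lambda>(t, j). axis j (spectral H 1 t \<xi>))" for \<xi>
        by (simp add: e_def fun_eq_iff)
      have "lincomb (map (\<lambda>(c, t). (c, (t, i))) l) (\<lambda>k. e k \<xi>) - b k \<xi> = axis i (lincomb l (\<lambda>t. spectral H 1 t \<xi>) - spectral (1/2) \<i> s \<xi>)" for \<xi>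
        unfolding e' axis_lincomb by (simp add: b_def Pair axis_diff)
      then show ?thesis
        using l by (intro exI[of _ "map (\<lambda>(c, t). (c, (t, i))) l"]) (simp add: axis_ip)
    qed
  qed (auto intro: sqX sqe)
  show ?thesis
  proof (rule that[of Y])
    show "sq_int M (Y k)" for k by (rule Y)
    show "centred_gaussian M (\<lambda>\<omega>. lincomb l (\<lambda>k. Y k \<omega>))" for l
    proof (rule centred_gaussian_lim[OF L2_lim_lincomb[OF L]])
      fix n
      obtain l' where "\<forall>F :: real \<times> 'd \<Rightarrow> real. lincomb l (\<lambda>k. lincomb (L k n) F) = lincomb l' F"
        using lincomb_lincomb[of l "\<lambda>k. L k n"] by blast
      then show "centred_gaussian M (\<lambda>\<omega>. lincomb l (\<lambda>k. lincomb (L k n) (\<lambda>i. X' i \<omega>)))"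
        using gX[of l'] by simp
    qed
    show "ip M (Y (s, i)) (Y (r, j)) = (if i = j then (\<bar>s\<bar> + \<bar>r\<bar> - \<bar>s - r\<bar>) / 2 else 0)" for s i r j
      unfolding YY by (simp add: b_def axis_ip spectral_half_gram)
    show "ip M (\<lambda>\<omega>. X t \<omega> $ i) (Y (s, j)) = (if i = j then ip lborel (spectral H 1 t) (spectral (1/2) \<i> s) else 0)" for t i s j
      using XY[of "(t, i)" "(s, j)"] by (simp add: X'_def e_def b_def axis_ip)
  qed
qed


lemma ip_increments:
  assumes sq: "\<And>k. sq_int M (Y k)"
    and gram: "\<And>s i r j. ip M (Y (s, i)) (Y (r, j)) = (if i = j then (\<bar>s\<bar> + \<bar>r\<bar> - \<bar>s - r\<bar>) / 2 else 0)"
  shows "ip M (\<lambda>\<omega>. Y (b, i) \<omega> - Y (a, i) \<omega>) (\<lambda>\<omega>. Y (d, j) \<omega> - Y (c, j) \<omega>) =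
    (if i = j then (\<bar>b - c\<bar> + \<bar>a - d\<bar> - \<bar>b - d\<bar> - \<bar>a - c\<bar>) / 2 else 0)"
  by (simp add: ip_diff_left ip_diff_right sq_int_diff sq gram field_simps)

text \<open>The continuous versions are taken coordinatewise; they differ from \<open>Y\<close> on null sets only, so laws
  and scalar products are unchanged.  Over disjoint time intervals, or in different coordinates,
  increments are orthogonal.\<close>

lemma (in prob_space) brownian_motion_from_gaussian_family:
  fixes Y :: "real \<times> 'd::finite \<Rightarrow> 'a \<Rightarrow> real"
  assumes sq: "\<And>k. sq_int M (Y k)"
    and gauss: "\<And>l. centred_gaussian M (\<lambda>\<omega>. lincomb l (\<lambda>k. Y k \<omega>))"
    and gram: "\<And>s i r j. ip M (Y (s, i)) (Y (r, j)) = (if i = j then (\<bar>s\<bar> + \<bar>r\<bar> - \<bar>s - r\<bar>) / 2 else 0)"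
  obtains B :: "real \<Rightarrow> 'a \<Rightarrow> real ^ 'd" where "standard_brownian_motion M B"
    "\<And>t i. AE \<omega> in M. B t \<omega> $ i = Y (t, i) \<omega>"
proof -
  have [measurable]: "Y k \<in> borel_measurable M" for k using sq[of k] by (simp add: sq_int_def)
  have ginc: "centred_gaussian M (\<lambda>\<omega>. Y (t, i) \<omega> - Y (s, i) \<omega>)" for s t i
    using gauss[of "[(1, (t, i)), (-1, (s, i))]"] by simp
  have vinc: "sq_dist M (\<lambda>\<omega>. Y (t, i) \<omega>) (\<lambda>\<omega>. Y (s, i) \<omega>) = \<bar>t - s\<bar>" for s t i
    by (simp add: ip_increments[OF sq gram] abs_minus_commute)
  have "\<exists>Z. (\<forall>t. Z t \<in> borel_measurable M) \<and> (\<forall>\<omega>. continuous_on UNIV (\<lambda>t. Z t \<omega>)) \<and>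
      (\<forall>\<omega>. Z 0 \<omega> = 0) \<and> (\<forall>t. AE \<omega> in M. Z t \<omega> = Y (t, i) \<omega>)" for i
  proof -
    have mom: "(\<integral>\<^sup>+\<omega>. ennreal ((Y (t, i) \<omega> - Y (s, i) \<omega>)^4) \<partial>M) \<le> ennreal (3 * (t - s)^2)" for s t
      using centred_gaussian_fourth_moment[OF ginc, of t i s] by (simp only: vinc power2_abs)
    have zero: "AE \<omega> in M. Y (0, i) \<omega> = 0"
    proof -
      have "(\<integral>\<omega>. Y (0, i) \<omega> \<bullet> Y (0, i) \<omega> \<partial>M) = 0" using gram[of 0 i 0 i] by (simp add: ip_def)
      then have "AE \<omega> in M. Y (0, i) \<omega> \<bullet> Y (0, i) \<omega> = 0"
        using sq[of "(0, i)"] by (subst (asm) integral_nonneg_eq_0_iff_AE) (auto simp: sq_int_def)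
      then show ?thesis by eventually_elim simp
    qed
    obtain Z where "\<And>t. Z t \<in> borel_measurable M" "\<And>\<omega>. continuous_on UNIV (\<lambda>t. Z t \<omega>)"
      "\<And>\<omega>. Z 0 \<omega> = 0" "\<And>t. AE \<omega> in M. Z t \<omega> = Y (t, i) \<omega>"
      by (rule continuous_version[of M "\<lambda>t. Y (t, i)" 3]) (auto intro: mom zero prob_space_axioms)
    then show ?thesis by blast
  qed
  then have "\<exists>Z. \<forall>i. (\<forall>t. Z i t \<in> borel_measurable M) \<and> (\<forall>\<omega>. continuous_on UNIV (\<lambda>t. Z i t \<omega>)) \<and>
      (\<forall>\<omega>. Z i 0 \<omega> = 0) \<and> (\<forall>t. AE \<omega> in M. Z i t \<omega> = Y (t, i) \<omega>)"
    by (intro choice allI)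
  then obtain Z where Z: "\<And>i t. Z i t \<in> borel_measurable M" "\<And>i \<omega>. continuous_on UNIV (\<lambda>t. Z i t \<omega>)"
      "\<And>i \<omega>. Z i 0 \<omega> = 0" "\<And>i t. AE \<omega> in M. Z i t \<omega> = Y (t, i) \<omega>"
    by blast
  note [measurable] = Z(1)
  define B where "B t \<omega> = (\<chi> i. Z i t \<omega>)" for t \<omega>
  have Bi: "B t \<omega> $ i = Z i t \<omega>" for t \<omega> i by (simp add: B_def)
  have incAE: "AE \<omega> in M. B t \<omega> $ i - B s \<omega> $ i = Y (t, i) \<omega> - Y (s, i) \<omega>" for s t i
    using Z(4)[of i t] Z(4)[of i s] by eventually_elim (simp add: Bi)
  have incm: "(\<lambda>\<omega>. B t \<omega> $ i - B s \<omega> $ i) \<in> borel_measurable M" for s t i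
    by (simp add: Bi)
  have incsq: "sq_int M (\<lambda>\<omega>. B t \<omega> $ i - B s \<omega> $ i)" for s t i
    by (rule sq_int_cong_AE[OF sq_int_diff[OF sq sq] incm incAE])
  have incip: "ip M (\<lambda>\<omega>. B b \<omega> $ i - B a \<omega> $ i) (\<lambda>\<omega>. B d \<omega> $ j - B c \<omega> $ j) =
      (if i = j then (\<bar>b - c\<bar> + \<bar>a - d\<bar> - \<bar>b - d\<bar> - \<bar>a - c\<bar>) / 2 else 0)" for a b c d i j
    unfolding ip_cong_AE[OF sq_int_diff[OF sq sq] sq_int_diff[OF sq sq] incsq incsq incAE incAE]
    by (rule ip_increments[OF sq gram])
  have "standard_brownian_motion M B"
    unfolding standard_brownian_motion_def
  proof (intro conjI allI impI ballI)
    fix t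
    show "B t \<in> borel_measurable M"
    proof (rule borel_measurable_euclidean_space[THEN iffD2], rule ballI)
      fix v :: "real ^ 'd" assume "v \<in> Basis"
      then obtain i where "v = axis i 1" by (auto simp: Basis_vec_def)
      then show "(\<lambda>\<omega>. B t \<omega> \<bullet> v) \<in> borel_measurable M"
        by (simp add: cart_eq_inner_axis[symmetric] Bi)
    qed
  next
    show "continuous_paths M B"
      unfolding continuous_paths_def B_def by (intro ballI continuous_on_vec_lambda Z(2))
  next
    fix \<omega> show "B 0 \<omega> = 0" by (simp add: vec_eq_iff Bi Z(3))
  next
    fix s t :: real and i assume st: "s < t"
    show "distributed M lborel (\<lambda>\<omega>. B t \<omega> $ i - B s \<omega> $ i) (normal_density 0 (sqrt (t - s)))"
    proof (rule centred_gaussian_normal)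
      show "centred_gaussian M (\<lambda>\<omega>. B t \<omega> $ i - B s \<omega> $ i)"
        by (rule centred_gaussian_cong_AE[OF ginc incm incAE])
      show "sq_dist M (\<lambda>\<omega>. B t \<omega> $ i) (\<lambda>\<omega>. B s \<omega> $ i) = (sqrt (t - s))^2"
        using st by (simp add: incip)
      show "0 < sqrt (t - s)" using st by simp
    qed
  next
    fix n :: nat and \<tau> :: "nat \<Rightarrow> real" assume \<tau>: "strict_mono_on {..n} \<tau>"
    define W where "W = (\<lambda>(k, i) \<omega>. B (\<tau> (Suc k)) \<omega> $ i - B (\<tau> k) \<omega> $ i)"
    have "indep_vars (\<lambda>_. borel) W ({..<n} \<times> UNIV)"
    proof (rule indep_vars_orthogonal)
      show "sq_int M (W j)" for j using incsq by (cases j) (simp add: W_def)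
      fix a
      have "\<exists>l. \<forall>F :: real \<times> 'd \<Rightarrow> real.
          (\<Sum>j\<in>{..<n} \<times> (UNIV :: 'd set). a j *\<^sub>R lincomb [(1, (\<tau> (Suc (fst j)), snd j)), (-1, (\<tau> (fst j), snd j))] F) = lincomb l F"
        by (rule sum_lincomb) simp
      then obtain l where l: "\<forall>F :: real \<times> 'd \<Rightarrow> real.
          (\<Sum>j\<in>{..<n} \<times> (UNIV :: 'd set). a j *\<^sub>R lincomb [(1, (\<tau> (Suc (fst j)), snd j)), (-1, (\<tau> (fst j), snd j))] F) = lincomb l F"
        by blast
      have "AE \<omega> in M. \<forall>j\<in>{..<n} \<times> (UNIV :: 'd set). W j \<omega> = Y (\<tau> (Suc (fst j)), snd j) \<omega> - Y (\<tau> (fst j), snd j) \<omega>"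
        using incAE by (subst AE_ball_countable) (auto simp: W_def intro: countable_finite)
      then have ae: "AE \<omega> in M. (\<Sum>j\<in>{..<n} \<times> UNIV. a j * W j \<omega>) = lincomb l (\<lambda>k. Y k \<omega>)"
      proof eventually_elim
        case (elim \<omega>)
        have "(\<Sum>j\<in>{..<n} \<times> UNIV. a j * W j \<omega>) =
          (\<Sum>j\<in>{..<n} \<times> UNIV. a j *\<^sub>R lincomb [(1, (\<tau> (Suc (fst j)), snd j)), (-1, (\<tau> (fst j), snd j))] (\<lambda>k. Y k \<omega>))"
          using elim by (intro sum.cong) auto
        also have "\<dots> = lincomb l (\<lambda>k. Y k \<omega>)" using l by (rule spec)
        finally show ?case .
      qed
      have m: "W j \<in> borel_measurable M" for j using incm by (cases j) (simp add: W_def)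
      show "centred_gaussian M (\<lambda>\<omega>. \<Sum>j\<in>{..<n} \<times> UNIV. a j * W j \<omega>)"
        by (rule centred_gaussian_cong_AE[OF gauss _ ae]) (intro borel_measurable_sum borel_measurable_times borel_measurable_const m)
    next
      fix p q assume pq: "p \<in> {..<n} \<times> (UNIV :: 'd set)" "q \<in> {..<n} \<times> UNIV" "p \<noteq> q"
      obtain k i where p: "p = (k, i)" by (cases p)
      obtain m j where q: "q = (m, j)" by (cases q)
      have less: "\<tau> k < \<tau> (Suc k)" if "k < n" for k
        using strict_mono_onD[OF \<tau>, of k "Suc k"] that by simp
      have le: "\<tau> (Suc k) \<le> \<tau> m" if "k < m" "m < n" for k m
        using strict_mono_on_leD[OF \<tau>, of "Suc k" m] that by simp
      have km: "k < n" "m < n" using pq p q by auto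
      show "ip M (W p) (W q) = 0"
      proof (cases "i = j")
        case True
        then consider "k < m" | "m < k" using pq p q by fastforce
        then show ?thesis
        proof cases
          case 1
          then show ?thesis using less[OF km(1)] less[OF km(2)] le[OF 1 km(2)] True by (simp add: W_def p q incip)
        next
          case 2
          then show ?thesis using less[OF km(1)] less[OF km(2)] le[OF 2 km(1)] True by (simp add: W_def p q incip)
        qed
      qed (simp add: W_def p q incip)
    qed simp
    then show "prob_space.indep_vars M (\<lambda>_. borel) (\<lambda>(k, i) \<omega>. B (\<tau> (Suc k)) \<omega> $ i - B (\<tau> k) \<omega> $ i) ({..<n} \<times> UNIV)"
      by (simp add: W_def)
  qed
  then show ?thesis using Z(4) by (intro that[of B]) (simp_all add: Bi)
qed

text \<open>For \<open>s < 0\<close> the interval is coded as \<open>(- c, s, 0)\<close>, whose integral \<open>- c * (B 0 - B s)\<close> is again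
  \<open>c * B s\<close>.\<close>

lemma step_code_signed_ind:
  defines "code \<equiv> map (\<lambda>(c, s). if 0 \<le> s then (c, 0, s) else (- c, s, 0 :: real))"
  shows "valid_step (code l)"
    and "step_fun (code l) u = lincomb l (\<lambda>s. signed_ind s u)"
    and "B 0 \<omega> = 0 \<Longrightarrow> step_integral B (code l) \<omega> = lincomb l (\<lambda>s. B s \<omega>)"
proof -
  show "valid_step (code l)" by (auto simp: valid_step_def code_def split: if_splits)
  show "step_fun (code l) u = lincomb l (\<lambda>s. signed_ind s u)"
    by (induction l) (auto simp: step_fun_def code_def signed_ind_def)
  show "step_integral B (code l) \<omega> = lincomb l (\<lambda>s. B s \<omega>)" if "B 0 \<omega> = 0"
    using that by (induction l) (auto simp: step_integral_def code_def algebra_simps)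
qed

theorem mainTheorem5:
  fixes M :: "'a measure" and H :: real and X :: "real \<Rightarrow> 'a \<Rightarrow> real ^ 'd"
  assumes "prob_space M"
    and "0 < H" and "H < 1"
    and "fractional_brownian_motion M H X"
  shows "\<exists>B :: real \<Rightarrow> 'a \<Rightarrow> real ^ 'd. standard_brownian_motion M B \<and>
    (\<forall>t. \<exists>Y. has_wiener_integral M B
                (\<lambda>u. S_kernel (H + 1/2) u - S_kernel (H + 1/2) (u - t)) Y \<and>
              (AE \<omega> in M. X t \<omega> = Y \<omega>))"
proof -
  interpret prob_space M by fact
  note H = assms(2,3)
  obtain Y where Y: "\<And>k. sq_int M (Y k)" "\<And>l. centred_gaussian M (\<lambda>\<omega>. lincomb l (\<lambda>k. Y k \<omega>))"
    and YY: "\<And>s i r j. ip M (Y (s, i)) (Y (r, j)) = (if i = j then (\<bar>s\<bar> + \<bar>r\<bar> - \<bar>s - r\<bar>) / 2 else 0)"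
    and XY: "\<And>t (i :: 'd) s j. ip M (\<lambda>\<omega>. X t \<omega> $ i) (Y (s, j)) = (if i = j then ip lborel (spectral H 1 t) (spectral (1/2) \<i> s) else 0)"
    using fractional_brownian_motion_whitening[OF H assms(4)] by blast
  obtain B :: "real \<Rightarrow> 'a \<Rightarrow> real ^ 'd" where B: "standard_brownian_motion M B"
    and BY: "\<And>t i. AE \<omega> in M. B t \<omega> $ i = Y (t, i) \<omega>"
    using brownian_motion_from_gaussian_family[OF Y YY] by blast
  have G: "gaussian_process M X" and E: "\<And>t i. expectation (\<lambda>\<omega>. X t \<omega> $ i) = 0"
    and cov: "\<And>s t i j. expectation (\<lambda>\<omega>. X s \<omega> $ i * X t \<omega> $ j) =
        (if i = j then kappa H * (\<bar>t\<bar> powr (2 * H) + \<bar>s\<bar> powr (2 * H) - \<bar>t - s\<bar> powr (2 * H)) else 0)"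
    using assms(4) by (auto simp: fractional_brownian_motion_def)
  have X: "X t \<in> borel_measurable M" for t using G by (simp add: gaussian_process_def)
  have Bm: "B t \<in> borel_measurable M" and B0: "\<And>\<omega>. \<omega> \<in> space M \<Longrightarrow> B 0 \<omega> = 0" for t
    using B by (auto simp: standard_brownian_motion_def)
  have nth: "(\<lambda>\<omega>. f \<omega> $ i) \<in> borel_measurable M" if "f \<in> borel_measurable M" for f :: "'a \<Rightarrow> real ^ 'd" and i
    using borel_measurable_inner[OF that borel_measurable_const[of "axis i 1"]] by (simp add: cart_eq_inner_axis)
  have sqX: "sq_int M (\<lambda>\<omega>. X t \<omega> $ i)" for t i
    using gaussian_process_lincomb[OF G E, of "[(1, (t, i))]"] by (simp add: centred_gaussian_def)
  have sqB: "sq_int M (\<lambda>\<omega>. B t \<omega> $ i)" for t i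
    by (rule sq_int_cong_AE[OF Y(1) nth[OF Bm] BY])
  have BB: "ip M (\<lambda>\<omega>. B s \<omega> $ i) (\<lambda>\<omega>. B r \<omega> $ i) = ip lborel (spectral (1/2) \<i> s) (spectral (1/2) \<i> r)" for s r i
    using ip_cong_AE[OF Y(1) Y(1) sqB sqB BY BY] by (simp add: YY spectral_half_gram)
  have BX: "ip M (\<lambda>\<omega>. B s \<omega> $ i) (\<lambda>\<omega>. X t \<omega> $ i) = ip lborel (spectral (1/2) \<i> s) (spectral H 1 t)" for s t i
    using ip_cong_AE[OF Y(1) sqX sqB sqX BY AE_I2[OF refl], of s i t i] XY[of t i s i]
    by (simp add: ip_commute[of M "Y _"] ip_commute[of lborel "spectral (1/2) \<i> s"])
  have XX: "ip M (\<lambda>\<omega>. X t \<omega> $ i) (\<lambda>\<omega>. X t \<omega> $ i) = ip lborel (spectral H 1 t) (spectral H 1 t)" for t i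
    using cov[of t i t i] by (simp add: ip_def[of M] spectral_gram(2)[OF H])
  have sqs: "sq_int lborel (spectral (1/2) \<i> s)" "sq_int lborel (spectral H 1 s)" for s
    by (rule spectral_gram; use H in simp)+
  have "has_wiener_integral M B (\<lambda>u. S_kernel (H + 1/2) u - S_kernel (H + 1/2) (u - t)) (X t)" for t
  proof -
    obtain L where L: "L2_lim lborel (\<lambda>n \<xi>. lincomb (L n) (\<lambda>s. spectral (1/2) \<i> s \<xi>)) (spectral H 1 t)"
      and K: "(\<lambda>n. \<integral>\<^sup>+u. ennreal ((lincomb (L n) (\<lambda>s. signed_ind s u) - (S_kernel (H + 1/2) u - S_kernel (H + 1/2) (u - t)))^2) \<partial>lborel) \<longlonglongrightarrow> 0"
      by (rule kernel_approx[OF H])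
    define p where "p n = map (\<lambda>(c, s). if 0 \<le> s then (c, 0, s) else (- c, s, 0)) (L n)" for n
    define D where "D n = sq_dist lborel (\<lambda>\<xi>. lincomb (L n) (\<lambda>s. spectral (1/2) \<i> s \<xi>)) (spectral H 1 t)" for n
    have D0: "D \<longlonglongrightarrow> 0" using L by (simp add: L2_lim_def D_def[abs_def])
    have iso: "sq_dist M (\<lambda>\<omega>. lincomb (L n) (\<lambda>s. B s \<omega> $ i)) (\<lambda>\<omega>. X t \<omega> $ i) = D n" for n i
      unfolding D_def by (simp only: ip_lincomb_diff sqB sqX sqs BB BX XX)
    have nn: "(\<integral>\<^sup>+\<omega>. ennreal ((norm (step_integral B (p n) \<omega> - X t \<omega>))\<^sup>2) \<partial>M) = of_nat CARD('d) * ennreal (D n)" for n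
    proof -
      have sq: "sq_int M (\<lambda>\<omega>. lincomb (L n) (\<lambda>s. B s \<omega> $ i) - X t \<omega> $ i)" for i
        by (intro sq_int_diff sq_int_lincomb sqB sqX)
      have m: "(\<lambda>\<omega>. lincomb (L n) (\<lambda>s. B s \<omega> $ i) - X t \<omega> $ i) \<in> borel_measurable M" for i
        using sq[of i] by (simp add: sq_int_def)
      have "(\<integral>\<^sup>+\<omega>. ennreal ((norm (step_integral B (p n) \<omega> - X t \<omega>))\<^sup>2) \<partial>M) =
        (\<integral>\<^sup>+\<omega>. (\<Sum>i\<in>UNIV. ennreal ((lincomb (L n) (\<lambda>s. B s \<omega> $ i) - X t \<omega> $ i) \<bullet> (lincomb (L n) (\<lambda>s. B s \<omega> $ i) - X t \<omega> $ i))) \<partial>M)"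
      proof (rule nn_integral_cong)
        fix \<omega> assume "\<omega> \<in> space M"
        then have s: "step_integral B (p n) \<omega> = lincomb (L n) (\<lambda>s. B s \<omega>)"
          unfolding p_def by (intro step_code_signed_ind B0)
        have "linear (\<lambda>v :: real ^ 'd. v $ i)" for i by (rule linearI) auto
        then have c: "lincomb (L n) (\<lambda>s. B s \<omega>) $ i = lincomb (L n) (\<lambda>s. B s \<omega> $ i)" for i
          by (rule lincomb_linear)
        show "ennreal ((norm (step_integral B (p n) \<omega> - X t \<omega>))\<^sup>2) =
          (\<Sum>i\<in>UNIV. ennreal ((lincomb (L n) (\<lambda>s. B s \<omega> $ i) - X t \<omega> $ i) \<bullet> (lincomb (L n) (\<lambda>s. B s \<omega> $ i) - X t \<omega> $ i)))"
          unfolding s power2_norm_eq_inner inner_vec_def[of _ "_ :: real ^ 'd"]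
          by (subst sum_ennreal) (simp_all add: c)
      qed
      also have "\<dots> = (\<Sum>i\<in>(UNIV :: 'd set). \<integral>\<^sup>+\<omega>. ennreal ((lincomb (L n) (\<lambda>s. B s \<omega> $ i) - X t \<omega> $ i) \<bullet> (lincomb (L n) (\<lambda>s. B s \<omega> $ i) - X t \<omega> $ i)) \<partial>M)"
        by (intro nn_integral_sum measurable_compose[OF _ measurable_ennreal] borel_measurable_inner m)
      also have "\<dots> = (\<Sum>i\<in>(UNIV :: 'd set). ennreal (D n))"
        by (intro sum.cong refl) (simp only: nn_integral_inner_self[OF sq] iso)
      finally show ?thesis by simp
    qed
    have "(\<lambda>n. of_nat CARD('d) * ennreal (D n)) \<longlonglongrightarrow> of_nat CARD('d) * ennreal 0"
      by (intro tendsto_mult_ennreal tendsto_const tendsto_ennrealI D0) auto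
    then have "(\<lambda>n. \<integral>\<^sup>+\<omega>. ennreal ((norm (step_integral B (p n) \<omega> - X t \<omega>))\<^sup>2) \<partial>M) \<longlonglongrightarrow> 0"
      unfolding nn by simp
    moreover have "valid_step (p n)" for n unfolding p_def by (rule step_code_signed_ind)
    moreover have "(\<lambda>n. \<integral>\<^sup>+u. ennreal ((step_fun (p n) u - (S_kernel (H + 1/2) u - S_kernel (H + 1/2) (u - t)))\<^sup>2) \<partial>lborel) \<longlonglongrightarrow> 0"
      using K unfolding p_def step_code_signed_ind(2) .
    moreover have "(\<lambda>u. S_kernel (H + 1/2) u - S_kernel (H + 1/2) (u - t)) \<in> borel_measurable lborel"
      by measurable
    ultimately show ?thesis using X unfolding has_wiener_integral_def by blast
  qed
  then show ?thesis using B by blast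
qed

end
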